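(* Let $(X^\delta,Y^\delta)_{\delta\in\Delta}$ be a family of pairs of closed, non-zero subspaces $X^\delta\subset X$, $Y^\delta\subset Y$ such that $$\gamma_\Delta^{C}:=\inf_{\delta\in\Delta}\ \inf_{\{0\neq w\in X^\delta:\ Cw\neq0\}}\frac{\|(Cw)|_{Y^\delta}\|_{(Y^\delta)'}}{\|Cw\|_{Y'}}>0 .$$ Let $\beta\ge1$, $g\in Y'$, $u_0\in H$, and let $u\in X$ be the solution of $Bu=g$, $\gamma_0u=u_0$. (a) (MR) Assume in addition that $X^\delta\subseteq Y^\delta$ for all $\delta\in\Delta$, and that for each $\delta\in\Delta$ there is given a symmetric boundedly invertible linear map $K_Y^\delta:(Y^\delta)'\to Y^\delta$ such that, for some constants $0<r_\Delta\le R_\Delta<\infty$, $r_\Delta\,(A_sv)(v)\le((K_Y^\delta)^{-1}v)(v)\le R_\Delta\,(A_sv)(v)$ for all $\delta\in\Delta$, $v\in Y^\delta$. Then the solution $u^\delta\in X^\delta$ of $$(Bw)\big(K_Y^\delta((Bu^\delta)|_{Y^\delta})\big)+\beta\langle\gamma_0u^\delta,\gamma_0w\rangle=(Bw)\big(K_Y^\delta(g|_{Y^\delta})\big)+\beta\langle u_0,\gamma_0w\rangle\qquad(w\in X^\delta)$$ satisfies $$|\!|\!|u-u^\delta|\!|\!|_X\le\sqrt{\tfrac{\max(R_\Delta,1)}{\min(r_\Delta,1)}}\,(\gamma_\Delta^C)^{-1}\inf_{w\in X^\delta}|\!|\!|u-w|\!|\!|_X .$$ (b) (BEN) (Without the additional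 assumptions of (a).) The solution $\bar u^\delta\in X^\delta$ of $$(Cw)(R^\delta C\bar u^\delta)+(A_s\bar u^\delta)(w)+\langle\gamma_T\bar u^\delta,\gamma_Tw\rangle+(\beta-1)\langle\gamma_0\bar u^\delta,\gamma_0w\rangle=(Cw)(R^\delta g)+g(w)+\beta\langle u_0,\gamma_0w\rangle\quad(w\in X^\delta)$$ satisfies $$|\!|\!|u-\bar u^\delta|\!|\!|_X\le(\gamma_\Delta^C)^{-2}\Big\{\inf_{w\in X^\delta}|\!|\!|u-w|\!|\!|_X+\inf_{v\in Y^\delta}\|u-v\|_Y\Big\}.$$
   Context: All spaces are over $\mathbb R$. $V,H$ are separable Hilbert spaces with $V\hookrightarrow H$ continuously and densely; $H$ is identified with its dual, giving the Gelfand triple $V\hookrightarrow H\simeq H'\hookrightarrow V'$. $\langle\cdot,\cdot\rangle$ denotes the scalar product on $H$ and its extension to the duality pairing on $V'\times V$ (or $V\times V'$); $\|\cdot\|$ is the norm of $H$. $I=(0,T)$. For a.e. $t\in I$, $a(t;\cdot,\cdot)$ is a bilinear form on $V\times V$, measurable in $t$ for each fixed pair of arguments, and, with constants independent of $t$, bounded, $|a(t;\eta,\zeta)|\lesssim\|\eta\|_V\|\zeta\|_V$, and coercive, $a(t;\eta,\eta)\gtrsim\|\eta\|_V^2$, for $\eta,\zeta\in V$. $X:=L_2(I;V)\cap H^1(I;V')$, $Y:=L_2(I;V)$. $\gamma_t:X\to H$, $u\mapsto u(t,\cdot)$, $t\in\bar I$, is the trace map. Operators: $A:Y\to Y'$,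 $(Aw)(v):=\int_I a(t;w(t),v(t))\,dt$; $A_s:=\frac12(A+A')$; $A_a:=\frac12(A-A')$; $\partial_t:X\to Y'$, $(\partial_tw)(v):=\int_I\langle\frac{dw}{dt}(t),v(t)\rangle\,dt$; $B:=\partial_t+A:X\to Y'$; $C:=B-A_s=\partial_t+A_a:X\to Y'$. Under these assumptions $(B,\gamma_0):X\to Y'\times H$ is boundedly invertible (known), so $Bu=g$, $\gamma_0u=u_0$ has a unique solution $u\in X$. Norms: $Y$ is equipped with $\|v\|_Y:=\sqrt{(A_sv)(v)}$ (equivalent to the standard norm), $Y'$ with the resulting dual norm, $Y^\delta$ with $\|\cdot\|_Y$ and $(Y^\delta)'$ with the resulting dual norm. For the constant $\beta\ge1$, the energy-norm on $X$ is $|\!|\!|w|\!|\!|_X:=\sqrt{\|Bw\|_{Y'}^2+\beta\|\gamma_0w\|^2}$. For $f\in Y'$, $f|_{Y^\delta}\in(Y^\delta)'$ is its restriction, and $R^\delta f\in Y^\delta$ denotes the unique element with $(A_sR^\delta f)(v)=f(v)$ for all $v\in Y^\delta$. Symmetry of $K_Y^\delta$ means $f(K_Y^\delta h)=h(K_Y^\delta f)$ for $f,h\in(Y^\delta)'$. *)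

theory Defs
  imports "HOL-Analysis.Analysis"
begin

definition sq_integrable :: "(real \<Rightarrow> 'a::{real_inner,second_countable_topology}) \<Rightarrow> bool" where
  "sq_integrable f \<longleftrightarrow> f \<in> borel_measurable lebesgue \<and> integrable lebesgue (\<lambda>t. (norm (f t))\<^sup>2)"

definition l2_rel :: "(real \<Rightarrow> 'a::{real_inner,second_countable_topology}) \<Rightarrow> (real \<Rightarrow> 'a) \<Rightarrow> bool" where
  "l2_rel f g \<longleftrightarrow> sq_integrable f \<and> sq_integrable g \<and> (AE t in lebesgue. f t = g t)"

lemma sq_integrable_zero: "sq_integrable (\<lambda>t. 0)"
  by (simp add: sq_integrable_def)

lemma sq_integrable_inner:
  assumes "sq_integrable f" "sq_integrable g"
  shows "integrable lebesgue (\<lambda>t. f t \<bullet> g t)"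
proof (rule Bochner_Integration.integrable_bound)
  show "integrable lebesgue (\<lambda>t. (norm (f t))\<^sup>2 + (norm (g t))\<^sup>2)"
    using assms by (auto simp: sq_integrable_def)
  show "(\<lambda>t. f t \<bullet> g t) \<in> borel_measurable lebesgue"
    using assms by (auto simp: sq_integrable_def)
  show "AE t in lebesgue. norm (f t \<bullet> g t) \<le> norm ((norm (f t))\<^sup>2 + (norm (g t))\<^sup>2)"
  proof (rule AE_I2)
    fix t
    have "\<bar>f t \<bullet> g t\<bar> \<le> norm (f t) * norm (g t)" by (rule Cauchy_Schwarz_ineq2)
    moreover have "2 * (norm (f t) * norm (g t)) \<le> (norm (f t))\<^sup>2 + (norm (g t))\<^sup>2"
      using sum_squares_bound[of "norm (f t)" "norm (g t)"] by simp
    moreover have "0 \<le> norm (f t) * norm (g t)" by simp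
    ultimately show "norm (f t \<bullet> g t) \<le> norm ((norm (f t))\<^sup>2 + (norm (g t))\<^sup>2)"
      unfolding real_norm_def by linarith
  qed
qed

lemma sq_integrable_add:
  assumes "sq_integrable f" "sq_integrable g"
  shows "sq_integrable (\<lambda>t. f t + g t)"
proof -
  have "integrable lebesgue (\<lambda>t. (norm (f t))\<^sup>2 + 2 * (f t \<bullet> g t) + (norm (g t))\<^sup>2)"
    using assms sq_integrable_inner[OF assms] by (auto simp: sq_integrable_def)
  moreover have "(norm (f t + g t))\<^sup>2 = (norm (f t))\<^sup>2 + 2 * (f t \<bullet> g t) + (norm (g t))\<^sup>2" for t
    by (simp add: power2_norm_eq_inner inner_add_left inner_add_right inner_commute)
  ultimately show ?thesis
    using assms by (auto simp: sq_integrable_def)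
qed

lemma sq_integrable_scaleR:
  assumes "sq_integrable f"
  shows "sq_integrable (\<lambda>t. c *\<^sub>R f t)"
  using assms by (auto simp: sq_integrable_def power_mult_distrib)

quotient_type (overloaded) 'a l2 = "real \<Rightarrow> 'a::{real_inner,second_countable_topology}" / partial: l2_rel
proof (rule part_equivpI)
  show "\<exists>f. l2_rel f f"
    using sq_integrable_zero by (auto simp: l2_rel_def)
  show "symp l2_rel"
    by (auto simp: symp_def l2_rel_def)
  show "transp l2_rel"
    by (auto simp: transp_def l2_rel_def elim: AE_mp)
qed

instantiation l2 :: ("{real_inner,second_countable_topology}") real_inner
begin

lift_definition zero_l2 :: "'a l2" is "\<lambda>t. 0"
  by (simp add: l2_rel_def sq_integrable_zero)

lift_definition plus_l2 :: "'a l2 \<Rightarrow> 'a l2 \<Rightarrow> 'a l2" is "\<lambda>f g t. f t + g t"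
  by (auto simp: l2_rel_def intro: sq_integrable_add)

lift_definition scaleR_l2 :: "real \<Rightarrow> 'a l2 \<Rightarrow> 'a l2" is "\<lambda>c f t. c *\<^sub>R f t"
  by (auto simp: l2_rel_def intro: sq_integrable_scaleR)

definition uminus_l2 :: "'a l2 \<Rightarrow> 'a l2" where "uminus_l2 x = (-1) *\<^sub>R x"

definition minus_l2 :: "'a l2 \<Rightarrow> 'a l2 \<Rightarrow> 'a l2" where "minus_l2 x y = x + (-1) *\<^sub>R y"

lift_definition inner_l2 :: "'a l2 \<Rightarrow> 'a l2 \<Rightarrow> real" is "\<lambda>f g. LINT t|lebesgue. f t \<bullet> g t"
proof -
  fix f f' g g' :: "real \<Rightarrow> 'a"
  assume "l2_rel f f'" "l2_rel g g'"
  then show "(LINT t|lebesgue. f t \<bullet> g t) = (LINT t|lebesgue. f' t \<bullet> g' t)"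
    unfolding l2_rel_def by (intro integral_cong_AE) (auto simp: sq_integrable_def)
qed

definition norm_l2 :: "'a l2 \<Rightarrow> real" where "norm_l2 x = sqrt (x \<bullet> x)"

definition dist_l2 :: "'a l2 \<Rightarrow> 'a l2 \<Rightarrow> real" where "dist_l2 x y = norm (x - y)"

definition sgn_l2 :: "'a l2 \<Rightarrow> 'a l2" where "sgn_l2 x = inverse (norm x) *\<^sub>R x"

definition uniformity_l2 :: "('a l2 \<times> 'a l2) filter" where
  "uniformity_l2 = (INF e\<in>{0 <..}. principal {(x, y). dist x y < e})"

definition open_l2 :: "'a l2 set \<Rightarrow> bool" where
  "open_l2 U \<longleftrightarrow> (\<forall>x\<in>U. eventually (\<lambda>(x', y). x' = x \<longrightarrow> y \<in> U) uniformity)"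

instance
proof
  fix x y z :: "'a l2" and c d :: real
  show "x + y + z = x + (y + z)"
    by transfer (auto simp: l2_rel_def add.assoc intro!: sq_integrable_add)
  show "x + y = y + x"
    by transfer (auto simp: l2_rel_def add.commute intro!: sq_integrable_add)
  show "0 + x = x"
    by transfer (auto simp: l2_rel_def)
  show "- x + x = 0"
    unfolding uminus_l2_def
    by transfer (auto simp: l2_rel_def intro!: sq_integrable_add sq_integrable_scaleR sq_integrable_zero)
  show "x - y = x + - y"
    by (simp add: uminus_l2_def minus_l2_def)
  show "c *\<^sub>R (x + y) = c *\<^sub>R x + c *\<^sub>R y"
    by transfer (auto simp: l2_rel_def scaleR_add_right intro!: sq_integrable_add sq_integrable_scaleR)
  show "(c + d) *\<^sub>R x = c *\<^sub>R x + d *\<^sub>R x"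
    by transfer (auto simp: l2_rel_def scaleR_add_left intro!: sq_integrable_add sq_integrable_scaleR)
  show "c *\<^sub>R d *\<^sub>R x = (c * d) *\<^sub>R x"
    by transfer (auto simp: l2_rel_def intro!: sq_integrable_scaleR)
  show "1 *\<^sub>R x = x"
    by transfer (auto simp: l2_rel_def)
  show "dist x y = norm (x - y)"
    by (simp add: dist_l2_def)
  show "sgn x = inverse (norm x) *\<^sub>R x"
    by (simp add: sgn_l2_def)
  show "(uniformity :: ('a l2 \<times> 'a l2) filter) = (INF e\<in>{0 <..}. principal {(x, y). dist x y < e})"
    by (simp add: uniformity_l2_def)
  show "open U \<longleftrightarrow> (\<forall>x\<in>U. eventually (\<lambda>(x', y). x' = x \<longrightarrow> y \<in> U) uniformity)" for U :: "'a l2 set"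
    by (simp add: open_l2_def)
  show "x \<bullet> y = y \<bullet> x"
    by transfer (simp add: inner_commute)
  show "(x + y) \<bullet> z = x \<bullet> z + y \<bullet> z"
    by transfer (auto simp: l2_rel_def inner_add_left sq_integrable_inner intro!: Bochner_Integration.integral_add)
  show "(c *\<^sub>R x) \<bullet> y = c * (x \<bullet> y)"
    by transfer simp
  show "0 \<le> x \<bullet> x"
    by transfer (auto intro!: Bochner_Integration.integral_nonneg)
  show "x \<bullet> x = 0 \<longleftrightarrow> x = 0"
  proof transfer
    fix f :: "real \<Rightarrow> 'a"
    assume "l2_rel f f"
    then have f: "sq_integrable f" by (simp add: l2_rel_def)
    have "(LINT t|lebesgue. f t \<bullet> f t) = 0 \<longleftrightarrow> (AE t in lebesgue. f t \<bullet> f t = 0)"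
      by (rule integral_nonneg_eq_0_iff_AE[OF sq_integrable_inner[OF f f]]) simp
    then show "(LINT t|lebesgue. f t \<bullet> f t) = 0 \<longleftrightarrow> l2_rel f (\<lambda>t. 0)"
      using f by (simp add: l2_rel_def sq_integrable_zero)
  qed
  show "norm x = sqrt (x \<bullet> x)"
    by (simp add: norm_l2_def)
qed

end

text \<open>\<open>L\<^sub>2((0,T);V)\<close>, extended by zero to the real line; it is a closed subspace of the type
  \<open>'v l2\<close>, whose norm restricts to the usual one.  (A type cannot depend on \<open>T\<close>.)\<close>

definition L2I :: "real \<Rightarrow> ('v::{real_inner,second_countable_topology}) l2 set" where
  "L2I T = {w. AE t in lebesgue. t \<notin> {0<..<T} \<longrightarrow> rep_l2 w t = 0}"

text \<open>Representatives of \<open>L\<^sub>2((0,T);V')\<close>, the dual \<open>V'\<close> being the type \<open>'v \<Rightarrow>\<^sub>L real\<close> with the operator norm.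
  As \<open>V'\<close> is separable for a separable Hilbert space \<open>V\<close>, Borel and strong measurability coincide.\<close>

definition L2I_dual :: "real \<Rightarrow> (real \<Rightarrow> 'v::real_normed_vector \<Rightarrow>\<^sub>L real) \<Rightarrow> bool" where
  "L2I_dual T f \<longleftrightarrow> f \<in> borel_measurable (lebesgue_on {0<..<T}) \<and>
     integrable (lebesgue_on {0<..<T}) (\<lambda>t. (norm (f t))\<^sup>2)"

definition test_function :: "real \<Rightarrow> (real \<Rightarrow> real) \<Rightarrow> bool" where
  "test_function T \<phi> \<longleftrightarrow> (\<forall>k. (deriv ^^ k) \<phi> differentiable_on UNIV) \<and>
     compact (closure {t. \<phi> t \<noteq> 0}) \<and> closure {t. \<phi> t \<noteq> 0} \<subseteq> {0<..<T}"

definition dense_embedding :: "('v::real_normed_vector \<Rightarrow> 'h::real_normed_vector) \<Rightarrow> bool" where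
  "dense_embedding j \<longleftrightarrow> bounded_linear j \<and> inj j \<and> closure (range j) = UNIV"

text \<open>Through \<open>V \<hookrightarrow> H \<simeq> H' \<hookrightarrow> V'\<close>, the element \<open>x\<close> of \<open>V\<close> acts as the functional
  \<open>\<eta> \<mapsto> \<langle>j x, j \<eta>\<rangle>\<close>.  The defining identity \<open>\<integral> \<phi>' w = - \<integral> \<phi> w'\<close> in \<open>V'\<close> is written out
  by applying both sides to an arbitrary \<open>\<eta>\<close>, because the Bochner integral of the library
  is not available for the type \<open>'v \<Rightarrow>\<^sub>L real\<close>.\<close>

definition has_weak_deriv ::
  "real \<Rightarrow> ('v::{real_inner,second_countable_topology} \<Rightarrow> 'h::real_inner) \<Rightarrow>
    'v l2 \<Rightarrow> (real \<Rightarrow> 'v \<Rightarrow>\<^sub>L real) \<Rightarrow> bool" where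
  "has_weak_deriv T j w w' \<longleftrightarrow> L2I_dual T w' \<and>
     (\<forall>\<phi> \<eta>. test_function T \<phi> \<longrightarrow>
        (LINT t|lebesgue_on {0<..<T}. deriv \<phi> t * (j (rep_l2 w t) \<bullet> j \<eta>)) =
        - (LINT t|lebesgue_on {0<..<T}. \<phi> t * blinfun_apply (w' t) \<eta>))"

definition weak_deriv ::
  "real \<Rightarrow> ('v::{real_inner,second_countable_topology} \<Rightarrow> 'h::real_inner) \<Rightarrow>
    'v l2 \<Rightarrow> real \<Rightarrow> 'v \<Rightarrow>\<^sub>L real" where
  "weak_deriv T j w = (SOME w'. has_weak_deriv T j w w')"

definition spaceX ::
  "real \<Rightarrow> ('v::{real_inner,second_countable_topology} \<Rightarrow> 'h::real_inner) \<Rightarrow> 'v l2 set" where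
  "spaceX T j = {w \<in> L2I T. \<exists>w'. has_weak_deriv T j w w'}"

text \<open>The term \<open>\<parallel>w\<parallel>\<^sup>2\<close> in \<open>L\<^sub>2(I;V')\<close> is dominated by the one in \<open>L\<^sub>2(I;V)\<close> and therefore omitted;
  the norm is only used for its topology.\<close>

definition normX ::
  "real \<Rightarrow> ('v::{real_inner,second_countable_topology} \<Rightarrow> 'h::real_inner) \<Rightarrow> 'v l2 \<Rightarrow> real" where
  "normX T j w =
     sqrt ((norm w)\<^sup>2 + (LINT t|lebesgue_on {0<..<T}. (norm (weak_deriv T j w t))\<^sup>2))"

definition closed_in_X ::
  "real \<Rightarrow> ('v::{real_inner,second_countable_topology} \<Rightarrow> 'h::real_inner) \<Rightarrow> 'v l2 set \<Rightarrow> bool" where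
  "closed_in_X T j S \<longleftrightarrow>
     (\<forall>x\<in>spaceX T j. (\<forall>e>0. \<exists>w\<in>S. normX T j (x - w) < e) \<longrightarrow> x \<in> S)"

text \<open>\<open>\<gamma>\<^sub>t\<close>: evaluation at \<open>t \<in> [0,T]\<close> of the continuous \<open>H\<close>-valued representative.\<close>

definition time_trace ::
  "real \<Rightarrow> ('v::{real_inner,second_countable_topology} \<Rightarrow> 'h::real_inner) \<Rightarrow> real \<Rightarrow> 'v l2 \<Rightarrow> 'h" where
  "time_trace T j t w =
     (SOME c. continuous_on {0..T} c \<and>
        (AE s in lebesgue_on {0<..<T}. c s = j (rep_l2 w s))) t"

text \<open>Functionals on a subspace \<open>S\<close> are functions on \<open>S\<close> in the sense of \<open>extensional\<close>, so that
  equality of functionals is equality, and restriction is \<open>restrict\<close>.\<close>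

definition dual :: "'a::real_normed_vector set \<Rightarrow> ('a \<Rightarrow> real) set" where
  "dual S = {f \<in> extensional S.
     (\<forall>x\<in>S. \<forall>y\<in>S. f (x + y) = f x + f y) \<and>
     (\<forall>c. \<forall>x\<in>S. f (c *\<^sub>R x) = c * f x) \<and>
     (\<exists>M. \<forall>x\<in>S. \<bar>f x\<bar> \<le> M * norm x)}"

definition admissible_form ::
  "real \<Rightarrow> (real \<Rightarrow> 'v::real_normed_vector \<Rightarrow> 'v \<Rightarrow> real) \<Rightarrow> bool" where
  "admissible_form T a \<longleftrightarrow>
     (AE t in lebesgue_on {0<..<T}. bilinear (a t)) \<and>
     (\<forall>\<eta> \<zeta>. (\<lambda>t. a t \<eta> \<zeta>) \<in> borel_measurable (lebesgue_on {0<..<T})) \<and>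
     (\<exists>M. AE t in lebesgue_on {0<..<T}. \<forall>\<eta> \<zeta>. \<bar>a t \<eta> \<zeta>\<bar> \<le> M * norm \<eta> * norm \<zeta>) \<and>
     (\<exists>\<alpha>>0. AE t in lebesgue_on {0<..<T}. \<forall>\<eta>. a t \<eta> \<eta> \<ge> \<alpha> * (norm \<eta>)\<^sup>2)"

definition opA ::
  "real \<Rightarrow> (real \<Rightarrow> 'v::{real_inner,second_countable_topology} \<Rightarrow> 'v \<Rightarrow> real) \<Rightarrow>
    'v l2 \<Rightarrow> 'v l2 \<Rightarrow> real" where
  "opA T a w = (\<lambda>v\<in>L2I T. LINT t|lebesgue_on {0<..<T}. a t (rep_l2 w t) (rep_l2 v t))"

definition opA_adj ::
  "real \<Rightarrow> (real \<Rightarrow> 'v::{real_inner,second_countable_topology} \<Rightarrow> 'v \<Rightarrow> real) \<Rightarrow>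
    'v l2 \<Rightarrow> 'v l2 \<Rightarrow> real" where
  "opA_adj T a w = (\<lambda>v\<in>L2I T. opA T a v w)"

definition opAs ::
  "real \<Rightarrow> (real \<Rightarrow> 'v::{real_inner,second_countable_topology} \<Rightarrow> 'v \<Rightarrow> real) \<Rightarrow>
    'v l2 \<Rightarrow> 'v l2 \<Rightarrow> real" where
  "opAs T a w = (\<lambda>v\<in>L2I T. (1/2) * (opA T a w v + opA_adj T a w v))"

definition op_dt ::
  "real \<Rightarrow> ('v::{real_inner,second_countable_topology} \<Rightarrow> 'h::real_inner) \<Rightarrow>
    'v l2 \<Rightarrow> 'v l2 \<Rightarrow> real" where
  "op_dt T j w =
     (\<lambda>v\<in>L2I T. LINT t|lebesgue_on {0<..<T}. blinfun_apply (weak_deriv T j w t) (rep_l2 v t))"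

definition opB ::
  "real \<Rightarrow> ('v::{real_inner,second_countable_topology} \<Rightarrow> 'h::real_inner) \<Rightarrow>
    (real \<Rightarrow> 'v \<Rightarrow> 'v \<Rightarrow> real) \<Rightarrow> 'v l2 \<Rightarrow> 'v l2 \<Rightarrow> real" where
  "opB T j a w = (\<lambda>v\<in>L2I T. op_dt T j w v + opA T a w v)"

definition opC ::
  "real \<Rightarrow> ('v::{real_inner,second_countable_topology} \<Rightarrow> 'h::real_inner) \<Rightarrow>
    (real \<Rightarrow> 'v \<Rightarrow> 'v \<Rightarrow> real) \<Rightarrow> 'v l2 \<Rightarrow> 'v l2 \<Rightarrow> real" where
  "opC T j a w = (\<lambda>v\<in>L2I T. opB T j a w v - opAs T a w v)"

definition normY ::
  "real \<Rightarrow> (real \<Rightarrow> 'v::{real_inner,second_countable_topology} \<Rightarrow> 'v \<Rightarrow> real) \<Rightarrow> 'v l2 \<Rightarrow> real" where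
  "normY T a v = sqrt (opAs T a v v)"

definition dual_norm ::
  "real \<Rightarrow> (real \<Rightarrow> 'v::{real_inner,second_countable_topology} \<Rightarrow> 'v \<Rightarrow> real) \<Rightarrow>
    'v l2 set \<Rightarrow> ('v l2 \<Rightarrow> real) \<Rightarrow> real" where
  "dual_norm T a S f = (SUP v\<in>S - {0}. \<bar>f v\<bar> / normY T a v)"

definition energy_norm ::
  "real \<Rightarrow> ('v::{real_inner,second_countable_topology} \<Rightarrow> 'h::real_inner) \<Rightarrow>
    (real \<Rightarrow> 'v \<Rightarrow> 'v \<Rightarrow> real) \<Rightarrow> real \<Rightarrow> 'v l2 \<Rightarrow> real" where
  "energy_norm T j a \<beta> w =
     sqrt ((dual_norm T a (L2I T) (opB T j a w))\<^sup>2 + \<beta> * (norm (time_trace T j 0 w))\<^sup>2)"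

text \<open>All quotients lie in \<open>[0,1]\<close>.  The minimum with \<open>1\<close> matters only if \<open>Cw = 0\<close> for all
  trial functions of all members of the family: the infimum over the empty set is then \<open>1\<close>,
  its value in \<open>[0,1]\<close>, not \<open>\<infinity>\<close>, which would make the error bounds \<open>0\<close>.\<close>

definition gammaC ::
  "real \<Rightarrow> ('v::{real_inner,second_countable_topology} \<Rightarrow> 'h::real_inner) \<Rightarrow>
    (real \<Rightarrow> 'v \<Rightarrow> 'v \<Rightarrow> real) \<Rightarrow> 'd set \<Rightarrow> ('d \<Rightarrow> 'v l2 set) \<Rightarrow> ('d \<Rightarrow> 'v l2 set) \<Rightarrow> real" where
  "gammaC T j a \<Delta> Xd Yd = real_of_ereal (min 1
     (INF \<delta>\<in>\<Delta>. INF w\<in>{w \<in> Xd \<delta>. w \<noteq> 0 \<and> opC T j a w \<noteq> (\<lambda>v\<in>L2I T. 0)}.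
        ereal (dual_norm T a (Yd \<delta>) (restrict (opC T j a w) (Yd \<delta>)) /
               dual_norm T a (L2I T) (opC T j a w))))"

definition discrete_riesz ::
  "real \<Rightarrow> (real \<Rightarrow> 'v::{real_inner,second_countable_topology} \<Rightarrow> 'v \<Rightarrow> real) \<Rightarrow>
    'v l2 set \<Rightarrow> ('v l2 \<Rightarrow> real) \<Rightarrow> 'v l2" where
  "discrete_riesz T a S f = (THE z. z \<in> S \<and> (\<forall>v\<in>S. opAs T a z v = f v))"

definition symmetric_boundedly_invertible ::
  "real \<Rightarrow> (real \<Rightarrow> 'v::{real_inner,second_countable_topology} \<Rightarrow> 'v \<Rightarrow> real) \<Rightarrow>
    'v l2 set \<Rightarrow> (('v l2 \<Rightarrow> real) \<Rightarrow> 'v l2) \<Rightarrow> bool" where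
  "symmetric_boundedly_invertible T a S K \<longleftrightarrow>
     bij_betw K (dual S) S \<and>
     (\<forall>f\<in>dual S. \<forall>h\<in>dual S. K (\<lambda>v\<in>S. f v + h v) = K f + K h) \<and>
     (\<forall>c. \<forall>f\<in>dual S. K (\<lambda>v\<in>S. c * f v) = c *\<^sub>R K f) \<and>
     (\<exists>M. \<forall>f\<in>dual S. normY T a (K f) \<le> M * dual_norm T a S f) \<and>
     (\<exists>M. \<forall>v\<in>S. dual_norm T a S (inv_into (dual S) K v) \<le> M * normY T a v) \<and>
     (\<forall>f\<in>dual S. \<forall>h\<in>dual S. f (K h) = h (K f))"

definition mr_solution ::
  "real \<Rightarrow> ('v::{real_inner,second_countable_topology} \<Rightarrow> 'h::real_inner) \<Rightarrow>
    (real \<Rightarrow> 'v \<Rightarrow> 'v \<Rightarrow> real) \<Rightarrow> real \<Rightarrow> 'v l2 set \<Rightarrow> 'v l2 set \<Rightarrow> (('v l2 \<Rightarrow> real) \<Rightarrow> 'v l2) \<Rightarrow>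
    ('v l2 \<Rightarrow> real) \<Rightarrow> 'h \<Rightarrow> 'v l2 \<Rightarrow> bool" where
  "mr_solution T j a \<beta> Xs Ys K g u0 z \<longleftrightarrow> z \<in> Xs \<and>
     (\<forall>w\<in>Xs. opB T j a w (K (restrict (opB T j a z) Ys)) + \<beta> * (time_trace T j 0 z \<bullet> time_trace T j 0 w) =
             opB T j a w (K (restrict g Ys)) + \<beta> * (u0 \<bullet> time_trace T j 0 w))"

definition ben_solution ::
  "real \<Rightarrow> ('v::{real_inner,second_countable_topology} \<Rightarrow> 'h::real_inner) \<Rightarrow>
    (real \<Rightarrow> 'v \<Rightarrow> 'v \<Rightarrow> real) \<Rightarrow> real \<Rightarrow> 'v l2 set \<Rightarrow> 'v l2 set \<Rightarrow>
    ('v l2 \<Rightarrow> real) \<Rightarrow> 'h \<Rightarrow> 'v l2 \<Rightarrow> bool" where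
  "ben_solution T j a \<beta> Xs Ys g u0 z \<longleftrightarrow> z \<in> Xs \<and>
     (\<forall>w\<in>Xs. opC T j a w (discrete_riesz T a Ys (opC T j a z)) + opAs T a z w
               + time_trace T j T z \<bullet> time_trace T j T w + (\<beta> - 1) * (time_trace T j 0 z \<bullet> time_trace T j 0 w) =
             opC T j a w (discrete_riesz T a Ys g) + g w + \<beta> * (u0 \<bullet> time_trace T j 0 w))"

end

theory Submission
  imports Defs "HOL-Real_Asymp.Real_Asymp"
begin

text \<open>Write \<open>\<parallel>Bw\<parallel>\<^sup>2 = \<parallel>Cw + A\<^sub>s w\<parallel>\<^sup>2\<close> and integrate by parts in time: the energy norm satisfies
  \<open>|||w|||\<^sup>2 = \<parallel>Cw\<parallel>\<^sup>2 + \<parallel>w\<parallel>\<^sub>Y\<^sup>2 + \<parallel>\<gamma>\<^sub>T w\<parallel>\<^sup>2 + (\<beta> - 1) \<parallel>\<gamma>\<^sub>0 w\<parallel>\<^sup>2\<close>.  Replacing the dual norm of \<open>Y\<close> by that of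
  \<open>Y\<^sup>\<delta>\<close> affects only the first term, and costs a factor \<open>\<gamma>\<^sub>\<Delta>\<close> at most; hence both discrete bilinear forms
  are symmetric and equivalent to the squared energy norm on \<open>X\<^sup>\<delta>\<close>.  The minimal residual solution is an
  orthogonal projection of \<open>u\<close>, and a projection has the same norm as its complement, so that
  quasi-optimality holds with the norm of the projection and without an additional \<open>1\<close>.  The other method
  differs from such a projection by the consistency term \<open>(Cw)(\<Pi>u - u)\<close> with the projection \<open>\<Pi>\<close> onto
  \<open>Y\<^sup>\<delta>\<close>.

  Traces and integration by parts rest on a regularisation in space.  With \<open>G = j\<^sup>*j\<close> on \<open>V\<close>, the weak
  derivative of \<open>w\<close> is the ordinary derivative of \<open>Gw\<close>, so \<open>(\<epsilon> + G)\<^sup>-\<^sup>1 G w\<close> is absolutely continuous with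
  values in \<open>V\<close>, satisfies the energy identity, and converges to \<open>w\<close> as \<open>\<epsilon> \<rightarrow> 0\<close>.\<close>

section \<open>Symmetric forms on Hilbert spaces\<close>

text \<open>Each method enters the error estimate only through two inequalities,
  \<open>k * E w w \<le> N w w\<close> on the trial space and \<open>N x x \<le> k' * E x x\<close>
  on all of X; the quasi-optimality constant is the square root of \<open>k' / k\<close>. The
  inf-sup condition concerns C and not B because, after the splitting, the dual norm of Cw is the
  only term that feels the restriction to discrete test functions. In the minimal residual method
  the splitting survives this restriction because a trial function inside the test space is its own
  Riesz representative of \<open>As w\<close>. In the other method the consistency term acts as a
  right-hand side, and inverting a form with lower bound \<gamma>^2 produces the second power of
  1/\<gamma>. In the trace part the obstacle is that w' takes values in V' only: j w has no
  derivative in H, and its squared norm cannot be differentiated directly. The resolvents of G help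
  because they are symmetric and commute with G, so both factors of an energy product can be
  regularised at once. They converge strongly but not in operator norm in general, which is why
  density of the range of G and dominated convergence are used.\<close>

definition bilinear_on :: "'a::real_vector set \<Rightarrow> ('a \<Rightarrow> 'a \<Rightarrow> real) \<Rightarrow> bool" where
  "bilinear_on S E \<longleftrightarrow>
     (\<forall>x\<in>S. \<forall>y\<in>S. \<forall>z\<in>S. E (x + y) z = E x z + E y z \<and> E z (x + y) = E z x + E z y) \<and>
     (\<forall>c. \<forall>x\<in>S. \<forall>y\<in>S. E (c *\<^sub>R x) y = c * E x y \<and> E x (c *\<^sub>R y) = c * E x y)"

locale psd_form =
  fixes S :: "'a::real_vector set" and E :: "'a \<Rightarrow> 'a \<Rightarrow> real"
  assumes subspace: "subspace S" and bilin: "bilinear_on S E"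
    and sym: "\<And>x y. x \<in> S \<Longrightarrow> y \<in> S \<Longrightarrow> E x y = E y x"
    and nonneg: "\<And>x. x \<in> S \<Longrightarrow> 0 \<le> E x x"
begin

lemma add_closed [simp]: "x \<in> S \<Longrightarrow> y \<in> S \<Longrightarrow> x + y \<in> S"
  and diff_closed [simp]: "x \<in> S \<Longrightarrow> y \<in> S \<Longrightarrow> x - y \<in> S"
  and scale_closed [simp]: "x \<in> S \<Longrightarrow> c *\<^sub>R x \<in> S"
  and zero_closed [simp]: "0 \<in> S"
  using subspace by (auto simp: subspace_add subspace_diff subspace_scale subspace_0)

lemma addL: "x \<in> S \<Longrightarrow> y \<in> S \<Longrightarrow> z \<in> S \<Longrightarrow> E (x + y) z = E x z + E y z"
  and addR: "x \<in> S \<Longrightarrow> y \<in> S \<Longrightarrow> z \<in> S \<Longrightarrow> E z (x + y) = E z x + E z y"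
  and scaleL: "x \<in> S \<Longrightarrow> y \<in> S \<Longrightarrow> E (c *\<^sub>R x) y = c * E x y"
  and scaleR: "x \<in> S \<Longrightarrow> y \<in> S \<Longrightarrow> E x (c *\<^sub>R y) = c * E x y"
  using bilin by (auto simp: bilinear_on_def)

lemma diffL: "x \<in> S \<Longrightarrow> y \<in> S \<Longrightarrow> z \<in> S \<Longrightarrow> E (x - y) z = E x z - E y z"
  using addL[of "x - y" y z] by simp

lemma diffR: "x \<in> S \<Longrightarrow> y \<in> S \<Longrightarrow> z \<in> S \<Longrightarrow> E z (x - y) = E z x - E z y"
  using addR[of "x - y" y z] by simp

lemma zeroL [simp]: "x \<in> S \<Longrightarrow> E 0 x = 0"
  using scaleL[of x x 0] by simp

lemma square_add:
  "x \<in> S \<Longrightarrow> y \<in> S \<Longrightarrow> E (x + y) (x + y) = E x x + 2 * E x y + E y y"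
  by (simp add: addL addR sym[of y x])

lemma square_diff:
  "x \<in> S \<Longrightarrow> y \<in> S \<Longrightarrow> E (x - y) (x - y) = E x x - 2 * E x y + E y y"
  by (simp add: diffL diffR sym[of y x])

lemma square_scale: "x \<in> S \<Longrightarrow> E (c *\<^sub>R x) (c *\<^sub>R x) = c\<^sup>2 * E x x"
  by (simp add: scaleL scaleR power2_eq_square)

text \<open>For a semidefinite form y may have length zero without being zero; a nonzero
  \<open>E x y\<close> would then make \<open>E (x - c y) (x - c y)\<close> negative for some
  c.\<close>

lemma Cauchy_Schwarz:
  assumes x: "x \<in> S" and y: "y \<in> S"
  shows "(E x y)\<^sup>2 \<le> E x x * E y y"
proof (cases "E y y = 0")
  case True
  have "E x y = 0"
  proof (rule ccontr)
    assume ne: "E x y \<noteq> 0"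
    \<comment> \<open>The quadratic in c has become affine; this c is where it takes the value
      -1.\<close>
    define c where "c = (E x x + 1) / (2 * E x y)"
    have "0 \<le> E (x - c *\<^sub>R y) (x - c *\<^sub>R y)" using x y by (intro nonneg) simp
    also have "\<dots> = E x x - 2 * c * E x y"
      using x y True by (simp add: square_diff scaleL scaleR)
    also have "\<dots> = -1" using ne by (simp add: c_def field_simps)
    finally show False by simp
  qed
  then show ?thesis using True by simp
next
  case False
  then have pos: "0 < E y y" using nonneg[OF y] by simp
  define c where "c = E x y / E y y"
  have "0 \<le> E (x - c *\<^sub>R y) (x - c *\<^sub>R y)" using x y by (intro nonneg) simp
  also have "\<dots> = E x x - 2 * c * E x y + c\<^sup>2 * E y y"
    using x y by (simp add: square_diff scaleL scaleR power2_eq_square)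
  also have "\<dots> = E x x - (E x y)\<^sup>2 / E y y"
    using pos by (simp add: c_def power2_eq_square)
  finally show ?thesis using pos by (simp add: pos_divide_le_eq)
qed

lemma Cauchy_Schwarz_sqrt:
  assumes "x \<in> S" "y \<in> S"
  shows "\<bar>E x y\<bar> \<le> sqrt (E x x) * sqrt (E y y)"
  using real_sqrt_le_mono[OF Cauchy_Schwarz[OF assms]] by (simp add: real_sqrt_mult)

lemma triangle:
  assumes x: "x \<in> S" and y: "y \<in> S"
  shows "sqrt (E (x + y) (x + y)) \<le> sqrt (E x x) + sqrt (E y y)"
proof (rule real_le_lsqrt)
  show "0 \<le> sqrt (E x x) + sqrt (E y y)" using nonneg x y by simp
  have "E (x + y) (x + y) = E x x + 2 * E x y + E y y" using x y by (rule square_add)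
  also have "\<dots> \<le> (sqrt (E x x) + sqrt (E y y))\<^sup>2"
    using Cauchy_Schwarz_sqrt[OF x y] nonneg[OF x] nonneg[OF y] by (simp add: power2_sum)
  finally show "E (x + y) (x + y) \<le> (sqrt (E x x) + sqrt (E y y))\<^sup>2" .
qed

text \<open>Rescaling the two components to swap their norms leaves the norm of the sum unchanged;
  this is the argument behind \<open>\<parallel>I - P\<parallel> = \<parallel>P\<parallel>\<close> for projections in a Hilbert space.\<close>

lemma complementary_component_bound:
  assumes U: "subspace U" "U \<subseteq> S" and W: "subspace W" "W \<subseteq> S"
    and M: "M \<ge> 1"
    and bound: "\<And>a b. a \<in> U \<Longrightarrow> b \<in> W \<Longrightarrow> sqrt (E a a) \<le> M * sqrt (E (a + b) (a + b))"
    and a: "a \<in> U" and b: "b \<in> W"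
  shows "sqrt (E b b) \<le> M * sqrt (E (a + b) (a + b))"
proof -
  have aS: "a \<in> S" and bS: "b \<in> S" using a b U W by auto
  define \<alpha> \<beta> where "\<alpha> = sqrt (E a a)" and "\<beta> = sqrt (E b b)"
  have nn: "0 \<le> \<alpha>" "0 \<le> \<beta>" using nonneg aS bS by (auto simp: \<alpha>_def \<beta>_def)
  have sq: "E a a = \<alpha>\<^sup>2" "E b b = \<beta>\<^sup>2" using nonneg aS bS by (auto simp: \<alpha>_def \<beta>_def)
  have abn: "0 \<le> sqrt (E (a + b) (a + b))" using nonneg aS bS by simp
  \<comment> \<open>The rescaling divides by both norms, so vanishing components are treated
    apart.\<close>
  consider "\<alpha> = 0" | "\<beta> = 0" | "0 < \<alpha>" "0 < \<beta>" using nn by fastforce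
  then show ?thesis
  proof cases
    case 1
    then have "E a b = 0" using Cauchy_Schwarz_sqrt[OF aS bS] \<alpha>_def by simp
    then have "E (a + b) (a + b) = E b b" using 1 sq aS bS by (simp add: square_add)
    then show ?thesis using M mult_right_mono[OF M abn] by simp
  next
    case 2
    have "0 \<le> M * sqrt (E (a + b) (a + b))" using M abn by (intro mult_nonneg_nonneg) auto
    then show ?thesis using 2 by (simp add: \<beta>_def)
  next
    case 3
    define a' b' where "a' = (\<beta> / \<alpha>) *\<^sub>R a" and "b' = (\<alpha> / \<beta>) *\<^sub>R b"
    have mem: "a' \<in> U" "b' \<in> W" "a' \<in> S" "b' \<in> S"
      using a b aS bS U W by (auto simp: a'_def b'_def subspace_scale)
    have "E a' a' = \<beta>\<^sup>2" "E b' b' = \<alpha>\<^sup>2" "E a' b' = E a b"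
      using 3 aS bS sq by (auto simp: a'_def b'_def square_scale power_divide scaleL scaleR power2_eq_square)
    then have "E (a' + b') (a' + b') = E (a + b) (a + b)" "sqrt (E a' a') = \<beta>"
      using aS bS mem sq nn by (auto simp: square_add)
    then show ?thesis using bound[OF mem(1,2)] by (simp add: \<beta>_def)
  qed
qed

end

text \<open>Serves twice: for minimising sequences, where the bound comes from the parallelogram
  law, and for regularised functions in H, where it comes from the energy estimate.\<close>

lemma Cauchy_if_square_le:
  fixes X :: "nat \<Rightarrow> 'a::real_inner"
  assumes c: "0 < c" and le: "\<And>m n. c * (norm (X m - X n))\<^sup>2 \<le> \<epsilon> m + \<epsilon> n"
    and lim: "\<epsilon> \<longlonglongrightarrow> (0::real)"
  shows "Cauchy X"
proof (rule metric_CauchyI)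
  fix e :: real assume e: "0 < e"
  then have "0 < c * e\<^sup>2 / 2" using c by simp
  from LIMSEQ_D[OF lim this] obtain N where N: "\<And>n. n \<ge> N \<Longrightarrow> \<bar>\<epsilon> n\<bar> < c * e\<^sup>2 / 2" by auto
  show "\<exists>N. \<forall>m\<ge>N. \<forall>n\<ge>N. dist (X m) (X n) < e"
  proof (intro exI allI impI)
    fix m n assume "N \<le> m" "N \<le> n"
    then have "c * (norm (X m - X n))\<^sup>2 < c * e\<^sup>2"
      using le[of m n] N[of m] N[of n] by linarith
    then show "dist (X m) (X n) < e"
      using c e by (simp add: dist_norm power2_less_imp_less)
  qed
qed

text \<open>Minimising \<open>N x x - 2 * l x\<close>: by the parallelogram law every minimising sequence
  is Cauchy.\<close>

lemma riesz_form:
  fixes S :: "'a::real_inner set"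
  assumes psd: "psd_form S N" and S: "complete S"
    and c: "0 < c" and coercive: "\<And>x. x \<in> S \<Longrightarrow> c * (norm x)\<^sup>2 \<le> N x x"
    and bounded: "\<And>x. x \<in> S \<Longrightarrow> N x x \<le> C * (norm x)\<^sup>2"
    and l_add: "\<And>x y. x \<in> S \<Longrightarrow> y \<in> S \<Longrightarrow> l (x + y) = l x + l y"
    and l_scale: "\<And>x r. x \<in> S \<Longrightarrow> l (r *\<^sub>R x) = r * l x"
    and l_bound: "\<And>x. x \<in> S \<Longrightarrow> \<bar>l x\<bar> \<le> M * norm x"
  shows "\<exists>!z. z \<in> S \<and> (\<forall>w\<in>S. N z w = l w)"
proof -
  interpret psd_form S N by (rule psd)
  have l_diff: "l (x - y) = l x - l y" if "x \<in> S" "y \<in> S" for x y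
    using l_add[of "x - y" y] that by simp
  define Q where "Q x = N x x - 2 * l x" for x
  \<comment> \<open>The scalar quadratic \<open>c s^2 - 2 |M| s\<close> has the minimum
    \<open>-M^2 / c\<close>.\<close>
  have Q_low: "- (M\<^sup>2 / c) \<le> Q x" if x: "x \<in> S" for x
  proof -
    have "0 \<le> (c * norm x - \<bar>M\<bar>)\<^sup>2" by simp
    then have "2 * (\<bar>M\<bar> * norm x) \<le> c * (norm x)\<^sup>2 + M\<^sup>2 / c"
      using c by (simp add: power2_diff field_simps power2_eq_square)
    moreover have "l x \<le> \<bar>M\<bar> * norm x"
      using l_bound[OF x] mult_right_mono[OF abs_ge_self norm_ge_zero, of M x] by linarith
    ultimately show ?thesis using coercive[OF x] by (simp add: Q_def)
  qed
  define q where "q = Inf (Q ` S)"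
  have bdd: "bdd_below (Q ` S)" using Q_low by (intro bdd_belowI2) auto
  have q_le: "q \<le> Q x" if "x \<in> S" for x
    unfolding q_def using bdd that by (intro cInf_lower) auto
  have "\<exists>x\<in>S. Q x < q + 1 / real (Suc n)" for n
  proof -
    have "Inf (Q ` S) < q + 1 / real (Suc n)" by (simp add: q_def)
    moreover have "Q ` S \<noteq> {}" using zero_closed by blast
    ultimately show ?thesis using cInf_lessD[of "Q ` S"] by blast
  qed
  then obtain X where X: "\<And>n. X n \<in> S" "\<And>n. Q (X n) < q + 1 / real (Suc n)" by metis
  have par: "N (x - y) (x - y) = 2 * Q x + 2 * Q y - 4 * Q ((1/2) *\<^sub>R (x + y))"
    if "x \<in> S" "y \<in> S" for x y
    using that by (simp add: Q_def square_diff square_scale square_add l_add l_scale power2_eq_square add_divide_distrib)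
  have "Cauchy X"
  proof (rule Cauchy_if_square_le[OF c])
    show "(\<lambda>n. 2 * (1 / real (Suc n))) \<longlonglongrightarrow> 0"
      using tendsto_mult_right_zero[OF LIMSEQ_inverse_real_of_nat] by (simp add: inverse_eq_divide)
    show "c * (norm (X m - X n))\<^sup>2 \<le> 2 * (1 / real (Suc m)) + 2 * (1 / real (Suc n))" for m n
      using coercive[of "X m - X n"] par[of "X m" "X n"] q_le[of "(1/2) *\<^sub>R (X m + X n)"]
        X(1)[of m] X(1)[of n] X(2)[of m] X(2)[of n] by simp
  qed
  then obtain z where z: "z \<in> S" "X \<longlonglongrightarrow> z"
    using S X(1) unfolding complete_def by blast
  \<comment> \<open>Expanding Q around z turns the bounds on N and l into continuity of Q at z, so
    that the infimum is attained in the limit.\<close>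
  have est: "Q z - Q x \<le> C * (norm (x - z))\<^sup>2 + 2 * (sqrt (C * (norm z)\<^sup>2) * sqrt (C * (norm (x - z))\<^sup>2)) + 2 * (M * norm (x - z))"
    if x: "x \<in> S" for x
  proof -
    have zx: "x - z \<in> S" using x z by simp
    have "Q z = Q x - N (x - z) (x - z) - 2 * N z (x - z) + 2 * l (x - z)"
      using x z square_diff[of x z] diffR[of x z z] sym[of x z] by (simp add: Q_def l_diff)
    moreover have "\<bar>N z (x - z)\<bar> \<le> sqrt (C * (norm z)\<^sup>2) * sqrt (C * (norm (x - z))\<^sup>2)"
    proof -
      have "sqrt (N z z) * sqrt (N (x - z) (x - z)) \<le> sqrt (C * (norm z)\<^sup>2) * sqrt (C * (norm (x - z))\<^sup>2)"
        using bounded[OF zx] bounded[OF z(1)] nonneg[OF z(1)] nonneg[OF zx]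
        by (intro mult_mono real_sqrt_le_mono) auto
      then show ?thesis using Cauchy_Schwarz_sqrt[OF z(1) zx] by linarith
    qed
    moreover have "0 \<le> C * (norm (x - z))\<^sup>2" "0 \<le> N (x - z) (x - z)"
      using bounded[OF zx] nonneg[OF zx] by auto
    ultimately show ?thesis using l_bound[OF zx] by linarith
  qed
  have Qz: "Q z = q"
  proof (rule antisym[OF _ q_le[OF z(1)]])
    have nz: "(\<lambda>n. norm (X n - z)) \<longlonglongrightarrow> 0"
      using z(2) by (simp add: LIM_zero tendsto_norm_zero)
    have "(\<lambda>n. C * (norm (X n - z))\<^sup>2 + 2 * (sqrt (C * (norm z)\<^sup>2) * sqrt (C * (norm (X n - z))\<^sup>2)) + 2 * (M * norm (X n - z)) + (q + 1 / real (Suc n)))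
      \<longlonglongrightarrow> C * 0\<^sup>2 + 2 * (sqrt (C * (norm z)\<^sup>2) * sqrt (C * 0\<^sup>2)) + 2 * (M * 0) + (q + 0)"
      using LIMSEQ_inverse_real_of_nat by (intro tendsto_intros nz) (simp add: inverse_eq_divide)
    moreover have "Q z \<le> C * (norm (X n - z))\<^sup>2 + 2 * (sqrt (C * (norm z)\<^sup>2) * sqrt (C * (norm (X n - z))\<^sup>2)) + 2 * (M * norm (X n - z)) + (q + 1 / real (Suc n))" for n
      using est[OF X(1)[of n]] X(2)[of n] by linarith
    ultimately show "Q z \<le> q" using LIMSEQ_le_const by fastforce
  qed
  have eq: "N z w = l w" if w: "w \<in> S" for w
  proof -
    define d where "d = N z w - l w"
    \<comment> \<open>A descent step along w. The optimal denominator would be \<open>N w w\<close>;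
      adding 1 keeps it positive for \<open>w = 0\<close> and still forces
      \<open>r = 0\<close>.\<close>
    define r where "r = d / (N w w + 1)"
    have pos: "0 < N w w + 1" using nonneg[OF w] by simp
    have "Q z \<le> Q (z - r *\<^sub>R w)" using q_le[of "z - r *\<^sub>R w"] Qz z w by simp
    also have "\<dots> = Q z - 2 * r * d + r\<^sup>2 * N w w"
      using z w by (simp add: Q_def d_def square_diff scaleL scaleR l_diff l_scale algebra_simps power2_eq_square)
    finally have "2 * r * d \<le> r\<^sup>2 * N w w" by simp
    moreover have "r * d = r\<^sup>2 * (N w w + 1)" using pos by (simp add: r_def power2_eq_square)
    ultimately have "r\<^sup>2 * (N w w + 2) \<le> 0" by (simp add: algebra_simps)
    moreover have "0 \<le> r\<^sup>2 * (N w w + 2)" using nonneg[OF w] by simp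
    ultimately have "r\<^sup>2 * (N w w + 2) = 0" by simp
    then have "r = 0" using nonneg[OF w] by (auto simp: add_nonneg_eq_0_iff)
    then show ?thesis using pos by (simp add: r_def d_def)
  qed
  show ?thesis
  proof (rule ex1I[of _ z])
    show "z \<in> S \<and> (\<forall>w\<in>S. N z w = l w)" using z eq by blast
    fix y assume y: "y \<in> S \<and> (\<forall>w\<in>S. N y w = l w)"
    then have yz: "y - z \<in> S" and "N (y - z) (y - z) = 0"
      using z eq by (auto simp: diffL)
    then have "c * (norm (y - z))\<^sup>2 \<le> 0" using coercive[OF yz] by simp
    then show "y = z" using c by (simp add: mult_le_0_iff)
  qed
qed

lemma riesz_representation:
  fixes l :: "'a::{real_inner,complete_space} \<Rightarrow> real"
  assumes "bounded_linear l"
  obtains z where "\<And>w. z \<bullet> w = l w"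
proof -
  interpret l: bounded_linear l by (rule assms)
  obtain M where M: "\<And>x. norm (l x) \<le> norm x * M" using l.bounded by blast
  have "\<exists>!z. z \<in> UNIV \<and> (\<forall>w\<in>UNIV. z \<bullet> w = l w)"
  proof (rule riesz_form[where c = 1 and C = 1 and M = M])
    show "psd_form UNIV ((\<bullet>) :: 'a \<Rightarrow> _)"
      by unfold_locales (auto simp: bilinear_on_def inner_add_left inner_add_right inner_commute)
  qed (use M in \<open>auto simp: l.add l.scaleR power2_norm_eq_inner complete_UNIV mult.commute\<close>)
  then show ?thesis using that by blast
qed

section \<open>Completeness of the space of square integrable functions\<close>

lemma borel_measurable_lebesgue_ident [measurable]: "(\<lambda>t::real. t) \<in> borel_measurable lebesgue"
  by (intro measurable_completion) simp

lemma l2_rel_rep: "l2_rel (rep_l2 x) (rep_l2 x)"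
  using Quotient_l2 by (rule Quotient_rep_reflp)

lemma sq_integrable_rep [simp]: "sq_integrable (rep_l2 x)"
  using l2_rel_rep[of x] by (simp add: l2_rel_def)

lemma rep_measurable [measurable]: "rep_l2 x \<in> borel_measurable lebesgue"
  using sq_integrable_rep[of x] by (simp add: sq_integrable_def)

lemma rep_abs_l2: "sq_integrable f \<Longrightarrow> AE t in lebesgue. rep_l2 (abs_l2 f) t = f t"
  using Quotient_rep_abs[OF Quotient_l2, of f] by (simp add: l2_rel_def)

lemma abs_rep_l2 [simp]: "abs_l2 (rep_l2 x) = x"
  using Quotient_l2 by (rule Quotient_abs_rep)

lemma l2_eq_iff: "x = y \<longleftrightarrow> (AE t in lebesgue. rep_l2 x t = rep_l2 y t)"
  using Quotient_rel_rep[OF Quotient_l2, of x y] by (simp add: l2_rel_def)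

lemma rep_plus_l2: "AE t in lebesgue. rep_l2 (x + y) t = rep_l2 x t + rep_l2 y t"
proof -
  have "x + y = abs_l2 (\<lambda>t. rep_l2 x t + rep_l2 y t)"
    using plus_l2.abs_eq[OF l2_rel_rep l2_rel_rep, of x y] by simp
  then show ?thesis using rep_abs_l2[OF sq_integrable_add[OF sq_integrable_rep sq_integrable_rep], of x y] by simp
qed

lemma rep_scaleR_l2: "AE t in lebesgue. rep_l2 (c *\<^sub>R x) t = c *\<^sub>R rep_l2 x t"
proof -
  have "c *\<^sub>R x = abs_l2 (\<lambda>t. c *\<^sub>R rep_l2 x t)"
    using scaleR_l2.abs_eq[OF l2_rel_rep, of c x] by simp
  then show ?thesis using rep_abs_l2[OF sq_integrable_scaleR[OF sq_integrable_rep], of c x] by simp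
qed

lemma rep_zero_l2: "AE t in lebesgue. rep_l2 0 t = 0"
  using rep_abs_l2[OF sq_integrable_zero] by (simp add: zero_l2_def)

lemma rep_diff_l2: "AE t in lebesgue. rep_l2 (x - y) t = rep_l2 x t - rep_l2 y t"
  using rep_plus_l2[of "x - y" y] by eventually_elim simp

lemma inner_l2: "x \<bullet> y = (LINT t|lebesgue. rep_l2 x t \<bullet> rep_l2 y t)"
  using inner_l2.abs_eq[OF l2_rel_rep l2_rel_rep, of x y] by simp

lemma norm_l2: "(norm x)\<^sup>2 = (LINT t|lebesgue. (norm (rep_l2 x t))\<^sup>2)"
  by (simp add: power2_norm_eq_inner inner_l2)

lemma sq_integrable_diff:
  "sq_integrable f \<Longrightarrow> sq_integrable g \<Longrightarrow> sq_integrable (\<lambda>t. f t - g t)"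
  using sq_integrable_add[OF _ sq_integrable_scaleR[of g "-1"]] by simp

text \<open>Completeness of Lebesgue measure makes every part of the exceptional null set
  measurable, so the two preimages differ by measurable sets only.\<close>

lemma borel_measurable_lebesgue_AE_cong:
  fixes f g :: "real \<Rightarrow> 'a::topological_space"
  assumes f: "f \<in> borel_measurable lebesgue" and ae: "AE t in lebesgue. f t = g t"
  shows "g \<in> borel_measurable lebesgue"
proof (rule measurableI)
  fix A :: "'a set" assume A: "A \<in> sets borel"
  from ae obtain N where N: "{t. f t \<noteq> g t} \<subseteq> N" "N \<in> null_sets lebesgue"
    by (auto simp: eventually_ae_filter)
  have "g t = f t" if "t \<notin> N" for t
    using N(1) that by (metis (mono_tags, lifting) mem_Collect_eq subsetD)
  then have "g -` A \<inter> space lebesgue = (f -` A \<inter> space lebesgue - N) \<union> (g -` A \<inter> N)"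
    by (intro set_eqI) (case_tac "x \<in> N"; simp)
  moreover have "g -` A \<inter> N \<in> sets lebesgue"
    using completion.complete2[OF _ N(2), of "g -` A \<inter> N"] by auto
  ultimately show "g -` A \<inter> space lebesgue \<in> sets lebesgue"
    using N(2) measurable_sets[OF f A] by (metis null_setsD2 sets.Diff sets.Un)
qed auto

lemma sq_integrable_bound:
  fixes f :: "real \<Rightarrow> 'a::{real_inner,second_countable_topology}"
    and g :: "real \<Rightarrow> 'b::{real_inner,second_countable_topology}"
  assumes "sq_integrable f" "g \<in> borel_measurable lebesgue"
    "AE t in lebesgue. norm (g t) \<le> C * norm (f t)"
  shows "sq_integrable g"
  unfolding sq_integrable_def
proof (intro conjI assms(2))
  show "integrable lebesgue (\<lambda>t. (norm (g t))\<^sup>2)"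
  proof (rule Bochner_Integration.integrable_bound)
    show "integrable lebesgue (\<lambda>t. C\<^sup>2 * (norm (f t))\<^sup>2)"
      using assms(1) by (simp add: sq_integrable_def)
    show "AE t in lebesgue. norm ((norm (g t))\<^sup>2) \<le> norm (C\<^sup>2 * (norm (f t))\<^sup>2)"
      using assms(3)
    proof eventually_elim
      case (elim t)
      then have "(norm (g t))\<^sup>2 \<le> (C * norm (f t))\<^sup>2" by (rule power_mono) simp
      then show ?case by (simp add: power_mult_distrib)
    qed
  qed (use assms(2) in measurable)
qed

lemma norm_abs_l2:
  assumes "sq_integrable f"
  shows "(norm (abs_l2 f))\<^sup>2 = (LINT t|lebesgue. (norm (f t))\<^sup>2)"
  unfolding norm_l2 using rep_abs_l2[OF assms] assms
  by (intro integral_cong_AE) (auto simp: sq_integrable_def)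

lemma norm_diff_abs_l2:
  assumes "sq_integrable f"
  shows "(norm (x - abs_l2 f))\<^sup>2 = (LINT t|lebesgue. (norm (rep_l2 x t - f t))\<^sup>2)"
proof -
  have [measurable]: "f \<in> borel_measurable lebesgue" using assms by (simp add: sq_integrable_def)
  show ?thesis unfolding norm_l2 using rep_abs_l2[OF assms] rep_diff_l2[of x "abs_l2 f"]
    by (intro integral_cong_AE) auto
qed

text \<open>Along a subsequence with geometrically decreasing increments the series of the squared
  pointwise increments, weighted by \<open>2\<^sup>n\<close>, is integrable, hence finite almost everywhere.\<close>

lemma l2_fast_Cauchy_converges:
  fixes X :: "nat \<Rightarrow> 'a::{real_inner,complete_space,second_countable_topology} l2"
  assumes fast: "\<And>n. (norm (X (Suc n) - X n))\<^sup>2 \<le> (1/8)^n"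
  shows "\<exists>x. X \<longlonglongrightarrow> x"
proof -
  define r where "r n = rep_l2 (X n)" for n
  define D where "D n t = (norm (r (Suc n) t - r n t))\<^sup>2" for n t
  have r [measurable]: "r n \<in> borel_measurable lebesgue" for n by (simp add: r_def)
  have sqd: "sq_integrable (\<lambda>t. r m t - r n t)" for m n
    by (auto simp: r_def intro: sq_integrable_diff)
  have nX: "(norm (X m - X n))\<^sup>2 = (LINT t|lebesgue. (norm (r m t - r n t))\<^sup>2)" for m n
    unfolding norm_l2 using rep_diff_l2[of "X m" "X n"]
    by (intro integral_cong_AE) (auto simp: r_def)
  have Dint: "integrable lebesgue (D n)" for n
    using sqd[of "Suc n" n] by (simp only: D_def[abs_def] sq_integrable_def)
  have DI: "(LINT t|lebesgue. D n t) \<le> (1/8)^n" for n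
    using nX[of "Suc n" n] fast[of n] by (simp add: D_def)
  \<comment> \<open>The weight leaves a factor 1/4 of the decay 1/8, which is still
    summable.\<close>
  have ennD: "(\<integral>\<^sup>+t. ennreal (2^n * D n t) \<partial>lebesgue) \<le> ennreal ((1/4)^n)" for n
  proof -
    have "(\<integral>\<^sup>+t. ennreal (2^n * D n t) \<partial>lebesgue) = ennreal (LINT t|lebesgue. 2^n * D n t)"
      by (intro nn_integral_eq_integral integrable_mult_right Dint) (simp add: D_def)
    also have "(LINT t|lebesgue. 2^n * D n t) \<le> 2^n * (1/8)^n"
      using DI by simp
    also have "2^n * (1/8)^n = (1/4::real)^n" by (simp flip: power_mult_distrib)
    finally show ?thesis by (simp add: ennreal_leI)
  qed
  have "(\<integral>\<^sup>+t. (\<Sum>n. ennreal (2^n * D n t)) \<partial>lebesgue) = (\<Sum>n. \<integral>\<^sup>+t. ennreal (2^n * D n t) \<partial>lebesgue)"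
    by (intro nn_integral_suminf) (simp add: D_def)
  also have "\<dots> \<le> (\<Sum>n. ennreal ((1/4)^n))"
    by (intro suminf_le ennD) auto
  also have "\<dots> = ennreal (\<Sum>n. (1/4)^n)"
    by (intro suminf_ennreal2) (auto intro: summable_geometric)
  also have "\<dots> < \<infinity>" by simp
  finally have "AE t in lebesgue. (\<Sum>n. ennreal (2^n * D n t)) \<noteq> \<infinity>"
    by (intro nn_integral_noteq_infinite) (auto simp: D_def)
  then have conv: "AE t in lebesgue. convergent (\<lambda>n. r n t)"
  proof eventually_elim
    case (elim t)
    then have "summable (\<lambda>n. 2^n * D n t)"
      by (intro summable_suminf_not_top) (auto simp: D_def)
    then have "(\<lambda>n. 2^n * D n t) \<longlonglongrightarrow> 0" by (rule summable_LIMSEQ_zero)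
    then have "Bseq (\<lambda>n. 2^n * D n t)" by (intro convergent_imp_Bseq) (auto simp: convergent_def)
    then obtain K where K: "0 < K" "\<And>n. norm (2^n * D n t) \<le> K" by (auto simp: Bseq_def)
    \<comment> \<open>Undoing the weight gives \<open>D n t \<le> K * (1/2)^n\<close>, hence
      geometric decay of the increments at t with ratio \<open>sqrt (1/2)\<close>.\<close>
    have le: "norm (r (Suc n) t - r n t) \<le> sqrt K * (sqrt (1/2))^n" for n
    proof -
      have "D n t \<le> K * (1/2)^n" using K(2)[of n] by (simp add: field_simps D_def)
      then have "sqrt (D n t) \<le> sqrt (K * (1/2)^n)" by (rule real_sqrt_le_mono)
      then show ?thesis by (simp add: D_def real_sqrt_mult real_sqrt_power)
    qed
    have "Cauchy (\<lambda>n. r n t)"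
    proof (rule metric_CauchyI)
      fix e :: real assume e: "0 < e"
      define s where "s n = sqrt K * (sqrt (1/2))^n" for n
      have sm: "summable s" unfolding s_def
        by (intro summable_mult summable_geometric) (simp add: real_less_lsqrt)
      then obtain N where N: "\<And>m n. m \<ge> N \<Longrightarrow> norm (sum s {m..<n}) < e"
        using summable_Cauchy[of s] e by blast
      have tele: "norm (r (m + k) t - r m t) \<le> sum s {m..<m + k}" for m k
      proof (induction k)
        case (Suc k)
        have "norm (r (m + Suc k) t - r m t) \<le> norm (r (Suc (m + k)) t - r (m + k) t) + norm (r (m + k) t - r m t)"
          by (rule order_trans[OF _ norm_triangle_ineq]) simp
        also have "\<dots> \<le> s (m + k) + sum s {m..<m + k}"
          using le[of "m + k"] Suc by (simp add: s_def)
        finally show ?case by simp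
      qed simp
      have "dist (r m t) (r n t) < e" if "N \<le> m" "m \<le> n" for m n
        using tele[of m "n - m"] N[of m n] that
        by (simp add: dist_norm norm_minus_commute)
      then show "\<exists>N. \<forall>m\<ge>N. \<forall>n\<ge>N. dist (r m t) (r n t) < e"
        by (metis dist_commute linear)
    qed
    then show ?case by (simp add: Cauchy_convergent_iff)
  qed
  \<comment> \<open>The default 0 is used on a null set only. Replacing the sequence by 0 there as
    well gives convergence everywhere, and with it measurability of f.\<close>
  define f where "f t = (if convergent (\<lambda>n. r n t) then lim (\<lambda>n. r n t) else 0)" for t
  have lim: "AE t in lebesgue. (\<lambda>n. r n t) \<longlonglongrightarrow> f t"
    using conv by eventually_elim (simp add: f_def convergent_LIMSEQ_iff)
  have fm [measurable]: "f \<in> borel_measurable lebesgue"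
  proof -
    define N where "N = {t. \<not> convergent (\<lambda>n. r n t)}"
    have "N \<in> null_sets lebesgue"
      using conv unfolding N_def eventually_ae_filter
      by (auto simp: completion.complete2 dest: null_sets_subset)
    then have [measurable]: "N \<in> sets lebesgue" by auto
    have "(\<lambda>t. if t \<in> N then 0 else r n t) \<in> borel_measurable lebesgue" for n by measurable
    moreover have "(\<lambda>n. if t \<in> N then 0 else r n t) \<longlonglongrightarrow> f t" for t
      by (auto simp: N_def f_def convergent_LIMSEQ_iff)
    ultimately show ?thesis by (rule borel_measurable_LIMSEQ_metric)
  qed
  have tail: "norm (X m - X n) \<le> 2 * (1/2)^n" if "n \<le> m" for m n
  proof -
    \<comment> \<open>The rate 1/8 for squares is relaxed to 1/4 in order to have the exact square
      root 1/2.\<close>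
    have st: "norm (X (Suc k) - X k) \<le> (1/2)^k" for k
    proof -
      have "(norm (X (Suc k) - X k))\<^sup>2 \<le> (1/8)^k" by (rule fast)
      also have "\<dots> \<le> (1/4)^k" by (intro power_mono) auto
      also have "\<dots> = ((1/2)^k)\<^sup>2" by (simp add: power_divide power2_eq_square flip: power_mult_distrib)
      finally show ?thesis by (rule power2_le_imp_le) simp
    qed
    have "norm (X (n + k) - X n) \<le> 2 * (1/2)^n - 2 * (1/2)^(n + k)" for k
    proof (induction k)
      case (Suc k)
      have "norm (X (n + Suc k) - X n) \<le> norm (X (Suc (n + k)) - X (n + k)) + norm (X (n + k) - X n)"
        by (rule order_trans[OF _ norm_triangle_ineq]) simp
      then show ?case using st[of "n + k"] Suc by simp
    qed simp
    from this[of "m - n"] that show ?thesis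
      using zero_le_power[of "1/2::real" m] by (simp del: zero_le_power)
  qed
  have fn: "sq_integrable (\<lambda>t. f t - r n t) \<and> (LINT t|lebesgue. (norm (f t - r n t))\<^sup>2) \<le> (2 * (1/2)^n)\<^sup>2" for n
  proof -
    \<comment> \<open>Fatou's lemma carries the tail estimate of the sequence over to its pointwise
      limit.\<close>
    have le: "(\<integral>\<^sup>+t. ennreal ((norm (f t - r n t))\<^sup>2) \<partial>lebesgue) \<le> ennreal ((2 * (1/2)^n)\<^sup>2)"
    proof -
      have "(\<integral>\<^sup>+t. ennreal ((norm (f t - r n t))\<^sup>2) \<partial>lebesgue)
        \<le> (\<integral>\<^sup>+t. liminf (\<lambda>m. ennreal ((norm (r m t - r n t))\<^sup>2)) \<partial>lebesgue)"
      proof (rule nn_integral_mono_AE)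
        show "AE t in lebesgue. ennreal ((norm (f t - r n t))\<^sup>2) \<le> liminf (\<lambda>m. ennreal ((norm (r m t - r n t))\<^sup>2))"
          using lim
        proof eventually_elim
          case (elim t)
          have "(\<lambda>m. ennreal ((norm (r m t - r n t))\<^sup>2)) \<longlonglongrightarrow> ennreal ((norm (f t - r n t))\<^sup>2)"
            by (intro tendsto_intros elim)
          from lim_imp_Liminf[OF _ this] show ?case by simp
        qed
      qed
      also have "\<dots> \<le> liminf (\<lambda>m. \<integral>\<^sup>+t. ennreal ((norm (r m t - r n t))\<^sup>2) \<partial>lebesgue)"
        by (rule nn_integral_liminf) measurable
      also have "\<dots> \<le> ennreal ((2 * (1/2)^n)\<^sup>2)"
      proof (rule Liminf_le)
        show "\<forall>\<^sub>F m in sequentially. (\<integral>\<^sup>+t. ennreal ((norm (r m t - r n t))\<^sup>2) \<partial>lebesgue) \<le> ennreal ((2 * (1/2)^n)\<^sup>2)"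
          using eventually_ge_at_top[of n]
        proof eventually_elim
          case (elim m)
          have "(\<integral>\<^sup>+t. ennreal ((norm (r m t - r n t))\<^sup>2) \<partial>lebesgue) = ennreal ((norm (X m - X n))\<^sup>2)"
            unfolding nX using sqd[of m n] by (intro nn_integral_eq_integral) (auto simp: sq_integrable_def)
          also have "\<dots> \<le> ennreal ((2 * (1/2)^n)\<^sup>2)"
            using tail[OF elim] by (intro ennreal_leI power_mono) auto
          finally show ?case .
        qed
      qed simp
      finally show ?thesis .
    qed
    have int: "integrable lebesgue (\<lambda>t. (norm (f t - r n t))\<^sup>2)"
      using le by (intro integrableI_bounded) (auto intro: le_less_trans)
    moreover have "ennreal (LINT t|lebesgue. (norm (f t - r n t))\<^sup>2) \<le> ennreal ((2 * (1/2)^n)\<^sup>2)"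
      using le nn_integral_eq_integral[OF int] by simp
    ultimately show ?thesis by (simp add: sq_integrable_def)
  qed
  have sqf: "sq_integrable f"
    using sq_integrable_add[of "\<lambda>t. f t - r 0 t" "r 0"] fn[of 0] by (simp add: r_def)
  have tail: "norm (X n - abs_l2 f) \<le> 2 * (1/2)^n" for n
  proof (rule power2_le_imp_le)
    show "(norm (X n - abs_l2 f))\<^sup>2 \<le> (2 * (1/2)^n)\<^sup>2"
      using fn[of n] unfolding norm_diff_abs_l2[OF sqf] by (simp add: r_def norm_minus_commute)
  qed simp
  have "(\<lambda>n. X n - abs_l2 f) \<longlonglongrightarrow> 0"
  proof (rule Lim_null_comparison)
    show "\<forall>\<^sub>F n in sequentially. norm (X n - abs_l2 f) \<le> 2 * (1/2)^n"
      by (intro always_eventually allI tail)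
    show "(\<lambda>n. 2 * (1/2)^n) \<longlonglongrightarrow> (0::real)"
      by (intro tendsto_mult_right_zero LIMSEQ_power_zero) simp
  qed
  then have "X \<longlonglongrightarrow> abs_l2 f" by (rule LIM_zero_cancel)
  then show ?thesis ..
qed

lemma complete_l2:
  "complete (UNIV :: 'a::{real_inner,complete_space,second_countable_topology} l2 set)"
  unfolding complete_def
proof (intro allI impI)
  fix X :: "nat \<Rightarrow> 'a l2" assume "(\<forall>n. X n \<in> UNIV) \<and> Cauchy X"
  then have C: "Cauchy X" by simp
  have "\<exists>N. \<forall>m\<ge>N. \<forall>n\<ge>N. (norm (X m - X n))\<^sup>2 \<le> (1/8)^k" for k
  proof -
    obtain N where "\<forall>m\<ge>N. \<forall>n\<ge>N. dist (X m) (X n) < sqrt ((1/8)^k)"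
      using metric_CauchyD[OF C, of "sqrt ((1/8)^k)"] by auto
    then have "(norm (X m - X n))\<^sup>2 \<le> (sqrt ((1/8)^k))\<^sup>2" if "N \<le> m" "N \<le> n" for m n
      using that by (intro power_mono) (auto simp: dist_norm less_imp_le)
    then show ?thesis by auto
  qed
  then obtain M where M: "\<And>k m n. m \<ge> M k \<Longrightarrow> n \<ge> M k \<Longrightarrow> (norm (X m - X n))\<^sup>2 \<le> (1/8)^k" by metis
  \<comment> \<open>The sum dominates each \<open>M k\<close>, and the added k makes s strictly
    increasing.\<close>
  define s where "s k = (\<Sum>i\<le>k. M i) + k" for k
  have s: "strict_mono s" by (rule strict_mono_Suc_iff[THEN iffD2]) (simp add: s_def)
  have sM: "M k \<le> s k" for k
    by (simp add: s_def trans_le_add1 member_le_sum)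
  have "\<exists>x. (\<lambda>k. X (s k)) \<longlonglongrightarrow> x"
  proof (rule l2_fast_Cauchy_converges)
    show "(norm (X (s (Suc k)) - X (s k)))\<^sup>2 \<le> (1/8)^k" for k
      using M[of k "s (Suc k)" "s k"] sM[of k] s by (meson lessI less_imp_le order_trans strict_monoD)
  qed
  then obtain x where "(X \<circ> s) \<longlonglongrightarrow> x" by (auto simp: comp_def)
  from Cauchy_converges_subseq[OF C s this] show "\<exists>l\<in>UNIV. X \<longlonglongrightarrow> l" by blast
qed

section \<open>Functions vanishing outside the time interval\<close>

lemma L2I_AE: "w \<in> L2I T \<longleftrightarrow> (AE t in lebesgue. t \<notin> {0<..<T} \<longrightarrow> rep_l2 w t = 0)"
  by (simp add: L2I_def)

lemma subspace_L2I: "subspace (L2I T :: 'a::{real_inner,second_countable_topology} l2 set)"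
  unfolding subspace_def
proof (intro conjI ballI allI)
  show "0 \<in> (L2I T :: 'a l2 set)" unfolding L2I_AE using rep_zero_l2[where 'a = 'a] by eventually_elim simp
  show "x + y \<in> L2I T" if "x \<in> L2I T" "y \<in> L2I T" for x y :: "'a l2"
    using that rep_plus_l2[of x y] unfolding L2I_AE by eventually_elim simp
  show "c *\<^sub>R x \<in> L2I T" if "x \<in> L2I T" for c and x :: "'a l2"
    using that rep_scaleR_l2[of c x] unfolding L2I_AE by eventually_elim simp
qed

lemma L2I_add: "(x :: 'a::{real_inner,second_countable_topology} l2) \<in> L2I T \<Longrightarrow> y \<in> L2I T \<Longrightarrow> x + y \<in> L2I T"
  and L2I_diff: "x \<in> L2I T \<Longrightarrow> y \<in> L2I T \<Longrightarrow> x - y \<in> L2I T"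
  and L2I_scale: "x \<in> L2I T \<Longrightarrow> c *\<^sub>R x \<in> L2I T"
  and L2I_zero: "0 \<in> (L2I T :: 'a l2 set)"
  using subspace_L2I[of T, where 'a = 'a] by (auto simp: subspace_add subspace_diff subspace_scale subspace_0)

lemma sq_integrable_indicator:
  assumes "sq_integrable f" "A \<in> sets lebesgue"
  shows "sq_integrable (\<lambda>t. indicator A t *\<^sub>R f t)"
proof (rule sq_integrable_bound[of f _ 1])
  have [measurable]: "f \<in> borel_measurable lebesgue" "A \<in> sets lebesgue"
    using assms by (auto simp: sq_integrable_def)
  show "(\<lambda>t. indicator A t *\<^sub>R f t) \<in> borel_measurable lebesgue" by measurable
qed (use assms in \<open>auto simp: indicator_def\<close>)

text \<open>The space is the orthogonal complement of the functions that vanish on the interval,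
  hence an intersection of kernels of continuous functionals.\<close>

lemma closed_L2I: "closed (L2I T :: 'a::{real_inner,second_countable_topology} l2 set)"
proof -
  have "(L2I T :: 'a l2 set) = (\<Inter>v\<in>{v. AE t in lebesgue. t \<in> {0<..<T} \<longrightarrow> rep_l2 v t = 0}. {w. w \<bullet> v = 0})"
  proof (intro set_eqI iffI INT_I)
    fix w v :: "'a l2" assume w: "w \<in> L2I T" and v: "v \<in> {v. AE t in lebesgue. t \<in> {0<..<T} \<longrightarrow> rep_l2 v t = 0}"
    have "AE t in lebesgue. rep_l2 w t \<bullet> rep_l2 v t = 0"
      using w v unfolding L2I_AE mem_Collect_eq by eventually_elim auto
    then show "w \<in> {w. w \<bullet> v = 0}" by (simp add: inner_l2 integral_eq_zero_AE)
  next
    fix w :: "'a l2"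
    assume w: "w \<in> (\<Inter>v\<in>{v. AE t in lebesgue. t \<in> {0<..<T} \<longrightarrow> rep_l2 v t = 0}. {w. w \<bullet> v = 0})"
    \<comment> \<open>The part of w outside the interval is itself an admissible v, and its product
      with w is its own squared norm.\<close>
    define f where "f t = indicator (- {0<..<T}) t *\<^sub>R rep_l2 w t" for t
    have f: "sq_integrable f" unfolding f_def by (intro sq_integrable_indicator) auto
    define v where "v = abs_l2 f"
    have v: "AE t in lebesgue. rep_l2 v t = f t" unfolding v_def by (rule rep_abs_l2[OF f])
    then have "AE t in lebesgue. t \<in> {0<..<T} \<longrightarrow> rep_l2 v t = 0"
      by eventually_elim (auto simp: f_def)
    then have "w \<bullet> v = 0" using w by blast
    moreover have "v \<bullet> v = w \<bullet> v"
      unfolding inner_l2 using v by (intro integral_cong_AE) (measurable, auto simp: f_def indicator_def)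
    ultimately have "v = 0" by simp
    then have "AE t in lebesgue. f t = 0" using v rep_zero_l2[where 'a = 'a] by auto
    then show "w \<in> L2I T" unfolding L2I_AE by eventually_elim (auto simp: f_def)
  qed
  moreover have "closed {w. w \<bullet> v = 0}" for v :: "'a l2"
    by (intro closed_Collect_eq continuous_intros)
  ultimately show ?thesis by (simp only: closed_INT ball_simps) blast
qed

lemma complete_closed_l2:
  fixes S :: "'a::{real_inner,complete_space,second_countable_topology} l2 set"
  shows "closed S \<Longrightarrow> complete S"
  using complete_closed_subset[OF _ subset_UNIV complete_l2] by blast

section \<open>Test functions and the fundamental lemma\<close>

text \<open>The classical flat function \<open>exp (-1/x)\<close>, multiplied by a power of 1/x:
  differentiation only shifts and combines the exponent n, so the linear span of the family is
  closed under it.\<close>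

definition flat :: "nat \<Rightarrow> real \<Rightarrow> real" where
  "flat n x = (if 0 < x then exp (- inverse x) * inverse x ^ n else 0)"

lemma flat_tendsto_0: "((\<lambda>x. exp (- inverse x) * inverse x ^ n) \<longlongrightarrow> (0::real)) (at_right 0)"
proof -
  have "((\<lambda>x. inverse x ^ n / exp (inverse x)) \<longlongrightarrow> (0::real)) (at_right 0)"
    by (rule filterlim_compose[OF tendsto_power_div_exp_0 filterlim_inverse_at_top_right])
  then show ?thesis by (simp add: exp_minus field_simps)
qed

lemma flat_has_derivative:
  "(flat n has_real_derivative (flat (n + 2) x - real n * flat (n + 1) x)) (at x)"
proof -
  consider "x < 0" | "x = 0" | "0 < x" by linarith
  then show ?thesis
  proof cases
    case 1
    have "((\<lambda>_. 0) has_real_derivative 0) (at x)" by simp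
    then have "(flat n has_real_derivative 0) (at x)"
      by (rule DERIV_cong_ev[THEN iffD1, rotated -1])
        (use 1 in \<open>auto simp: flat_def eventually_nhds intro!: exI[of _ "{..<0}"]\<close>)
    then show ?thesis using 1 by (simp add: flat_def)
  next
    case 2
    \<comment> \<open>Dividing by h raises the exponent by one, so the difference quotient at 0 is
      again flat.\<close>
    have "((\<lambda>h. flat n h / h) \<longlongrightarrow> 0) (at_right 0)"
    proof (rule Lim_transform_eventually[OF flat_tendsto_0[of "Suc n"]])
      show "\<forall>\<^sub>F h in at_right 0. exp (- inverse h) * inverse h ^ Suc n = flat n h / h"
        by (auto simp: flat_def eventually_at_right_field divide_inverse intro!: exI[of _ 1])
    qed
    moreover have "((\<lambda>h. flat n h / h) \<longlongrightarrow> 0) (at_left 0)"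
      by (rule tendsto_eventually) (auto simp: flat_def eventually_at_left_field intro!: exI[of _ "-1"])
    ultimately have "((\<lambda>h. flat n h / h) \<longlongrightarrow> 0) (at 0)"
      by (simp add: filterlim_split_at)
    then show ?thesis using 2 by (simp add: DERIV_def flat_def)
  next
    case 3
    define y where "y = inverse x"
    have inv: "(inverse has_real_derivative - (y\<^sup>2)) (at x)"
      using DERIV_inverse[of x] 3 by (simp add: y_def power2_eq_square power_inverse)
    have pow: "((\<lambda>x. inverse x ^ n) has_real_derivative real n * (- (y\<^sup>2)) * y ^ (n - 1)) (at x)"
      using DERIV_power[OF inv, of n] by (simp add: y_def mult.assoc)
    have ex: "((\<lambda>x. exp (- inverse x)) has_real_derivative exp (- y) * y\<^sup>2) (at x)"
      using DERIV_chain2[OF DERIV_exp DERIV_minus[OF inv]] by (simp add: y_def)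
    have "((\<lambda>x. exp (- inverse x) * inverse x ^ n) has_real_derivative
      (flat (n + 2) x - real n * flat (n + 1) x)) (at x)"
      by (rule DERIV_cong[OF DERIV_mult[OF ex pow]])
        (use 3 in \<open>cases n; simp add: flat_def y_def algebra_simps power2_eq_square\<close>)
    then show ?thesis
      by (rule DERIV_cong_ev[THEN iffD1, rotated -1])
        (use 3 in \<open>auto simp: flat_def eventually_nhds intro!: exI[of _ "{0<..}"]\<close>)
  qed
qed

lemma flat_0_bounds: "0 \<le> flat 0 x" "flat 0 x \<le> 1"
  by (auto simp: flat_def)

text \<open>A class of functions large enough to contain the derivatives of its members, so that
  smoothness of a bump needs no formula for its k-th derivative. The steepness is c, and a and b
  bound the support.\<close>

inductive_set bump_span :: "real \<Rightarrow> real \<Rightarrow> real \<Rightarrow> (real \<Rightarrow> real) set" for c a b where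
  base: "(\<lambda>t. flat k (c * (t - a)) * flat l (c * (b - t))) \<in> bump_span c a b"
| add: "f \<in> bump_span c a b \<Longrightarrow> g \<in> bump_span c a b \<Longrightarrow> (\<lambda>t. f t + g t) \<in> bump_span c a b"
| scale: "f \<in> bump_span c a b \<Longrightarrow> (\<lambda>t. r * f t) \<in> bump_span c a b"

lemma bump_span_derivative:
  assumes "f \<in> bump_span c a b"
  shows "\<exists>f'\<in>bump_span c a b. \<forall>t. (f has_real_derivative f' t) (at t)"
  using assms
proof induction
  case (base k l)
  define P where "P k l t = flat k (c * (t - a)) * flat l (c * (b - t))" for k l t
  have mem: "P k l \<in> bump_span c a b" for k l
    unfolding P_def[abs_def] by (rule bump_span.base)
  define f' where "f' t = c * P (k + 2) l t + (- c * real k) * P (k + 1) l t +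
    ((- c) * P k (l + 2) t + (c * real l) * P k (l + 1) t)" for t
  have "f' \<in> bump_span c a b" unfolding f'_def[abs_def]
    by (intro bump_span.add bump_span.scale mem)
  moreover have "(P k l has_real_derivative f' t) (at t)" for t
  proof -
    have 1: "((\<lambda>t. flat k (c * (t - a))) has_real_derivative
        (flat (k + 2) (c * (t - a)) - real k * flat (k + 1) (c * (t - a))) * c) (at t)"
      by (rule DERIV_chain2[OF flat_has_derivative]) (auto intro!: derivative_eq_intros)
    have 2: "((\<lambda>t. flat l (c * (b - t))) has_real_derivative
        (flat (l + 2) (c * (b - t)) - real l * flat (l + 1) (c * (b - t))) * (- c)) (at t)"
      by (rule DERIV_chain2[OF flat_has_derivative]) (auto intro!: derivative_eq_intros)
    show ?thesis unfolding P_def f'_def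
      by (rule DERIV_cong[OF DERIV_mult[OF 1 2]]) (simp add: P_def algebra_simps)
  qed
  ultimately show ?case unfolding P_def[abs_def] by blast
next
  case (add f g)
  then obtain f' g' where "f' \<in> bump_span c a b" "g' \<in> bump_span c a b"
    "\<forall>t. (f has_real_derivative f' t) (at t)" "\<forall>t. (g has_real_derivative g' t) (at t)" by blast
  then show ?case
    by (intro bexI[of _ "\<lambda>t. f' t + g' t"]) (auto intro: bump_span.add DERIV_add)
next
  case (scale f r)
  then obtain f' where "f' \<in> bump_span c a b" "\<forall>t. (f has_real_derivative f' t) (at t)" by blast
  then show ?case
    by (intro bexI[of _ "\<lambda>t. r * f' t"]) (auto intro: bump_span.scale DERIV_cmult)
qed

lemma bump_span_support:
  assumes "f \<in> bump_span c a b" "0 < c" "t \<notin> {a<..<b}"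
  shows "f t = 0"
  using assms by induction (auto simp: flat_def zero_less_mult_iff)

definition smooth :: "(real \<Rightarrow> real) \<Rightarrow> bool" where
  "smooth f \<longleftrightarrow> (\<forall>k. (deriv ^^ k) f differentiable_on UNIV)"

text \<open>By induction P passes to all iterated derivatives, so a single differentiation step
  stands for the quantification over all orders.\<close>

lemma smooth_coinduct:
  assumes P: "P f" and step: "\<And>f. P f \<Longrightarrow> \<exists>f'. P f' \<and> (\<forall>t. (f has_real_derivative f' t) (at t))"
  shows "smooth f"
proof -
  have der: "P (deriv f)" "f differentiable_on UNIV" if Pf: "P f" for f
  proof -
    obtain f' where f': "P f'" "\<And>t. (f has_real_derivative f' t) (at t)" using step[OF Pf] by blast
    have "deriv f = f'" using f'(2) by (auto intro: DERIV_imp_deriv)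
    then show "P (deriv f)" using f' by simp
    show "f differentiable_on UNIV"
      using f'(2) by (auto simp: differentiable_on_def real_differentiable_def)
  qed
  have "P ((deriv ^^ k) f)" for k by (induction k) (auto simp: P der)
  then show ?thesis using der by (auto simp: smooth_def)
qed

lemma smooth_deriv: "smooth f \<Longrightarrow> smooth (deriv f)"
  unfolding smooth_def by (metis comp_apply funpow_Suc_right)

lemma smooth_has_derivative:
  assumes "smooth f" shows "(f has_real_derivative deriv f t) (at t)"
proof -
  have "f differentiable_on UNIV" using assms unfolding smooth_def by (metis funpow_0)
  then show ?thesis
    by (simp add: differentiable_on_def real_differentiable_def DERIV_deriv_iff_real_differentiable)
qed

lemma smooth_continuous: "smooth f \<Longrightarrow> continuous_on S f"
  using smooth_has_derivative DERIV_continuous_on[of S f "deriv f"] by (metis has_field_derivative_at_within)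

lemma smooth_lincomb:
  assumes "smooth f" "smooth g" shows "smooth (\<lambda>t. r * f t + s * g t)"
proof (rule smooth_coinduct[where P = "\<lambda>h. \<exists>f g. smooth f \<and> smooth g \<and> h = (\<lambda>t. r * f t + s * g t)"])
  show "\<exists>f' g'. smooth f' \<and> smooth g' \<and> (\<lambda>t. r * f t + s * g t) = (\<lambda>t. r * f' t + s * g' t)"
    using assms by blast
  fix h assume "\<exists>f g. smooth f \<and> smooth g \<and> h = (\<lambda>t. r * f t + s * g t)"
  then obtain f g where fg: "smooth f" "smooth g" "h = (\<lambda>t. r * f t + s * g t)" by blast
  show "\<exists>h'. (\<exists>f g. smooth f \<and> smooth g \<and> h' = (\<lambda>t. r * f t + s * g t)) \<and> (\<forall>t. (h has_real_derivative h' t) (at t))"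
    using fg smooth_deriv smooth_has_derivative
    by (intro exI[of _ "\<lambda>t. r * deriv f t + s * deriv g t"]) (auto intro!: DERIV_add DERIV_cmult)
qed

lemma smooth_bump_span: "f \<in> bump_span c a b \<Longrightarrow> smooth f"
  by (rule smooth_coinduct[where P = "\<lambda>f. f \<in> bump_span c a b"]) (use bump_span_derivative in blast)+

lemma smooth_antiderivative:
  assumes "smooth f" "\<And>t. (F has_real_derivative f t) (at t)"
  shows "smooth F"
proof (rule smooth_coinduct[where P = "\<lambda>h. smooth h \<or> h = F"])
  fix h assume "smooth h \<or> h = F"
  then show "\<exists>h'. (smooth h' \<or> h' = F) \<and> (\<forall>t. (h has_real_derivative h' t) (at t))"
    using assms smooth_deriv smooth_has_derivative by blast
qed simp

text \<open>A closed interval containing the support is easier to follow through sums, derivatives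
  and antiderivatives than the closure of the support.\<close>

lemma test_function_iff:
  "test_function T \<phi> \<longleftrightarrow> smooth \<phi> \<and> (\<exists>a b. 0 < a \<and> b < T \<and> (\<forall>t. t \<notin> {a..b} \<longrightarrow> \<phi> t = 0))"
proof (intro iffI conjI)
  assume t: "test_function T \<phi>"
  then show "smooth \<phi>" by (simp add: test_function_def smooth_def)
  define S where "S = closure {t. \<phi> t \<noteq> 0}"
  have S: "compact S" "S \<subseteq> {0<..<T}" and out: "\<And>t. t \<notin> S \<Longrightarrow> \<phi> t = 0"
    using t closure_subset[of "{t. \<phi> t \<noteq> 0}"] by (auto simp: test_function_def S_def)
  show "\<exists>a b. 0 < a \<and> b < T \<and> (\<forall>t. t \<notin> {a..b} \<longrightarrow> \<phi> t = 0)"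
  proof (cases "S = {}")
    case True
    \<comment> \<open>With empty support any endpoints do; these satisfy both strict inequalities
      for every T.\<close>
    then show ?thesis using out by (intro exI[of _ 1] exI[of _ "T - 1"]) auto
  next
    case False
    obtain a where a: "a \<in> S" "\<And>x. x \<in> S \<Longrightarrow> a \<le> x"
      using compact_attains_inf[OF S(1) False] by blast
    obtain b where b: "b \<in> S" "\<And>x. x \<in> S \<Longrightarrow> x \<le> b"
      using compact_attains_sup[OF S(1) False] by blast
    have "\<phi> t = 0" if "t \<notin> {a..b}" for t using out[of t] a(2)[of t] b(2)[of t] that by auto
    then show ?thesis using a(1) b(1) S(2) by (intro exI[of _ a] exI[of _ b]) auto
  qed
next
  assume "smooth \<phi> \<and> (\<exists>a b. 0 < a \<and> b < T \<and> (\<forall>t. t \<notin> {a..b} \<longrightarrow> \<phi> t = 0))"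
  then obtain a b where s: "smooth \<phi>" and ab: "0 < a" "b < T" "\<And>t. t \<notin> {a..b} \<Longrightarrow> \<phi> t = 0" by blast
  have sub: "closure {t. \<phi> t \<noteq> 0} \<subseteq> {a..b}"
    using ab(3) by (intro closure_minimal) (blast, simp)
  then have "bounded (closure {t. \<phi> t \<noteq> 0})" by (rule bounded_subset[rotated]) simp
  then have "compact (closure {t. \<phi> t \<noteq> 0})" by (simp add: compact_eq_bounded_closed)
  then show "test_function T \<phi>" using s sub ab by (auto simp: test_function_def smooth_def)
qed

lemma test_function_smooth: "test_function T \<phi> \<Longrightarrow> smooth \<phi>"
  by (simp add: test_function_iff)

lemma test_function_has_derivative: "test_function T \<phi> \<Longrightarrow> (\<phi> has_real_derivative deriv \<phi> t) (at t)"
  using test_function_smooth smooth_has_derivative by blast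

lemma test_function_zero: "test_function T \<phi> \<Longrightarrow> t \<notin> {0<..<T} \<Longrightarrow> \<phi> t = 0"
  unfolding test_function_iff by (metis atLeastAtMost_iff greaterThanLessThan_iff less_le_trans le_less_trans)

lemma test_function_lincomb:
  assumes "test_function T \<phi>" "test_function T \<psi>"
  shows "test_function T (\<lambda>t. r * \<phi> t + s * \<psi> t)"
proof -
  obtain a b c d where *: "0 < a" "b < T" "\<And>t. t \<notin> {a..b} \<Longrightarrow> \<phi> t = 0"
    "0 < c" "d < T" "\<And>t. t \<notin> {c..d} \<Longrightarrow> \<psi> t = 0"
    using assms unfolding test_function_iff by metis
  have "r * \<phi> t + s * \<psi> t = 0" if "t \<notin> {min a c..max b d}" for t
    proof -
    have "t \<notin> {a..b}" "t \<notin> {c..d}" using that by auto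
    then show ?thesis using * by simp
  qed
  then show ?thesis using assms * unfolding test_function_iff
    by (intro conjI smooth_lincomb exI[of _ "min a c"] exI[of _ "max b d"]) auto
qed

lemma test_function_bump:
  assumes "0 < a" "b < T" "0 < c"
  shows "test_function T (\<lambda>t. flat 0 (c * (t - a)) * flat 0 (c * (b - t)))"
proof -
  have "(\<lambda>t. flat 0 (c * (t - a)) * flat 0 (c * (b - t))) \<in> bump_span c a b" by (rule bump_span.base)
  then show ?thesis unfolding test_function_iff
    using smooth_bump_span bump_span_support assms
    by (intro conjI exI[of _ a] exI[of _ b]) (blast, auto simp: flat_def zero_less_mult_iff)
qed

lemma test_function_deriv:
  assumes "test_function T \<phi>" shows "test_function T (deriv \<phi>)"
proof -
  obtain a b where ab: "0 < a" "b < T" "\<And>t. t \<notin> {a..b} \<Longrightarrow> \<phi> t = 0"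
    using assms unfolding test_function_iff by metis
  have "deriv \<phi> t = 0" if t: "t \<notin> {a..b}" for t
  proof -
    have "\<forall>\<^sub>F x in nhds t. x \<in> - {a..b}" using t by (intro eventually_nhds_in_open) auto
    then have "\<forall>\<^sub>F x in nhds t. \<phi> x = 0" by eventually_elim (use ab in auto)
    then have "deriv \<phi> t = deriv (\<lambda>_. 0) t" by (intro deriv_cong_ev) auto
    then show ?thesis by simp
  qed
  then show ?thesis using assms ab smooth_deriv unfolding test_function_iff by blast
qed

text \<open>The primitive starting at 0 vanishes to the left of the support of f; to the right of it
  its constant value is the integral of f, which the mean condition makes 0.\<close>

lemma test_function_antiderivative:
  assumes f: "test_function T f" and mean: "integral {0..T} f = 0"
  obtains F where "test_function T F" "deriv F = f"
proof -
  obtain a b where ab: "0 < a" "b < T" "\<And>t. t \<notin> {a..b} \<Longrightarrow> f t = 0"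
    using f unfolding test_function_iff by metis
  have cont: "continuous_on S f" for S using f test_function_smooth smooth_continuous by blast
  define F where "F t = integral {0..t} f" for t
  have left: "F t = 0" if "t < a" for t
    unfolding F_def using ab that by (subst integral_cong[where g = "\<lambda>_. 0"]) auto
  have right: "F t = 0" if t: "b < t" for t
  proof (cases "0 \<le> b")
    case True
    have int: "f integrable_on {x..y}" for x y by (intro integrable_continuous_interval cont)
    have "F s = integral {0..b} f" if "b \<le> s" for s
    proof -
      have "integral {b..s} f = integral {b..s} (\<lambda>_. 0)"
        using ab by (intro integral_spike[of "{b}"]) auto
      then show ?thesis unfolding F_def
        using Henstock_Kurzweil_Integration.integral_combine[OF True that int] by simp
    qed
    from this[of t] this[of T] t ab mean show ?thesis by (simp add: F_def)
  next
    case False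
    then show ?thesis unfolding F_def using ab by (subst integral_cong[where g = "\<lambda>_. 0"]) auto
  qed
  have der: "(F has_real_derivative f t) (at t)" for t
  proof (cases "t < a")
    case True
    have "((\<lambda>_. 0) has_real_derivative 0) (at t)" by simp
    then have "(F has_real_derivative 0) (at t)"
      by (rule DERIV_cong_ev[THEN iffD1, rotated -1])
        (use True left in \<open>auto simp: eventually_nhds intro!: exI[of _ "{..<a}"]\<close>)
    then show ?thesis using True ab by simp
  next
    case False
    then have t: "t \<in> {0<..<t + 1}" using ab by simp
    have "(F has_vector_derivative f t) (at t within {0..t+1})"
      unfolding F_def using t by (intro integral_has_vector_derivative cont) auto
    then show ?thesis
      using at_within_interior[of t "{0..t+1}"] t
      by (simp add: has_real_derivative_iff_has_vector_derivative)
  qed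
  have "test_function T F" unfolding test_function_iff
    using smooth_antiderivative[OF test_function_smooth[OF f] der] ab left right
    by (intro conjI exI[of _ a] exI[of _ b]) (auto simp: not_le)
  moreover have "deriv F = f" using der by (auto intro: DERIV_imp_deriv)
  ultimately show ?thesis by (rule that)
qed

lemma test_function_measurable [measurable]: "test_function T \<phi> \<Longrightarrow> \<phi> \<in> borel_measurable lebesgue"
  using borel_measurable_continuous_onI[OF smooth_continuous[OF test_function_smooth], of T \<phi>]
  by (intro measurable_completion) simp

lemma test_function_bounded:
  assumes "test_function T \<phi>" obtains M where "\<And>t. \<bar>\<phi> t\<bar> \<le> M"
proof -
  have "compact (\<phi> ` {0..T})"
    using assms by (intro compact_continuous_image) (auto simp: test_function_smooth smooth_continuous)
  then obtain M where M: "\<And>t. t \<in> {0..T} \<Longrightarrow> \<bar>\<phi> t\<bar> \<le> M"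
    using compact_imp_bounded bounded_iff by (metis image_eqI real_norm_def)
  have "\<bar>\<phi> t\<bar> \<le> max M 0" for t
    using M[of t] test_function_zero[OF assms, of t] by (cases "t \<in> {0..T}") auto
  then show ?thesis by (rule that)
qed

section \<open>The fundamental lemma of the calculus of variations\<close>

lemma flat_seq_tendsto_1:
  assumes "0 < x"
  shows "(\<lambda>n. flat 0 (real (Suc n) * x - \<delta>)) \<longlonglongrightarrow> 1"
proof -
  have lim: "filterlim (\<lambda>n. real (Suc n) * x - \<delta>) at_top sequentially"
    using assms by real_asymp
  have "(\<lambda>n. exp (- inverse (real (Suc n) * x - \<delta>))) \<longlonglongrightarrow> exp (- 0)"
    by (intro tendsto_intros filterlim_compose[OF tendsto_inverse_0_at_top lim] filterlim_ident)
  then have "(\<lambda>n. exp (- inverse (real (Suc n) * x - \<delta>))) \<longlonglongrightarrow> 1" by simp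
  then show ?thesis
  proof (rule Lim_transform_eventually)
    show "\<forall>\<^sub>F n in sequentially. exp (- inverse (real (Suc n) * x - \<delta>)) = flat 0 (real (Suc n) * x - \<delta>)"
      using lim[unfolded filterlim_at_top_dense, rule_format, of 0] by eventually_elim (simp add: flat_def)
  qed
qed

text \<open>Bumps with values in \<open>[0, 1]\<close> converge pointwise to the indicator of the
  part of the interval inside (0, T), and the products are dominated by |g|.\<close>

lemma integral_interval_eq_0:
  assumes g: "integrable lebesgue g" and out: "\<And>t. t \<notin> {0<..<T} \<Longrightarrow> g t = 0"
    and test: "\<And>\<phi>. test_function T \<phi> \<Longrightarrow> (LINT t|lebesgue. \<phi> t * g t) = 0"
  shows "(LINT t|lebesgue. indicator {a<..<b} t * g t) = 0"
proof -
  define a' b' where "a' = max a 0" and "b' = min b T"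
  have eq: "indicator {a<..<b} t * g t = indicator {a'<..<b'} t * g t" for t
    using out[of t] by (auto simp: a'_def b'_def indicator_def)
  show ?thesis
  proof (cases "a' < b'")
    case False
    then show ?thesis unfolding eq by simp
  next
    case True
    define \<delta> where "\<delta> = (b' - a') / 3"
    have \<delta>: "0 < \<delta>" using True by (simp add: \<delta>_def)
    \<comment> \<open>Steepness n + 1 drives the values inside to 1, while the shift \<delta>/(n+1)
      keeps the support strictly inside (0, T). In the rescaled variable the shift is the constant
      \<delta>.\<close>
    define \<phi> where "\<phi> n t = flat 0 (real (Suc n) * (t - (a' + \<delta> / real (Suc n)))) *
      flat 0 (real (Suc n) * ((b' - \<delta> / real (Suc n)) - t))" for n t
    have \<phi>_eq: "\<phi> n t = flat 0 (real (Suc n) * (t - a') - \<delta>) * flat 0 (real (Suc n) * (b' - t) - \<delta>)" for n t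
      by (simp add: \<phi>_def algebra_simps del: of_nat_Suc)
    have tf: "test_function T (\<phi> n)" for n
    proof -
      have "0 < \<delta> / real (Suc n)" using \<delta> by simp
      moreover have "0 \<le> a'" "b' \<le> T" by (auto simp: a'_def b'_def)
      ultimately show ?thesis
        unfolding \<phi>_def[abs_def] by (intro test_function_bump) linarith+
    qed
    have bd: "\<bar>\<phi> n t\<bar> \<le> 1" for n t
      unfolding \<phi>_def by (simp add: abs_mult flat_0_bounds mult_le_one)
    have lim: "(\<lambda>n. \<phi> n t) \<longlonglongrightarrow> indicator {a'<..<b'} t" for t
    proof (cases "t \<in> {a'<..<b'}")
      case True
      then show ?thesis unfolding \<phi>_eq
        using tendsto_mult[OF flat_seq_tendsto_1[of "t - a'" \<delta>] flat_seq_tendsto_1[of "b' - t" \<delta>]] by simp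
    next
      case False
      then have "\<phi> n t = 0" for n
      proof -
        have "real (Suc n) * (t - a') \<le> 0 \<or> real (Suc n) * (b' - t) \<le> 0"
          using False by (auto simp: not_less intro: mult_nonneg_nonpos)
        then show ?thesis using \<delta> unfolding \<phi>_eq by (auto simp: flat_def simp del: of_nat_Suc)
      qed
      then show ?thesis using False by simp
    qed
    have [measurable]: "g \<in> borel_measurable lebesgue" using g by auto
    have "(\<lambda>n. LINT t|lebesgue. \<phi> n t * g t) \<longlonglongrightarrow> (LINT t|lebesgue. indicator {a'<..<b'} t * g t)"
    proof (rule integral_dominated_convergence[where w = "\<lambda>t. \<bar>g t\<bar>"])
      show "(\<lambda>t. \<phi> n t * g t) \<in> borel_measurable lebesgue" for n
        using tf by measurable
      show "AE t in lebesgue. (\<lambda>n. \<phi> n t * g t) \<longlonglongrightarrow> indicator {a'<..<b'} t * g t"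
        by (intro AE_I2 tendsto_mult lim tendsto_const)
      show "AE t in lebesgue. norm (\<phi> n t * g t) \<le> \<bar>g t\<bar>" for n
        using bd by (simp add: abs_mult mult_left_le_one_le)
    qed (use g in auto)
    moreover have "(LINT t|lebesgue. \<phi> n t * g t) = 0" for n by (rule test[OF tf])
    ultimately show ?thesis unfolding eq by (simp add: LIMSEQ_const_iff)
  qed
qed

lemma borel_eq_Ioo: "borel = sigma UNIV (range (\<lambda>(a, b). {a<..<b::real}))"
proof -
  have "range (\<lambda>(a, b). box a b) = range (\<lambda>(a, b). {a<..<b::real})" by (simp add: box_real)
  then show ?thesis using borel_eq_box[where 'a = real] by simp
qed

text \<open>Dynkin's argument: open intervals are stable under intersection and generate the Borel
  sets, and the vanishing total integral takes care of complements. A density with zero integral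
  over all Borel sets is 0.\<close>

lemma AE_zero_if_interval_integrals_zero:
  fixes g :: "real \<Rightarrow> real"
  assumes g: "integrable lborel g"
    and Ioo: "\<And>a b. (LINT t|lborel. indicator {a<..<b} t * g t) = 0"
    and total: "(LINT t|lborel. g t) = 0"
  shows "AE t in lborel. g t = 0"
proof -
  have set0: "(LINT t:A|lborel. g t) = 0" if A: "A \<in> sets borel" for A
  proof -
    let ?G = "range (\<lambda>(a, b). {a<..<b::real})"
    have Ain: "A \<in> sigma_sets UNIV ?G"
      using A unfolding borel_eq_Ioo by (simp add: sets_measure_of)
    have "Int_stable ?G"
      unfolding Int_stable_def
    proof clarify
      fix a b c d :: real
      have "{a<..<b} \<inter> {c<..<d} = (\<lambda>(a, b). {a<..<b}) (max a c, min b d)" by auto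
      then show "{a<..<b} \<inter> {c<..<d} \<in> ?G" by blast
    qed
    moreover have "?G \<subseteq> Pow UNIV" by simp
    ultimately show ?thesis using Ain
    proof (induction rule: sigma_sets_induct_disjoint)
      case (basic A)
      then show ?case using Ioo by (auto simp: set_lebesgue_integral_def)
    next
      case empty
      show ?case by (simp add: set_lebesgue_integral_def)
    next
      case (compl A)
      have [measurable]: "A \<in> sets borel"
        using compl(1) unfolding borel_eq_Ioo by (simp add: sets_measure_of)
      have "integrable lborel (\<lambda>t. indicator A t * g t)"
        using integrable_mult_indicator[of A lborel g] g by simp
      moreover have "(LINT t:UNIV - A|lborel. g t) = (LINT t|lborel. g t - indicator A t * g t)"
        unfolding set_lebesgue_integral_def by (intro Bochner_Integration.integral_cong) (auto simp: indicator_def)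
      ultimately show ?case
        using compl(2) total g by (simp add: set_lebesgue_integral_def)
    next
      case (union A)
      have B: "A i \<in> sets borel" for i
        using union(2) unfolding borel_eq_Ioo by (auto simp: sets_measure_of)
      have "(LINT t:(\<Union>i. A i)|lborel. g t) = (\<Sum>i. LINT t:A i|lborel. g t)"
      proof (rule lebesgue_integral_countable_add)
        show "set_integrable lborel (\<Union>i. A i) g"
          unfolding set_integrable_def using B g by (intro integrable_mult_indicator) auto
      qed (use union(1) B in \<open>auto simp: disjoint_family_on_def\<close>)
      then show ?case using union(3) by simp
    qed
  qed
  show ?thesis
    using density_unique_real[OF g integrable_zero] set0 by simp
qed

lemma fundamental_lemma:
  fixes g :: "real \<Rightarrow> real"
  assumes g: "integrable lebesgue g" and out: "\<And>t. t \<notin> {0<..<T} \<Longrightarrow> g t = 0"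
    and test: "\<And>\<phi>. test_function T \<phi> \<Longrightarrow> (LINT t|lebesgue. \<phi> t * g t) = 0"
  shows "AE t in lebesgue. g t = 0"
proof -
  have gm [measurable]: "g \<in> borel_measurable lebesgue" using g by auto
  \<comment> \<open>The argument by generators runs over Borel sets, so g is exchanged for a Borel
    function that equals it almost everywhere.\<close>
  obtain g' where g' [measurable]: "g' \<in> borel_measurable lborel" and ae: "AE t in lborel. g t = g' t"
    using completion_ex_borel_measurable_real[OF gm] by blast
  have g'm [measurable]: "g' \<in> borel_measurable lebesgue" by (rule measurable_completion[OF g'])
  have ae': "AE t in lebesgue. g t = g' t" by (rule AE_completion[OF ae])
  have g'i: "integrable lebesgue g'"
    using g integrable_cong_AE[OF gm g'm ae'] by simp
  have "AE t in lborel. g' t = 0"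
  proof (rule AE_zero_if_interval_integrals_zero)
    show "integrable lborel g'" using g'i g' by (simp add: integrable_completion)
    have I: "(LINT t|lborel. indicator {a<..<b} t * g' t) = 0" for a b
    proof -
      have "(LINT t|lborel. indicator {a<..<b} t * g' t) = (LINT t|lebesgue. indicator {a<..<b} t * g' t)"
        by (rule integral_completion[symmetric]) measurable
      also have "\<dots> = (LINT t|lebesgue. indicator {a<..<b} t * g t)"
        using ae' by (intro integral_cong_AE) auto
      also have "\<dots> = 0" by (rule integral_interval_eq_0[OF g out test])
      finally show ?thesis .
    qed
    then show "(LINT t|lborel. indicator {a<..<b} t * g' t) = 0" for a b .
    have "(LINT t|lborel. g' t) = (LINT t|lborel. indicator {0<..<T} t * g' t)"
      proof (intro integral_cong_AE)
      show "AE t in lborel. g' t = indicator {0<..<T} t * g' t"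
        using ae
      proof eventually_elim
        case (elim t)
        then show ?case using out[of t] by (cases "t \<in> {0<..<T}") auto
      qed
    qed auto
    then show "(LINT t|lborel. g' t) = 0" using I by simp
  qed
  then have "AE t in lebesgue. g' t = 0" by (rule AE_completion)
  with ae' show ?thesis by eventually_elim simp
qed

lemma sq_integrable_weight:
  fixes \<eta> :: "'v::{real_inner,second_countable_topology}"
  assumes f: "f \<in> borel_measurable lebesgue" and M: "\<And>t. \<bar>f t\<bar> \<le> M"
    and out: "\<And>t. t \<notin> {a..b} \<Longrightarrow> f t = 0"
  shows "sq_integrable (\<lambda>t. f t *\<^sub>R \<eta>)"
proof (rule sq_integrable_bound[where f = "\<lambda>t. indicator {a..b} t :: real" and C = "M * norm \<eta>"])
  have "integrable lebesgue (\<lambda>t. indicator {a..b} t :: real)"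
    by (rule integrable_real_indicator) (auto simp: emeasure_lborel_Icc_eq)
  then show "sq_integrable (\<lambda>t. indicator {a..b} t :: real)"
    by (simp add: sq_integrable_def power2_eq_square indicator_inter_arith[symmetric])
  show "(\<lambda>t. f t *\<^sub>R \<eta>) \<in> borel_measurable lebesgue" using f by measurable
  show "AE t in lebesgue. norm (f t *\<^sub>R \<eta>) \<le> M * norm \<eta> * norm (indicator {a..b} t :: real)"
    using M out by (intro AE_I2) (auto simp: indicator_def mult_right_mono)
qed

lemma sq_integrable_test:
  fixes \<eta> :: "'v::{real_inner,second_countable_topology}"
  assumes "test_function T \<phi>" shows "sq_integrable (\<lambda>t. \<phi> t *\<^sub>R \<eta>)"
proof -
  obtain M where M: "\<And>t. \<bar>\<phi> t\<bar> \<le> M" using test_function_bounded[OF assms] by blast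
  show ?thesis
  proof (rule sq_integrable_weight[OF test_function_measurable[OF assms] M])
    show "\<phi> t = 0" if "t \<notin> {0..T}" for t
      by (rule test_function_zero[OF assms]) (use that in auto)
  qed
qed

lemma sq_integrable_indicator_const:
  fixes \<eta> :: "'v::{real_inner,second_countable_topology}"
  assumes "A \<in> sets lebesgue" "A \<subseteq> {a..b}"
  shows "sq_integrable (\<lambda>t. indicator A t *\<^sub>R \<eta>)"
proof (rule sq_integrable_weight)
  show "indicator A \<in> borel_measurable lebesgue" using assms(1) by (rule borel_measurable_indicator)
  show "\<bar>indicator A t\<bar> \<le> (1::real)" for t by (simp add: indicator_def)
  show "indicator A t = (0::real)" if "t \<notin> {a..b}" for t using assms(2) that by (auto simp: indicator_def)
qed

lemma integrable_test_inner:
  fixes z :: "real \<Rightarrow> 'v::{real_inner,second_countable_topology}"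
  assumes "sq_integrable z" "test_function T \<phi>"
  shows "integrable lebesgue (\<lambda>t. \<phi> t * (z t \<bullet> \<eta>))"
  using sq_integrable_inner[OF assms(1) sq_integrable_test[OF assms(2)], of \<eta>] by simp

text \<open>Separability: countably many directions share one exceptional null set, and a vector
  orthogonal to a dense set is 0.\<close>

lemma fundamental_lemma_vector:
  fixes z :: "real \<Rightarrow> 'v::{real_inner,second_countable_topology}"
  assumes z: "sq_integrable z" and out: "\<And>t. t \<notin> {0<..<T} \<Longrightarrow> z t = 0"
    and test: "\<And>\<phi> \<eta>. test_function T \<phi> \<Longrightarrow> (LINT t|lebesgue. \<phi> t * (z t \<bullet> \<eta>)) = 0"
  shows "AE t in lebesgue. z t = 0"
proof -
  obtain D :: "'v set" where D: "countable D" "\<And>U. open U \<Longrightarrow> U \<noteq> {} \<Longrightarrow> \<exists>d\<in>D. d \<in> U"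
    using countable_dense_setE by blast
  have "AE t in lebesgue. z t \<bullet> \<eta> = 0" for \<eta>
  proof (rule fundamental_lemma[where T = T])
    have "integrable lebesgue (\<lambda>t. indicator {0..T} t * (z t \<bullet> \<eta>))"
      using sq_integrable_inner[OF z sq_integrable_indicator_const[of "{0..T}" 0 T \<eta>]] by simp
    moreover have "indicator {0..T} t * (z t \<bullet> \<eta>) = z t \<bullet> \<eta>" for t
      using out[of t] by (cases "t \<in> {0<..<T}") auto
    ultimately show "integrable lebesgue (\<lambda>t. z t \<bullet> \<eta>)" by simp
  qed (use out test in auto)
  then have "AE t in lebesgue. \<forall>d\<in>D. z t \<bullet> d = 0"
    using D(1) by (simp add: AE_ball_countable)
  then show ?thesis
  proof eventually_elim
    case (elim t)
    show ?case
    proof (rule ccontr)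
      assume ne: "z t \<noteq> 0"
      \<comment> \<open>Some d of the dense set is closer to \<open>z t\<close> than 0 is, which is
        incompatible with orthogonality.\<close>
      obtain d where d: "d \<in> D" "d \<in> ball (z t) (norm (z t))"
        using D(2)[of "ball (z t) (norm (z t))"] ne by (auto simp del: mem_ball)
      have "(norm (z t))\<^sup>2 = z t \<bullet> (z t - d)"
        using elim d by (simp add: power2_norm_eq_inner inner_diff_right)
      also have "\<dots> \<le> norm (z t) * norm (z t - d)" by (rule norm_cauchy_schwarz)
      also have "\<dots> < norm (z t) * norm (z t)"
        using d ne by (intro mult_strict_left_mono) (auto simp: dist_norm)
      finally show False by (simp add: power2_eq_square)
    qed
  qed
qed

lemma test_function_integral:
  assumes "test_function T \<phi>"
  shows "integrable lebesgue \<phi>" "(LINT t|lebesgue. \<phi> t) = integral {0..T} \<phi>"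
proof -
  show int: "integrable lebesgue \<phi>"
  proof -
    have "integrable lebesgue (\<lambda>t. (\<phi> t *\<^sub>R 1) \<bullet> (indicator {0..T} t *\<^sub>R (1::real)))"
      by (rule sq_integrable_inner[OF sq_integrable_test[OF assms] sq_integrable_indicator_const]) auto
    moreover have "(\<lambda>t. (\<phi> t *\<^sub>R 1) \<bullet> (indicator {0..T} t *\<^sub>R (1::real))) = \<phi>"
    proof
      show "(\<phi> t *\<^sub>R 1) \<bullet> (indicator {0..T} t *\<^sub>R (1::real)) = \<phi> t" for t
        using test_function_zero[OF assms, of t] by (cases "t \<in> {0<..<T}") auto
    qed
    ultimately show ?thesis by simp
  qed
  have "set_integrable lebesgue {0..T} \<phi>"
    unfolding set_integrable_def using int by (intro integrable_mult_indicator) auto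
  from set_lebesgue_integral_eq_integral(2)[OF this]
  have "(LINT t:{0..T}|lebesgue. \<phi> t) = integral {0..T} \<phi>" .
  moreover have "(\<lambda>t. indicator {0..T} t *\<^sub>R \<phi> t) = \<phi>"
  proof
    show "indicator {0..T} t *\<^sub>R \<phi> t = \<phi> t" for t
      using test_function_zero[OF assms, of t] by (cases "t \<in> {0<..<T}") auto
  qed
  ultimately show "(LINT t|lebesgue. \<phi> t) = integral {0..T} \<phi>"
    by (simp add: set_lebesgue_integral_def)
qed

lemma normalized_test_function:
  assumes "0 < T" obtains \<psi> where "test_function T \<psi>" "(LINT t|lebesgue. \<psi> t) = 1"
proof -
  define b where "b t = flat 0 (1 * (t - T/3)) * flat 0 (1 * (2 * T/3 - t))" for t
  have b: "test_function T b" unfolding b_def[abs_def] using assms by (intro test_function_bump) auto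
  have cont: "continuous_on {0..T} b" by (rule smooth_continuous[OF test_function_smooth[OF b]])
  have nn: "0 \<le> b t" for t by (simp add: b_def flat_0_bounds)
  have pos: "b (T/2) \<noteq> 0" using assms by (simp add: b_def flat_def)
  have iff: "integral {0..T} b = 0 \<longleftrightarrow> (\<forall>x\<in>{0..T}. b x = 0)"
    by (rule integral_eq_0_iff[OF cont assms nn])
  have "integral {0..T} b \<noteq> 0"
  proof
    assume "integral {0..T} b = 0"
    moreover have "T/2 \<in> {0..T}" using assms by simp
    ultimately have "b (T/2) = 0" unfolding iff by (rule bspec)
    then show False using pos by contradiction
  qed
  then have I: "(LINT t|lebesgue. b t) \<noteq> 0" using test_function_integral[OF b] by simp
  define c where "c = inverse (LINT t|lebesgue. b t)"
  show ?thesis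
  proof
    show "test_function T (\<lambda>t. c * b t + 0 * b t)" by (intro test_function_lincomb b)
    show "(LINT t|lebesgue. c * b t + 0 * b t) = 1"
      using I test_function_integral(1)[OF b] by (simp add: c_def)
  qed
qed

text \<open>Every test function is the derivative of a test function plus a multiple of a fixed
  \<psi> of mean one. Subtracting from z its \<psi>-weighted mean therefore leaves a function that
  annihilates all test functions.\<close>

lemma du_Bois_Reymond:
  fixes z :: "real \<Rightarrow> 'v::{real_inner,complete_space,second_countable_topology}"
  assumes T: "0 < T" and z: "sq_integrable z" and out: "\<And>t. t \<notin> {0<..<T} \<Longrightarrow> z t = 0"
    and test: "\<And>\<phi> \<eta>. test_function T \<phi> \<Longrightarrow> (LINT t|lebesgue. deriv \<phi> t * (z t \<bullet> \<eta>)) = 0"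
  shows "\<exists>c. AE t in lebesgue. t \<in> {0<..<T} \<longrightarrow> z t = c"
proof -
  obtain \<psi> where \<psi>: "test_function T \<psi>" "(LINT t|lebesgue. \<psi> t) = 1"
    using normalized_test_function[OF T] by blast
  \<comment> \<open>The \<psi>-weighted mean of z as a functional; its Riesz representative is the
    sought constant.\<close>
  define l where "l \<eta> = (LINT t|lebesgue. \<psi> t * (z t \<bullet> \<eta>))" for \<eta>
  have zm [measurable]: "z \<in> borel_measurable lebesgue" using z by (simp add: sq_integrable_def)
  have [measurable]: "\<psi> \<in> borel_measurable lebesgue" using \<psi>(1) by measurable
  have zint: "integrable lebesgue (\<lambda>t. \<phi> t * (z t \<bullet> \<eta>))" if "test_function T \<phi>" for \<phi> \<eta>
    using z that by (rule integrable_test_inner)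
  have "bounded_linear l"
  proof (rule bounded_linear_intro)
    show "l (x + y) = l x + l y" for x y
      by (simp add: l_def inner_add_right distrib_left zint[OF \<psi>(1)])
    show "l (r *\<^sub>R x) = r *\<^sub>R l x" for r x
      by (simp add: l_def mult.left_commute)
    have n: "integrable lebesgue (\<lambda>t. norm (\<psi> t *\<^sub>R z t))"
    proof -
      have a: "sq_integrable (\<lambda>t. \<psi> t *\<^sub>R (1::real))" by (rule sq_integrable_test[OF \<psi>(1)])
      have b: "sq_integrable (\<lambda>t. norm (z t))" by (rule sq_integrable_bound[OF z, where C = 1]) auto
      from integrable_norm[OF sq_integrable_inner[OF a b]] show ?thesis by (simp add: abs_mult)
    qed
    show "norm (l x) \<le> norm x * (LINT t|lebesgue. norm (\<psi> t *\<^sub>R z t))" for x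
    proof -
      have "norm (l x) \<le> (LINT t|lebesgue. norm (\<psi> t * (z t \<bullet> x)))"
        unfolding l_def by (rule integral_norm_bound)
      also have "\<dots> \<le> (LINT t|lebesgue. norm x * norm (\<psi> t *\<^sub>R z t))"
      proof (rule integral_mono)
        show "norm (\<psi> t * (z t \<bullet> x)) \<le> norm x * norm (\<psi> t *\<^sub>R z t)" for t
          using mult_left_mono[OF Cauchy_Schwarz_ineq2[of "z t" x], of "\<bar>\<psi> t\<bar>"]
          by (simp add: abs_mult mult_ac)
      qed (use n zint[OF \<psi>(1)] in auto)
      finally show ?thesis by simp
    qed
  qed
  then obtain c where c: "\<And>\<eta>. c \<bullet> \<eta> = l \<eta>" using riesz_representation by blast
  define z1 where "z1 t = z t - indicator {0<..<T} t *\<^sub>R c" for t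
  have ind: "sq_integrable (\<lambda>t. indicator {0<..<T} t *\<^sub>R c)"
    by (rule sq_integrable_indicator_const[where a = 0 and b = T]) auto
  have "AE t in lebesgue. z1 t = 0"
  proof (rule fundamental_lemma_vector)
    show "sq_integrable z1" unfolding z1_def[abs_def] by (intro sq_integrable_diff z ind)
    show "z1 t = 0" if "t \<notin> {0<..<T}" for t using that out by (simp add: z1_def)
    fix \<phi> and \<eta> :: 'v assume \<phi>: "test_function T \<phi>"
    define J where "J = (LINT t|lebesgue. \<phi> t)"
    have f: "test_function T (\<lambda>t. 1 * \<phi> t + (- J) * \<psi> t)" by (intro test_function_lincomb \<phi> \<psi>)
    have "(LINT t|lebesgue. 1 * \<phi> t + (- J) * \<psi> t) = 0"
      using test_function_integral(1)[OF \<phi>] test_function_integral(1)[OF \<psi>(1)] \<psi>(2) by (simp add: J_def)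
    then have "integral {0..T} (\<lambda>t. 1 * \<phi> t + (- J) * \<psi> t) = 0"
      using test_function_integral(2)[OF f] by simp
    then obtain F where F: "test_function T F" "deriv F = (\<lambda>t. 1 * \<phi> t + (- J) * \<psi> t)"
      using test_function_antiderivative[OF f] by blast
    have "0 = (LINT t|lebesgue. \<phi> t * (z t \<bullet> \<eta>) - J * (\<psi> t * (z t \<bullet> \<eta>)))"
      using test[OF F(1), of \<eta>] by (simp add: F(2) algebra_simps)
    also have "\<dots> = (LINT t|lebesgue. \<phi> t * (z t \<bullet> \<eta>)) - J * l \<eta>"
      using zint[OF \<phi>] zint[OF \<psi>(1)] by (simp add: l_def)
    finally have 1: "(LINT t|lebesgue. \<phi> t * (z t \<bullet> \<eta>)) = J * (c \<bullet> \<eta>)" using c by simp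
    have "(LINT t|lebesgue. \<phi> t * (z1 t \<bullet> \<eta>)) = (LINT t|lebesgue. \<phi> t * (z t \<bullet> \<eta>) - \<phi> t * (c \<bullet> \<eta>))"
      using test_function_zero[OF \<phi>]
      by (intro Bochner_Integration.integral_cong) (auto simp: z1_def inner_diff_left right_diff_distrib indicator_def)
    also have "\<dots> = (LINT t|lebesgue. \<phi> t * (z t \<bullet> \<eta>)) - J * (c \<bullet> \<eta>)"
      using zint[OF \<phi>] test_function_integral(1)[OF \<phi>] by (simp add: J_def)
    finally show "(LINT t|lebesgue. \<phi> t * (z1 t \<bullet> \<eta>)) = 0" using 1 by simp
  qed
  then have "AE t in lebesgue. t \<in> {0<..<T} \<longrightarrow> z t = c"
    by eventually_elim (auto simp: z1_def)
  then show ?thesis ..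
qed

section \<open>Weak antiderivatives\<close>

text \<open>The difference quotients of K are bounded by increments of the continuous Q, so K has
  derivative 0 at every point. This takes the place of almost-everywhere differentiation of
  absolutely continuous functions.\<close>

lemma constant_if_superlinear_increments:
  fixes K Q :: "real \<Rightarrow> real"
  assumes T: "0 \<le> T" and Q: "continuous_on {0..T} Q"
    and le: "\<And>s t. 0 \<le> s \<Longrightarrow> s \<le> t \<Longrightarrow> t \<le> T \<Longrightarrow> \<bar>K t - K s\<bar> \<le> (t - s) * (Q t - Q s)"
  shows "K T = K 0"
proof -
  have "\<exists>c. \<forall>x\<in>{0..T}. K x = c"
  proof (rule has_field_derivative_zero_constant)
    fix x assume x: "x \<in> {0..T}"
    have "((\<lambda>y. (K y - K x) / (y - x)) \<longlongrightarrow> 0) (at x within {0..T})"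
    proof (rule Lim_null_comparison)
      have "(Q \<longlongrightarrow> Q x) (at x within {0..T})" using Q x by (simp add: continuous_on_def)
      then show "((\<lambda>y. \<bar>Q y - Q x\<bar>) \<longlongrightarrow> 0) (at x within {0..T})"
        by (intro tendsto_rabs_zero LIM_zero)
      show "\<forall>\<^sub>F y in at x within {0..T}. norm ((K y - K x) / (y - x)) \<le> \<bar>Q y - Q x\<bar>"
        unfolding eventually_at_filter
      proof (intro always_eventually allI impI)
        fix y assume y: "y \<noteq> x" "y \<in> {0..T}"
        have "\<bar>K y - K x\<bar> \<le> \<bar>y - x\<bar> * \<bar>Q y - Q x\<bar>"
        proof (cases "x \<le> y")
          case True
          then have "\<bar>K y - K x\<bar> \<le> (y - x) * (Q y - Q x)" using le[of x y] x y by simp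
          also have "\<dots> \<le> \<bar>(y - x) * (Q y - Q x)\<bar>" by (rule abs_ge_self)
          finally show ?thesis by (simp add: abs_mult)
        next
          case False
          then have "\<bar>K x - K y\<bar> \<le> (x - y) * (Q x - Q y)" using le[of y x] x y by simp
          also have "\<dots> \<le> \<bar>(x - y) * (Q x - Q y)\<bar>" by (rule abs_ge_self)
          finally show ?thesis by (simp add: abs_mult abs_minus_commute)
        qed
        then show "norm ((K y - K x) / (y - x)) \<le> \<bar>Q y - Q x\<bar>"
          using y by (simp add: abs_divide divide_le_eq mult.commute)
      qed
    qed
    then show "(K has_field_derivative 0) (at x within {0..T})"
      by (simp add: has_field_derivative_iff)
  qed simp
  then show ?thesis using T by auto
qed

text \<open>\<open>y\<close> is an antiderivative of \<open>q\<close> on \<open>[0,\<infinity>)\<close>, tested against every vector; the type of \<open>q\<close> is not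
  an instance of the class \<open>banach\<close>, so that its Bochner integral is not at hand.\<close>

definition weak_primitive :: "(real \<Rightarrow> 'v::{real_inner,second_countable_topology}) \<Rightarrow> (real \<Rightarrow> 'v) \<Rightarrow> bool" where
  "weak_primitive y q \<longleftrightarrow> sq_integrable q \<and>
     (\<forall>s t \<eta>. 0 \<le> s \<longrightarrow> s \<le> t \<longrightarrow> (y t - y s) \<bullet> \<eta> = (LINT \<tau>:{s..t}|lebesgue. q \<tau> \<bullet> \<eta>))"

lemma weak_primitiveD:
  "weak_primitive y q \<Longrightarrow> sq_integrable q"
  "weak_primitive y q \<Longrightarrow> 0 \<le> s \<Longrightarrow> s \<le> t \<Longrightarrow> (y t - y s) \<bullet> \<eta> = (LINT \<tau>:{s..t}|lebesgue. q \<tau> \<bullet> \<eta>)"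
  by (auto simp: weak_primitive_def)

lemma set_integrable_inner:
  "sq_integrable q \<Longrightarrow> set_integrable lebesgue {s..t} (\<lambda>\<tau>. q \<tau> \<bullet> \<eta>)"
  using sq_integrable_inner[OF _ sq_integrable_indicator_const[of "{s..t}" s t \<eta>], of q]
  by (simp add: set_integrable_def)

lemma integrable_imp_set_integrable:
  fixes f :: "real \<Rightarrow> real"
  assumes "integrable lebesgue f" shows "set_integrable lebesgue {s..t} f"
  unfolding set_integrable_def using assms by (intro integrable_mult_indicator) auto

lemma set_integral_combine:
  fixes f :: "real \<Rightarrow> real"
  assumes "r \<le> s" "s \<le> t" "set_integrable lebesgue {r..t} f"
  shows "(LINT \<tau>:{r..t}|lebesgue. f \<tau>) = (LINT \<tau>:{r..s}|lebesgue. f \<tau>) + (LINT \<tau>:{s..t}|lebesgue. f \<tau>)"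
proof -
  have 1: "set_integrable lebesgue {r..s} f" "set_integrable lebesgue {s..t} f"
    using assms by (auto intro: set_integrable_subset)
  have "f integrable_on {r..t}" using assms(3) by (rule set_lebesgue_integral_eq_integral(1))
  then show ?thesis
    using Henstock_Kurzweil_Integration.integral_combine[of r s t f] assms 1
    by (simp add: set_lebesgue_integral_eq_integral(2))
qed

lemma continuous_indefinite_integral:
  fixes f :: "real \<Rightarrow> real"
  assumes "set_integrable lebesgue {a..b} f"
  shows "continuous_on {a..b} (\<lambda>t. LINT \<tau>:{a..t}|lebesgue. f \<tau>)"
proof -
  have "continuous_on {a..b} (\<lambda>t. integral {a..t} f)"
    using assms by (intro indefinite_integral_continuous_1 set_lebesgue_integral_eq_integral(1))
  moreover have "(LINT \<tau>:{a..t}|lebesgue. f \<tau>) = integral {a..t} f" if "t \<in> {a..b}" for t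
    using that assms by (intro set_lebesgue_integral_eq_integral(2) set_integrable_subset[OF assms]) auto
  ultimately show ?thesis by (rule continuous_on_eq[OF _ sym])
qed

lemma set_integral_const [simp]: "s \<le> t \<Longrightarrow> (LINT \<tau>:{s..t}|lebesgue. (c::real)) = c * (t - s)"
  by (simp add: set_lebesgue_integral_def)

lemma set_integrable_const_Icc: "set_integrable lebesgue {s..t::real} (\<lambda>_. c::real)"
  unfolding set_integrable_def
  by (rule integrable_scaleR_left, rule integrable_real_indicator) (auto simp: emeasure_lborel_Icc_eq)

lemma AM_GM_weighted:
  fixes a b h :: real
  assumes "0 < h" shows "a * b \<le> (h * a\<^sup>2 + b\<^sup>2 / h) / 2"
proof -
  have "0 \<le> (h * a - b)\<^sup>2 / h" using assms by simp
  also have "\<dots> = h * a\<^sup>2 - 2 * (a * b) + b\<^sup>2 / h"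
    using assms by (simp add: power2_eq_square field_simps)
  finally show ?thesis by simp
qed

text \<open>Young's inequality with weight t - s: the constant \<open>E / (t - s)\<close> is
  integrated over a length t - s and returns to E.\<close>

lemma set_integral_inner_le:
  fixes q d :: "real \<Rightarrow> 'v::{real_inner,second_countable_topology}"
  assumes st: "s < t" and q: "sq_integrable q"
    and int: "set_integrable lebesgue {s..t} (\<lambda>\<tau>. q \<tau> \<bullet> d \<tau>)"
    and d: "\<And>\<tau>. \<tau> \<in> {s..t} \<Longrightarrow> (norm (d \<tau>))\<^sup>2 \<le> E"
  shows "\<bar>LINT \<tau>:{s..t}|lebesgue. q \<tau> \<bullet> d \<tau>\<bar> \<le>
    ((t - s) * (LINT \<tau>:{s..t}|lebesgue. (norm (q \<tau>))\<^sup>2) + E) / 2"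
proof -
  have qi: "set_integrable lebesgue {s..t} (\<lambda>\<tau>. (norm (q \<tau>))\<^sup>2)"
    using q by (intro integrable_imp_set_integrable) (simp add: sq_integrable_def)
  have "\<bar>LINT \<tau>:{s..t}|lebesgue. q \<tau> \<bullet> d \<tau>\<bar> \<le> (LINT \<tau>:{s..t}|lebesgue. \<bar>q \<tau> \<bullet> d \<tau>\<bar>)"
    using set_integral_norm_bound[OF int] by simp
  also have "\<dots> \<le> (LINT \<tau>:{s..t}|lebesgue. ((t - s) / 2) * (norm (q \<tau>))\<^sup>2 + E / (t - s) / 2)"
  proof (rule set_integral_mono)
    show "set_integrable lebesgue {s..t} (\<lambda>\<tau>. \<bar>q \<tau> \<bullet> d \<tau>\<bar>)" using int by (rule set_integrable_abs)
    show "set_integrable lebesgue {s..t} (\<lambda>\<tau>. ((t - s) / 2) * (norm (q \<tau>))\<^sup>2 + E / (t - s) / 2)"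
      using qi by (intro set_integral_add set_integrable_mult_right set_integrable_const_Icc) auto
    fix \<tau> assume \<tau>: "\<tau> \<in> {s..t}"
    have "\<bar>q \<tau> \<bullet> d \<tau>\<bar> \<le> norm (q \<tau>) * norm (d \<tau>)" by (rule Cauchy_Schwarz_ineq2)
    also have "\<dots> \<le> ((t - s) * (norm (q \<tau>))\<^sup>2 + (norm (d \<tau>))\<^sup>2 / (t - s)) / 2"
      using st by (intro AM_GM_weighted) simp
    also have "\<dots> \<le> ((t - s) / 2) * (norm (q \<tau>))\<^sup>2 + E / (t - s) / 2"
      using d[OF \<tau>] st by (simp add: add_divide_distrib divide_right_mono)
    finally show "\<bar>q \<tau> \<bullet> d \<tau>\<bar> \<le> ((t - s) / 2) * (norm (q \<tau>))\<^sup>2 + E / (t - s) / 2" .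
  qed
  also have "\<dots> = ((t - s) / 2) * (LINT \<tau>:{s..t}|lebesgue. (norm (q \<tau>))\<^sup>2) + E / (t - s) / 2 * (t - s)"
    using qi st by (subst set_integral_add(2)) (auto intro!: set_integrable_const_Icc)
  also have "E / (t - s) / 2 * (t - s) = E / 2" using st by (simp add: field_simps)
  finally show ?thesis by (simp add: add_divide_distrib)
qed

text \<open>The increment is paired with itself, and half of its square is absorbed into the left
  side.\<close>

lemma weak_primitive_increment:
  assumes p: "weak_primitive y q" and st: "0 \<le> s" "s \<le> t"
  shows "(norm (y t - y s))\<^sup>2 \<le> (t - s) * (LINT \<tau>:{s..t}|lebesgue. (norm (q \<tau>))\<^sup>2)"
proof (cases "s = t")
  case False
  then have "s < t" using st by simp
  define d where "d = y t - y s"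
  have q: "sq_integrable q" using p by (rule weak_primitiveD)
  have "(norm d)\<^sup>2 = (LINT \<tau>:{s..t}|lebesgue. q \<tau> \<bullet> d)"
    using weak_primitiveD(2)[OF p st, of d] by (simp add: power2_norm_eq_inner d_def)
  also have "\<dots> \<le> ((t - s) * (LINT \<tau>:{s..t}|lebesgue. (norm (q \<tau>))\<^sup>2) + (norm d)\<^sup>2) / 2"
    using set_integral_inner_le[OF \<open>s < t\<close> q set_integrable_inner[OF q], of d "(norm d)\<^sup>2"] by simp
  finally show ?thesis by (simp add: d_def)
qed simp

text \<open>The increment bound makes y Hoelder continuous with exponent 1/2.\<close>

lemma weak_primitive_continuous:
  assumes p: "weak_primitive y q"
  shows "continuous_on {0..} y"
proof -
  define M where "M = (LINT \<tau>|lebesgue. (norm (q \<tau>))\<^sup>2)"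
  have q: "integrable lebesgue (\<lambda>\<tau>. (norm (q \<tau>))\<^sup>2)"
    using weak_primitiveD(1)[OF p] by (simp add: sq_integrable_def)
  have le: "(norm (y t - y s))\<^sup>2 \<le> (t - s) * M" if "0 \<le> s" "s \<le> t" for s t
  proof -
    have "(LINT \<tau>:{s..t}|lebesgue. (norm (q \<tau>))\<^sup>2) \<le> M"
      unfolding M_def set_lebesgue_integral_def
      using q integrable_imp_set_integrable[OF q, of s t]
      by (intro integral_mono) (auto simp: set_integrable_def indicator_def)
    then have "(t - s) * (LINT \<tau>:{s..t}|lebesgue. (norm (q \<tau>))\<^sup>2) \<le> (t - s) * M"
      using that by (intro mult_left_mono) auto
    then show ?thesis using weak_primitive_increment[OF p that] by linarith
  qed
  have le': "norm (y t - y s) \<le> sqrt (\<bar>t - s\<bar> * M)" if "0 \<le> s" "0 \<le> t" for s t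
  proof (cases "s \<le> t")
    case True then show ?thesis using le[of s t] that by (intro real_le_rsqrt) auto
  next
    case False then show ?thesis using le[of t s] that by (intro real_le_rsqrt) (auto simp: norm_minus_commute)
  qed
  show ?thesis unfolding continuous_on_def
  proof
    fix s :: real assume s: "s \<in> {0..}"
    have "((\<lambda>t. y t - y s) \<longlongrightarrow> 0) (at s within {0..})"
    proof (rule Lim_null_comparison)
      show "\<forall>\<^sub>F t in at s within {0..}. norm (y t - y s) \<le> sqrt (\<bar>t - s\<bar> * M)"
        using le' s by (auto simp: eventually_at_filter)
      have "((\<lambda>t. sqrt (\<bar>t - s\<bar> * M)) \<longlongrightarrow> sqrt (\<bar>s - s\<bar> * M)) (at s within {0..})"
        by (intro tendsto_intros)
      then show "((\<lambda>t. sqrt (\<bar>t - s\<bar> * M)) \<longlongrightarrow> 0) (at s within {0..})" by simp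
    qed
    then show "(y \<longlongrightarrow> y s) (at s within {0..})" by (rule LIM_zero_cancel)
  qed
qed

lemma sq_integrable_continuous:
  fixes y :: "real \<Rightarrow> 'v::{real_inner,second_countable_topology}"
  assumes "continuous_on {a..b} y"
  shows "sq_integrable (\<lambda>\<tau>. indicator {a..b} \<tau> *\<^sub>R y \<tau>)"
proof -
  have m: "(\<lambda>\<tau>. indicator {a..b} \<tau> *\<^sub>R y \<tau>) \<in> borel_measurable lebesgue"
    using borel_measurable_continuous_on_indicator[OF _ assms] by (intro measurable_completion) simp
  have "compact (y ` {a..b})" using assms by (rule compact_continuous_image) simp
  then obtain M where M: "\<And>t. t \<in> {a..b} \<Longrightarrow> norm (y t) \<le> M"
    using compact_imp_bounded bounded_iff by (metis image_eqI)
  show ?thesis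
  proof (rule sq_integrable_bound[where f = "\<lambda>t. indicator {a..b} t *\<^sub>R (1::real)" and C = M])
    show "sq_integrable (\<lambda>t. indicator {a..b} t *\<^sub>R (1::real))"
      by (rule sq_integrable_indicator_const) auto
    show "AE t in lebesgue. norm (indicator {a..b} t *\<^sub>R y t) \<le> M * norm (indicator {a..b} t *\<^sub>R (1::real))"
      using M by (intro AE_I2) (auto simp: indicator_def)
  qed (rule m)
qed

lemma set_integrable_inner_continuous:
  fixes y :: "real \<Rightarrow> 'v::{real_inner,second_countable_topology}"
  assumes "sq_integrable q" "continuous_on {s..t} y"
  shows "set_integrable lebesgue {s..t} (\<lambda>\<tau>. q \<tau> \<bullet> y \<tau>)"
  using sq_integrable_inner[OF assms(1) sq_integrable_continuous[OF assms(2)]]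
  by (simp add: set_integrable_def)

text \<open>The difference K of the product and the integral changes over \<open>[s, t]\<close> by
  at most t - s times the energy of q1 and q2 on that interval, so it is constant.\<close>

lemma weak_primitive_product:
  fixes y1 y2 q1 q2 :: "real \<Rightarrow> 'v::{real_inner,second_countable_topology}"
  assumes p1: "weak_primitive y1 q1" and p2: "weak_primitive y2 q2" and T: "0 \<le> T"
  shows "y1 T \<bullet> y2 T - y1 0 \<bullet> y2 0 = (LINT \<tau>:{0..T}|lebesgue. q1 \<tau> \<bullet> y2 \<tau> + q2 \<tau> \<bullet> y1 \<tau>)"
proof -
  have q: "sq_integrable q1" "sq_integrable q2" using p1 p2 weak_primitiveD(1) by auto
  have n: "integrable lebesgue (\<lambda>\<tau>. (norm (q1 \<tau>))\<^sup>2)" "integrable lebesgue (\<lambda>\<tau>. (norm (q2 \<tau>))\<^sup>2)"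
    using q by (auto simp: sq_integrable_def)
  have c: "continuous_on {s..t} y1" "continuous_on {s..t} y2" if "0 \<le> s" for s t
    using weak_primitive_continuous[OF p1] weak_primitive_continuous[OF p2] that
    by (auto elim!: continuous_on_subset)
  define g where "g \<tau> = q1 \<tau> \<bullet> y2 \<tau> + q2 \<tau> \<bullet> y1 \<tau>" for \<tau>
  have gi: "set_integrable lebesgue {s..t} g" if "0 \<le> s" for s t
    unfolding g_def using q c that by (intro set_integral_add set_integrable_inner_continuous)
  define Q where "Q t = (LINT \<tau>:{0..t}|lebesgue. (norm (q1 \<tau>))\<^sup>2 + (norm (q2 \<tau>))\<^sup>2)" for t
  have Qi: "set_integrable lebesgue {s..t} (\<lambda>\<tau>. (norm (q1 \<tau>))\<^sup>2 + (norm (q2 \<tau>))\<^sup>2)" for s t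
    using n by (intro integrable_imp_set_integrable) auto
  define K where "K t = y1 t \<bullet> y2 t - (LINT \<tau>:{0..t}|lebesgue. g \<tau>)" for t
  have "K T = K 0"
  proof (rule constant_if_superlinear_increments[OF T])
    show "continuous_on {0..T} Q" unfolding Q_def by (intro continuous_indefinite_integral Qi)
    fix s t assume st: "0 \<le> s" "s \<le> t" "t \<le> T"
    show "\<bar>K t - K s\<bar> \<le> (t - s) * (Q t - Q s)"
    proof (cases "s = t")
      case False
      then have "s < t" using st by simp
      define E1 where "E1 = (LINT \<tau>:{s..t}|lebesgue. (norm (q1 \<tau>))\<^sup>2)"
      define E2 where "E2 = (LINT \<tau>:{s..t}|lebesgue. (norm (q2 \<tau>))\<^sup>2)"
      have ni: "set_integrable lebesgue {r..u} (\<lambda>\<tau>. (norm (q1 \<tau>))\<^sup>2)" "set_integrable lebesgue {r..u} (\<lambda>\<tau>. (norm (q2 \<tau>))\<^sup>2)" for r u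
        using n by (auto intro: integrable_imp_set_integrable)
      have QE: "Q t - Q s = E1 + E2"
        using set_integral_combine[OF st(1,2) Qi] ni by (simp add: Q_def E1_def E2_def set_integral_add)
      have sub: "(LINT \<tau>:{r..u}|lebesgue. (norm (q \<tau>))\<^sup>2) \<le> (LINT \<tau>:{s..t}|lebesgue. (norm (q \<tau>))\<^sup>2)"
        if "s \<le> r" "u \<le> t" "\<And>r u. set_integrable lebesgue {r..u} (\<lambda>\<tau>. (norm (q \<tau>))\<^sup>2)" for r u and q :: "real \<Rightarrow> 'v"
        unfolding set_lebesgue_integral_def using that
        by (intro integral_mono) (auto simp: set_integrable_def indicator_def)
      have d2: "(norm (y2 t - y2 \<tau>))\<^sup>2 \<le> (t - s) * E2" if \<tau>: "\<tau> \<in> {s..t}" for \<tau>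
      proof -
        have "(norm (y2 t - y2 \<tau>))\<^sup>2 \<le> (t - \<tau>) * (LINT \<tau>:{\<tau>..t}|lebesgue. (norm (q2 \<tau>))\<^sup>2)"
          using weak_primitive_increment[OF p2, of \<tau> t] \<tau> st by simp
        also have "\<dots> \<le> (t - s) * E2"
          unfolding E2_def using \<tau> ni sub[of \<tau> t q2] by (intro mult_mono) (auto simp: set_lebesgue_integral_def intro!: integral_nonneg)
        finally show ?thesis .
      qed
      have d1: "(norm (y1 s - y1 \<tau>))\<^sup>2 \<le> (t - s) * E1" if \<tau>: "\<tau> \<in> {s..t}" for \<tau>
      proof -
        have "(norm (y1 s - y1 \<tau>))\<^sup>2 \<le> (\<tau> - s) * (LINT \<tau>:{s..\<tau>}|lebesgue. (norm (q1 \<tau>))\<^sup>2)"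
          using weak_primitive_increment[OF p1, of s \<tau>] \<tau> st by (simp add: norm_minus_commute)
        also have "\<dots> \<le> (t - s) * E1"
          unfolding E1_def using \<tau> ni sub[of s \<tau> q1] by (intro mult_mono) (auto simp: set_lebesgue_integral_def intro!: integral_nonneg)
        finally show ?thesis .
      qed
      have i1: "set_integrable lebesgue {s..t} (\<lambda>\<tau>. q1 \<tau> \<bullet> (y2 t - y2 \<tau>))"
        and i2: "set_integrable lebesgue {s..t} (\<lambda>\<tau>. q2 \<tau> \<bullet> (y1 s - y1 \<tau>))"
        using q c st by (auto intro!: set_integrable_inner_continuous continuous_intros)
      \<comment> \<open>Freezing y2 at t but y1 at s splits the difference of products without a
        second-order remainder; after subtracting g only increments inside \<open>[s, t]\<close>
        remain.\<close>
      have "K t - K s = (y1 t - y1 s) \<bullet> y2 t + (y2 t - y2 s) \<bullet> y1 s - (LINT \<tau>:{s..t}|lebesgue. g \<tau>)"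
        using set_integral_combine[OF st(1,2) gi]
      by (simp add: K_def inner_diff_left inner_diff_right inner_commute[of "y2 t"] inner_commute[of "y2 s"])
      also have "\<dots> = (LINT \<tau>:{s..t}|lebesgue. q1 \<tau> \<bullet> y2 t) + (LINT \<tau>:{s..t}|lebesgue. q2 \<tau> \<bullet> y1 s) - (LINT \<tau>:{s..t}|lebesgue. g \<tau>)"
        using weak_primitiveD(2)[OF p1 st(1,2)] weak_primitiveD(2)[OF p2 st(1,2)] by simp
      also have "\<dots> = (LINT \<tau>:{s..t}|lebesgue. (q1 \<tau> \<bullet> y2 t + q2 \<tau> \<bullet> y1 s) - g \<tau>)"
        using q gi st by (simp add: set_integral_add set_integral_diff set_integrable_inner)
      also have "\<dots> = (LINT \<tau>:{s..t}|lebesgue. q1 \<tau> \<bullet> (y2 t - y2 \<tau>) + q2 \<tau> \<bullet> (y1 s - y1 \<tau>))"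
        by (simp add: g_def inner_diff_right algebra_simps)
      also have "\<dots> = (LINT \<tau>:{s..t}|lebesgue. q1 \<tau> \<bullet> (y2 t - y2 \<tau>)) + (LINT \<tau>:{s..t}|lebesgue. q2 \<tau> \<bullet> (y1 s - y1 \<tau>))"
        using i1 i2 by (rule set_integral_add)
      finally have "\<bar>K t - K s\<bar> \<le> ((t - s) * E1 + (t - s) * E2) / 2 + ((t - s) * E2 + (t - s) * E1) / 2"
        using set_integral_inner_le[OF \<open>s < t\<close> q(1) i1 d2] set_integral_inner_le[OF \<open>s < t\<close> q(2) i2 d1]
        unfolding E1_def E2_def by linarith
      also have "\<dots> = (t - s) * (Q t - Q s)" unfolding QE by (simp add: algebra_simps)
      finally show ?thesis .
    qed simp
  qed
  moreover have "(LINT \<tau>:{0..0}|lebesgue. g \<tau>) = 0"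
    using set_lebesgue_integral_eq_integral(2)[OF gi[of 0 0]] by simp
  ultimately show ?thesis by (simp add: K_def flip: g_def)
qed

text \<open>For each t separately, the value is the Riesz representative of integration of q over
  \<open>[0, t]\<close> against a vector.\<close>

lemma weak_primitive_exists:
  fixes q :: "real \<Rightarrow> 'v::{real_inner,complete_space,second_countable_topology}"
  assumes q: "sq_integrable q"
  shows "\<exists>y. weak_primitive y q"
proof -
  have "\<exists>z. \<forall>\<eta>. z \<bullet> \<eta> = (LINT \<tau>:{0..t}|lebesgue. q \<tau> \<bullet> \<eta>)" for t
  proof -
    have "bounded_linear (\<lambda>\<eta>. LINT \<tau>:{0..t}|lebesgue. q \<tau> \<bullet> \<eta>)"
    proof (rule bounded_linear_intro)
      note qi = set_integrable_inner[OF q]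
      show "(LINT \<tau>:{0..t}|lebesgue. q \<tau> \<bullet> (x + y)) = (LINT \<tau>:{0..t}|lebesgue. q \<tau> \<bullet> x) + (LINT \<tau>:{0..t}|lebesgue. q \<tau> \<bullet> y)" for x y
        by (simp add: inner_add_right set_integral_add qi)
      show "(LINT \<tau>:{0..t}|lebesgue. q \<tau> \<bullet> (r *\<^sub>R x)) = r *\<^sub>R (LINT \<tau>:{0..t}|lebesgue. q \<tau> \<bullet> x)" for r x
        by simp
      have "sq_integrable (\<lambda>\<tau>. norm (q \<tau>))"
        using q by (intro sq_integrable_bound[OF q, where C = 1]) (auto simp: sq_integrable_def)
      from set_integrable_inner[OF this, of 0 t 1]
      have ni: "set_integrable lebesgue {0..t} (\<lambda>\<tau>. norm (q \<tau>))" by simp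
      show "norm (LINT \<tau>:{0..t}|lebesgue. q \<tau> \<bullet> x) \<le> norm x * (LINT \<tau>:{0..t}|lebesgue. norm (q \<tau>))" for x
      proof -
        have "norm (LINT \<tau>:{0..t}|lebesgue. q \<tau> \<bullet> x) \<le> (LINT \<tau>:{0..t}|lebesgue. norm (q \<tau> \<bullet> x))"
          by (rule set_integral_norm_bound[OF qi])
        also have "\<dots> \<le> (LINT \<tau>:{0..t}|lebesgue. norm x * norm (q \<tau>))"
        proof (rule set_integral_mono)
          show "set_integrable lebesgue {0..t} (\<lambda>\<tau>. norm (q \<tau> \<bullet> x))" using qi by (rule set_integrable_norm)
          show "set_integrable lebesgue {0..t} (\<lambda>\<tau>. norm x * norm (q \<tau>))" using ni by simp
          show "norm (q \<tau> \<bullet> x) \<le> norm x * norm (q \<tau>)" for \<tau>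
            using Cauchy_Schwarz_ineq2[of "q \<tau>" x] by (simp add: mult.commute)
        qed
        finally show ?thesis by simp
      qed
    qed
    then show ?thesis using riesz_representation by metis
  qed
  then obtain y where y: "\<And>t \<eta>. y t \<bullet> \<eta> = (LINT \<tau>:{0..t}|lebesgue. q \<tau> \<bullet> \<eta>)" by metis
  have "weak_primitive y q" unfolding weak_primitive_def
  proof (intro conjI q allI impI)
    fix s t \<eta> assume st: "(0::real) \<le> s" "s \<le> t"
    show "(y t - y s) \<bullet> \<eta> = (LINT \<tau>:{s..t}|lebesgue. q \<tau> \<bullet> \<eta>)"
      using set_integral_combine[OF st set_integrable_inner[OF q]] by (simp add: inner_diff_left y)
  qed
  then show ?thesis by blast
qed

lemma weak_primitive_add_const: "weak_primitive y q \<Longrightarrow> weak_primitive (\<lambda>t. y t + c) q"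
  by (simp add: weak_primitive_def)

lemma sq_integrable_bounded_linear:
  fixes q :: "real \<Rightarrow> 'v::{real_inner,second_countable_topology}"
    and P :: "'v \<Rightarrow> 'w::{real_inner,second_countable_topology}"
  assumes P: "bounded_linear P" and q: "sq_integrable q"
  shows "sq_integrable (\<lambda>t. P (q t))"
proof -
  obtain K where K: "\<And>x. norm (P x) \<le> norm x * K" using bounded_linear.bounded[OF P] by blast
  have "P \<in> borel_measurable borel"
    using P by (intro borel_measurable_continuous_onI linear_continuous_on)
  then have "(\<lambda>t. P (q t)) \<in> borel_measurable lebesgue"
    using q measurable_compose[of q lebesgue borel P borel] by (simp add: sq_integrable_def)
  then show ?thesis using q K by (intro sq_integrable_bound[OF q, where C = K]) (auto simp: mult.commute)
qed

text \<open>Symmetry moves P onto the test vector, where the defining identity applies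
  unchanged.\<close>

lemma weak_primitive_bounded_linear:
  fixes P :: "'v::{real_inner,second_countable_topology} \<Rightarrow> 'v"
  assumes p: "weak_primitive y q" and P: "bounded_linear P" and sym: "\<And>x z. P x \<bullet> z = x \<bullet> P z"
  shows "weak_primitive (\<lambda>t. P (y t)) (\<lambda>t. P (q t))"
  unfolding weak_primitive_def
proof (intro conjI allI impI)
  show "sq_integrable (\<lambda>t. P (q t))" using P weak_primitiveD(1)[OF p] by (rule sq_integrable_bounded_linear)
  fix s t \<eta> assume "(0::real) \<le> s" "s \<le> t"
  then have "(y t - y s) \<bullet> P \<eta> = (LINT \<tau>:{s..t}|lebesgue. q \<tau> \<bullet> P \<eta>)"
    by (rule weak_primitiveD(2)[OF p])
  then show "(P (y t) - P (y s)) \<bullet> \<eta> = (LINT \<tau>:{s..t}|lebesgue. P (q \<tau>) \<bullet> \<eta>)"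
    by (simp add: sym linear_diff[OF bounded_linear.linear[OF P], symmetric])
qed

lemma weak_primitive_test_function:
  fixes \<eta> :: "'v::{real_inner,second_countable_topology}"
  assumes \<phi>: "test_function T \<phi>"
  shows "weak_primitive (\<lambda>t. \<phi> t *\<^sub>R \<eta>) (\<lambda>t. deriv \<phi> t *\<^sub>R \<eta>)"
  unfolding weak_primitive_def
proof (intro conjI allI impI)
  show "sq_integrable (\<lambda>t. deriv \<phi> t *\<^sub>R \<eta>)" by (rule sq_integrable_test[OF test_function_deriv[OF \<phi>]])
  fix s t and \<zeta> :: 'v assume st: "(0::real) \<le> s" "s \<le> t"
  have "(deriv \<phi> has_integral (\<phi> t - \<phi> s)) {s..t}"
    using st(2) test_function_has_derivative[OF \<phi>]
    by (intro fundamental_theorem_of_calculus)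
      (auto simp: has_real_derivative_iff_has_vector_derivative[symmetric] intro: has_field_derivative_at_within)
  moreover have "set_integrable lebesgue {s..t} (deriv \<phi>)"
    by (intro integrable_imp_set_integrable test_function_integral(1)[OF test_function_deriv[OF \<phi>]])
  ultimately have "(LINT \<tau>:{s..t}|lebesgue. deriv \<phi> \<tau>) = \<phi> t - \<phi> s"
    by (simp add: set_lebesgue_integral_eq_integral(2) integral_unique)
  then show "(\<phi> t *\<^sub>R \<eta> - \<phi> s *\<^sub>R \<eta>) \<bullet> \<zeta> = (LINT \<tau>:{s..t}|lebesgue. deriv \<phi> \<tau> *\<^sub>R \<eta> \<bullet> \<zeta>)"
    by (simp add: inner_diff_left left_diff_distrib)
qed

text \<open>The product rule for y and \<phi> times \<eta>, whose boundary values vanish.\<close>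

lemma weak_primitive_integration_by_parts:
  fixes y :: "real \<Rightarrow> 'v::{real_inner,second_countable_topology}"
  assumes T: "0 \<le> T" and p: "weak_primitive y q" and \<phi>: "test_function T \<phi>"
  shows "(LINT t|lebesgue. deriv \<phi> t * (y t \<bullet> \<eta>)) = - (LINT t|lebesgue. \<phi> t * (q t \<bullet> \<eta>))"
proof -
  have c: "continuous_on {0..T} y" using weak_primitive_continuous[OF p] by (rule continuous_on_subset) auto
  have q: "sq_integrable q" using p by (rule weak_primitiveD)
  define Y where "Y t = indicator {0..T} t *\<^sub>R y t" for t
  have Y: "sq_integrable Y" unfolding Y_def[abs_def] by (rule sq_integrable_continuous[OF c])
  have eq: "deriv \<phi> t * (Y t \<bullet> \<eta>) = deriv \<phi> t * (y t \<bullet> \<eta>)" for t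
    using test_function_zero[OF test_function_deriv[OF \<phi>], of t]
    by (cases "t \<in> {0<..<T}") (auto simp: Y_def)
  have i1: "integrable lebesgue (\<lambda>t. deriv \<phi> t * (y t \<bullet> \<eta>))"
    using integrable_test_inner[OF Y test_function_deriv[OF \<phi>], of \<eta>] by (simp add: eq)
  have i2: "integrable lebesgue (\<lambda>t. \<phi> t * (q t \<bullet> \<eta>))" by (rule integrable_test_inner[OF q \<phi>])
  have "0 = (LINT \<tau>:{0..T}|lebesgue. deriv \<phi> \<tau> *\<^sub>R \<eta> \<bullet> y \<tau> + q \<tau> \<bullet> (\<phi> \<tau> *\<^sub>R \<eta>))"
    using weak_primitive_product[OF weak_primitive_test_function[OF \<phi>, of \<eta>] p T]
      test_function_zero[OF \<phi>, of 0] test_function_zero[OF \<phi>, of T] by simp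
  also have "\<dots> = (LINT t|lebesgue. deriv \<phi> t * (y t \<bullet> \<eta>) + \<phi> t * (q t \<bullet> \<eta>))"
    unfolding set_lebesgue_integral_def
  proof (rule Bochner_Integration.integral_cong[OF refl])
    show "indicator {0..T} t *\<^sub>R (deriv \<phi> t *\<^sub>R \<eta> \<bullet> y t + q t \<bullet> (\<phi> t *\<^sub>R \<eta>)) =
      deriv \<phi> t * (y t \<bullet> \<eta>) + \<phi> t * (q t \<bullet> \<eta>)" for t
      using test_function_zero[OF test_function_deriv[OF \<phi>], of t] test_function_zero[OF \<phi>, of t]
      by (cases "t \<in> {0<..<T}") (auto simp: inner_commute)
  qed
  finally show ?thesis using i1 i2 by simp
qed

section \<open>The continuous representative\<close>

locale gelfand_triple =
  fixes j :: "'v::{real_inner,complete_space,second_countable_topology} \<Rightarrow>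
              'h::{real_inner,complete_space,second_countable_topology}"
  assumes j: "dense_embedding j"
begin

lemma j_bounded_linear: "bounded_linear j"
  using j by (simp add: dense_embedding_def)

sublocale J: bounded_linear j by (rule j_bounded_linear)

lemma j_eq_0: "j x = 0 \<Longrightarrow> x = 0"
  using j J.zero by (metis dense_embedding_def injD)

definition K where "K = onorm j"

lemma K_nonneg: "0 \<le> K" unfolding K_def by (rule onorm_pos_le[OF j_bounded_linear])

lemma norm_j_le: "norm (j x) \<le> K * norm x"
  unfolding K_def by (rule onorm[OF j_bounded_linear])

text \<open>The operator \<open>j\<^sup>*j\<close>, through which \<open>V \<hookrightarrow> V'\<close> becomes an operator on \<open>V\<close>.\<close>

definition G :: "'v \<Rightarrow> 'v" where "G x = (SOME z. \<forall>\<eta>. z \<bullet> \<eta> = j x \<bullet> j \<eta>)"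

lemma G_inner: "G x \<bullet> \<eta> = j x \<bullet> j \<eta>"
proof -
  have "bounded_linear (\<lambda>\<eta>. j x \<bullet> j \<eta>)"
    by (rule bounded_linear_compose[OF bounded_linear_inner_right j_bounded_linear])
  then have "\<exists>z. \<forall>\<eta>. z \<bullet> \<eta> = j x \<bullet> j \<eta>" using riesz_representation by metis
  from someI_ex[OF this] show ?thesis unfolding G_def by blast
qed

lemma G_sym: "G x \<bullet> y = x \<bullet> G y"
  by (metis G_inner inner_commute)

lemma G_nonneg: "G x \<bullet> x = (norm (j x))\<^sup>2"
  by (simp add: G_inner power2_norm_eq_inner)

lemma G_bounded_linear: "bounded_linear G"
proof (rule bounded_linear_intro)
  show "G (x + y) = G x + G y" for x y
    by (rule vector_eq_rdot[THEN iffD1]) (auto simp: G_inner inner_add_left J.add)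
  show "G (r *\<^sub>R x) = r *\<^sub>R G x" for r x
    by (rule vector_eq_rdot[THEN iffD1]) (auto simp: G_inner J.scaleR)
  show "norm (G x) \<le> norm x * K\<^sup>2" for x
  proof -
    have "(norm (G x))\<^sup>2 = j x \<bullet> j (G x)" by (simp add: power2_norm_eq_inner G_inner)
    also have "\<dots> \<le> norm (j x) * norm (j (G x))" by (rule norm_cauchy_schwarz)
    also have "\<dots> \<le> (K * norm x) * (K * norm (G x))"
      using norm_j_le K_nonneg by (intro mult_mono) auto
    finally have "norm (G x) * norm (G x) \<le> (norm x * K\<^sup>2) * norm (G x)"
      by (simp add: power2_eq_square mult_ac)
    then show ?thesis
      by (cases "norm (G x) = 0") (auto simp: mult_le_cancel_right)
  qed
qed

sublocale G: bounded_linear G by (rule G_bounded_linear)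

text \<open>A vector orthogonal to the range of the symmetric G lies in its kernel, which is the
  kernel of the injective j.\<close>

lemma closure_range_G: "closure (range G) = UNIV"
proof -
  let ?S = "closure (range G)"
  have sub: "subspace ?S"
    unfolding subspace_def
  proof (intro conjI ballI allI)
    have r: "subspace (range G)" by (rule linear_subspace_image[OF G.linear subspace_UNIV])
    then show "0 \<in> ?S" using closure_subset[of "range G"] by (auto dest: subspace_0)
    show "x + y \<in> ?S" if xy: "x \<in> ?S" "y \<in> ?S" for x y
    proof -
      obtain X Y where X: "\<And>n. X n \<in> range G" "X \<longlonglongrightarrow> x" and Y: "\<And>n. Y n \<in> range G" "Y \<longlonglongrightarrow> y"
        using xy unfolding closure_sequential by blast
      then show ?thesis unfolding closure_sequential
        by (intro exI[of _ "\<lambda>n. X n + Y n"]) (simp add: subspace_add[OF r] tendsto_add)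
    qed
    show "c *\<^sub>R x \<in> ?S" if x: "x \<in> ?S" for c x
    proof -
      obtain X where X: "\<And>n. X n \<in> range G" "X \<longlonglongrightarrow> x" using x unfolding closure_sequential by blast
      then show ?thesis unfolding closure_sequential
        by (intro exI[of _ "\<lambda>n. c *\<^sub>R X n"]) (simp add: subspace_scale[OF r] tendsto_scaleR)
    qed
  qed
  have "x \<in> ?S" for x
  proof -
    have "\<exists>!z. z \<in> ?S \<and> (\<forall>w\<in>?S. z \<bullet> w = x \<bullet> w)"
    proof (rule riesz_form[where c = 1 and C = 1 and M = "norm x"])
      show "psd_form ?S (\<bullet>)"
        by unfold_locales (auto simp: sub bilinear_on_def inner_add_left inner_add_right inner_commute)
      show "complete ?S" by (rule complete_closed_subset[OF closed_closure subset_UNIV complete_UNIV])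
    qed (auto simp: power2_norm_eq_inner inner_add_right Cauchy_Schwarz_ineq2)
    then obtain z where z: "z \<in> ?S" "\<And>w. w \<in> ?S \<Longrightarrow> z \<bullet> w = x \<bullet> w" by blast
    have "z \<bullet> G (x - z) = x \<bullet> G (x - z)" by (intro z(2) closure_subset[THEN subsetD] rangeI)
    then have "G (x - z) \<bullet> (x - z) = 0"
      by (simp add: G_sym inner_diff_left)
    then have "j (x - z) = 0" by (simp add: G_nonneg)
    then show ?thesis using j_eq_0[of "x - z"] z(1) by simp
  qed
  then show ?thesis by blast
qed

section \<open>Resolvents of G and their strong convergence\<close>

definition resolvent :: "real \<Rightarrow> 'v \<Rightarrow> 'v" where
  "resolvent \<epsilon> x = (SOME y. \<epsilon> *\<^sub>R y + G y = x)"

lemma resolvent_unique: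
  assumes "0 < \<epsilon>" "\<epsilon> *\<^sub>R y + G y = \<epsilon> *\<^sub>R z + G z" shows "y = z"
proof -
  have "\<epsilon> *\<^sub>R (y - z) + G (y - z) = 0" using assms(2) by (simp add: scaleR_diff_right G.diff algebra_simps)
  then have "(\<epsilon> *\<^sub>R (y - z) + G (y - z)) \<bullet> (y - z) = 0" by simp
  then have "\<epsilon> * (norm (y - z))\<^sup>2 + (norm (j (y - z)))\<^sup>2 = 0"
    by (simp add: inner_add_left G_nonneg power2_norm_eq_inner)
  moreover have "0 \<le> \<epsilon> * (norm (y - z))\<^sup>2" using assms(1) by simp
  ultimately have "\<epsilon> * (norm (y - z))\<^sup>2 = 0"
    using zero_le_power2[of "norm (j (y - z))"] by linarith
  then show ?thesis using assms(1) by simp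
qed

text \<open>The form \<open>\<epsilon> * (z \<bullet> w) + j z \<bullet> j w\<close> is coercive
  with constant \<epsilon>, and the representative of x in it solves the equation.\<close>

lemma resolvent_eq:
  assumes \<epsilon>: "0 < \<epsilon>" shows "\<epsilon> *\<^sub>R resolvent \<epsilon> x + G (resolvent \<epsilon> x) = x"
proof -
  have "\<exists>!z. z \<in> UNIV \<and> (\<forall>w\<in>UNIV. \<epsilon> * (z \<bullet> w) + j z \<bullet> j w = x \<bullet> w)"
  proof (rule riesz_form[where c = \<epsilon> and C = "\<epsilon> + K\<^sup>2" and M = "norm x"])
    show "psd_form UNIV (\<lambda>z w. \<epsilon> * (z \<bullet> w) + j z \<bullet> j w)"
      using \<epsilon> by unfold_locales
        (auto simp: bilinear_on_def inner_add_left inner_add_right inner_commute J.add J.scaleR distrib_left mult_ac)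
    show "\<epsilon> * (norm z)\<^sup>2 \<le> \<epsilon> * (z \<bullet> z) + j z \<bullet> j z" for z by (simp add: power2_norm_eq_inner)
    show "\<epsilon> * (z \<bullet> z) + j z \<bullet> j z \<le> (\<epsilon> + K\<^sup>2) * (norm z)\<^sup>2" for z
      using power_mono[OF norm_j_le[of z] norm_ge_zero, of 2]
      by (simp add: power2_norm_eq_inner[symmetric] distrib_right power_mult_distrib)
  qed (use \<epsilon> in \<open>auto simp: inner_add_right Cauchy_Schwarz_ineq2 complete_UNIV\<close>)
  then obtain z where z: "\<And>w. \<epsilon> * (z \<bullet> w) + j z \<bullet> j w = x \<bullet> w" by blast
  have "\<epsilon> *\<^sub>R z + G z = x"
    by (rule vector_eq_rdot[THEN iffD1]) (auto simp: inner_add_left G_inner z)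
  then show ?thesis unfolding resolvent_def by (rule someI[of "\<lambda>y. \<epsilon> *\<^sub>R y + G y = x"])
qed

lemma resolvent_eqI: "0 < \<epsilon> \<Longrightarrow> \<epsilon> *\<^sub>R y + G y = x \<Longrightarrow> resolvent \<epsilon> x = y"
  by (rule resolvent_unique) (auto simp: resolvent_eq)

text \<open>In the square of \<epsilon> y + G y the mixed term is a nonnegative multiple of
  \<open>(norm (j y))^2\<close>, so each summand alone is bounded by x.\<close>

lemma resolvent_norms:
  assumes "0 < \<epsilon>"
  shows "\<epsilon> * norm (resolvent \<epsilon> x) \<le> norm x" "norm (G (resolvent \<epsilon> x)) \<le> norm x"
proof -
  let ?y = "resolvent \<epsilon> x"
  have "(norm x)\<^sup>2 = (norm (\<epsilon> *\<^sub>R ?y + G ?y))\<^sup>2" using resolvent_eq[OF assms] by simp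
  also have "\<dots> = (\<epsilon> * norm ?y)\<^sup>2 + 2 * \<epsilon> * (norm (j ?y))\<^sup>2 + (norm (G ?y))\<^sup>2"
    using G_nonneg[of ?y]
    by (simp add: power2_norm_eq_inner inner_add_left inner_add_right inner_commute power_mult_distrib)
      (simp add: power2_eq_square power2_norm_eq_inner[symmetric])
  finally have eq: "(norm x)\<^sup>2 = (\<epsilon> * norm ?y)\<^sup>2 + 2 * \<epsilon> * (norm (j ?y))\<^sup>2 + (norm (G ?y))\<^sup>2" .
  have "0 \<le> 2 * \<epsilon> * (norm (j ?y))\<^sup>2" using assms by simp
  then have "(\<epsilon> * norm ?y)\<^sup>2 \<le> (norm x)\<^sup>2" "(norm (G ?y))\<^sup>2 \<le> (norm x)\<^sup>2"
    unfolding eq by (auto simp: add_increasing2)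
  then show "\<epsilon> * norm ?y \<le> norm x" "norm (G ?y) \<le> norm x"
    by (auto intro: power2_le_imp_le)
qed

lemma resolvent_bounded_linear:
  assumes "0 < \<epsilon>" shows "bounded_linear (resolvent \<epsilon>)"
proof (rule bounded_linear_intro)
  note e = resolvent_eq[OF assms]
  show "resolvent \<epsilon> (x + y) = resolvent \<epsilon> x + resolvent \<epsilon> y" for x y
    using e[of x] e[of y] by (intro resolvent_eqI assms) (simp add: scaleR_add_right G.add algebra_simps)
  show "resolvent \<epsilon> (r *\<^sub>R x) = r *\<^sub>R resolvent \<epsilon> x" for r x
    using arg_cong[OF e[of x], of "scaleR r"]
    by (intro resolvent_eqI assms) (simp add: scaleR_add_right G.scaleR mult.commute)
  show "norm (resolvent \<epsilon> x) \<le> norm x * (1 / \<epsilon>)" for x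
    using resolvent_norms(1)[OF assms, of x] assms by (simp add: field_simps)
qed

lemma resolvent_sym:
  assumes "0 < \<epsilon>" shows "resolvent \<epsilon> x \<bullet> y = x \<bullet> resolvent \<epsilon> y"
proof -
  let ?R = "resolvent \<epsilon>"
  have "?R x \<bullet> y = ?R x \<bullet> (\<epsilon> *\<^sub>R ?R y + G (?R y))" by (simp add: resolvent_eq[OF assms])
  also have "\<dots> = (\<epsilon> *\<^sub>R ?R x + G (?R x)) \<bullet> ?R y" by (simp add: inner_add_left inner_add_right G_sym)
  finally show ?thesis by (simp add: resolvent_eq[OF assms])
qed

lemma resolvent_commute:
  assumes "0 < \<epsilon>" shows "resolvent \<epsilon> (G x) = G (resolvent \<epsilon> x)"
  using arg_cong[OF resolvent_eq[OF assms, of x], of G]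
  by (intro resolvent_eqI assms) (simp add: G.add G.scaleR)

definition Rs :: "nat \<Rightarrow> 'v \<Rightarrow> 'v" where "Rs n = resolvent (1 / real (Suc n))"

lemma Rs_bounded_linear: "bounded_linear (Rs n)" unfolding Rs_def by (rule resolvent_bounded_linear) simp
lemma Rs_sym: "Rs n x \<bullet> y = x \<bullet> Rs n y" unfolding Rs_def by (rule resolvent_sym) simp
lemma Rs_commute: "Rs n (G x) = G (Rs n x)" unfolding Rs_def by (rule resolvent_commute) simp
lemma norm_Rs_G: "norm (Rs n (G x)) \<le> norm x"
  unfolding Rs_commute unfolding Rs_def by (rule resolvent_norms) simp

lemma Rs_G_diff: "x - Rs n (G x) = (1 / real (Suc n)) *\<^sub>R Rs n x"
  using resolvent_eq[of "1 / real (Suc n)" x] unfolding Rs_commute by (simp add: Rs_def algebra_simps)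

text \<open>The error is -1/(n+1) times \<open>Rs n x\<close>. For x = G v it is at most |v|/(n+1),
  and for general x at most |x| uniformly in n, so density of the range of G suffices.\<close>

lemma Rs_G_tendsto: "(\<lambda>n. Rs n (G x)) \<longlonglongrightarrow> x"
proof (rule LIMSEQ_I)
  fix e :: real assume e: "0 < e"
  have "x \<in> closure (range G)" by (simp add: closure_range_G)
  then obtain v where v: "norm (G v - x) < e / 2"
    using e unfolding closure_approachable dist_norm by (metis half_gt_zero rangeE)
  obtain N where N: "2 * norm v / e < real N" using reals_Archimedean2 by blast
  have "norm (Rs n (G x) - x) < e" if n: "n \<ge> N" for n
  proof -
    interpret R: bounded_linear "Rs n" by (rule Rs_bounded_linear)
    let ?h = "1 / real (Suc n)"
    have "Rs n (G x) - x = - (?h *\<^sub>R Rs n (G v)) - ?h *\<^sub>R Rs n (x - G v)"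
      using Rs_G_diff[of x n] by (simp add: R.diff scaleR_diff_right algebra_simps)
    then have "norm (Rs n (G x) - x) \<le> ?h * norm (Rs n (G v)) + ?h * norm (Rs n (x - G v))"
      using norm_triangle_ineq4[of "- (?h *\<^sub>R Rs n (G v))" "?h *\<^sub>R Rs n (x - G v)"] by simp
    moreover have "?h * norm (Rs n (G v)) \<le> ?h * norm v" by (intro mult_left_mono norm_Rs_G) simp
    moreover have "?h * norm (Rs n (x - G v)) \<le> norm (x - G v)"
      unfolding Rs_def by (rule resolvent_norms) simp
    moreover have "?h * norm v < e * (1/2)"
    proof -
      have "2 * norm v / e < real (Suc n)" using N n by linarith
      then show ?thesis using e by (simp add: field_simps)
    qed
    ultimately show ?thesis using v norm_minus_commute[of x "G v"] by linarith
  qed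
  then show "\<exists>N. \<forall>n\<ge>N. norm (Rs n (G x) - x) < e" by blast
qed

end

lemma norm_diff_square_le:
  fixes x y :: "'a::real_inner"
  shows "(norm (x - y))\<^sup>2 \<le> 2 * (norm x)\<^sup>2 + 2 * (norm y)\<^sup>2"
proof -
  have "(norm (x - y))\<^sup>2 + (norm (x + y))\<^sup>2 = 2 * (norm x)\<^sup>2 + 2 * (norm y)\<^sup>2"
    by (simp add: power2_norm_eq_inner inner_add_left inner_add_right inner_diff_left inner_diff_right)
  then show ?thesis using zero_le_power2[of "norm (x + y)"] by linarith
qed

section \<open>Energy estimates for regularised functions\<close>

context gelfand_triple begin

text \<open>The squared norm of j x is \<open>x \<bullet> G x\<close>, so the product rule applies
  to the weak primitives P m and G P m; symmetry and commutation make its two integrands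
  equal.\<close>

lemma energy_increment:
  assumes w: "sq_integrable w" and p: "weak_primitive m d"
    and m: "AE t in lebesgue. t \<in> {0<..<T} \<longrightarrow> m t = G (w t)"
    and P: "bounded_linear P" and sym: "\<And>x y. P x \<bullet> y = x \<bullet> P y" and comm: "\<And>x. P (G x) = G (P x)"
    and st: "0 \<le> s" "s \<le> t" "t \<le> T"
  shows "(norm (j (P (m t))))\<^sup>2 - (norm (j (P (m s))))\<^sup>2 =
    2 * (LINT \<tau>:{s..t}|lebesgue. P (G (d \<tau>)) \<bullet> P (G (w \<tau>)))"
proof -
  define f where "f \<tau> = P (G (d \<tau>)) \<bullet> P (G (w \<tau>))" for \<tau>
  have d: "sq_integrable d" using p by (rule weak_primitiveD)
  have PG: "bounded_linear (\<lambda>x. P (G x))" by (rule bounded_linear_compose[OF P G_bounded_linear])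
  have fi: "integrable lebesgue f" unfolding f_def[abs_def]
    by (intro sq_integrable_inner sq_integrable_bounded_linear[OF PG] d w)
  have p1: "weak_primitive (\<lambda>t. P (m t)) (\<lambda>t. P (d t))"
    by (rule weak_primitive_bounded_linear[OF p P sym])
  have p2: "weak_primitive (\<lambda>t. G (P (m t))) (\<lambda>t. G (P (d t)))"
    by (rule weak_primitive_bounded_linear[OF p1 G_bounded_linear G_sym])
  have from0: "(norm (j (P (m t))))\<^sup>2 - (norm (j (P (m 0))))\<^sup>2 = 2 * (LINT \<tau>:{0..t}|lebesgue. f \<tau>)"
    if t: "0 \<le> t" "t \<le> T" for t
  proof -
    have c: "continuous_on {0..t} (\<lambda>t. P (m t))"
      using weak_primitive_continuous[OF p1] by (rule continuous_on_subset) auto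
    have int: "set_integrable lebesgue {0..t} (\<lambda>\<tau>. P (G (d \<tau>)) \<bullet> P (m \<tau>))"
      by (rule set_integrable_inner_continuous[OF sq_integrable_bounded_linear[OF PG d] c])
    have "(norm (j (P (m t))))\<^sup>2 - (norm (j (P (m 0))))\<^sup>2 = P (m t) \<bullet> G (P (m t)) - P (m 0) \<bullet> G (P (m 0))"
      by (simp add: G_nonneg[symmetric] inner_commute)
    also have "\<dots> = (LINT \<tau>:{0..t}|lebesgue. P (d \<tau>) \<bullet> G (P (m \<tau>)) + G (P (d \<tau>)) \<bullet> P (m \<tau>))"
      by (rule weak_primitive_product[OF p1 p2 t(1)])
    also have "\<dots> = (LINT \<tau>:{0..t}|lebesgue. 2 * (P (G (d \<tau>)) \<bullet> P (m \<tau>)))"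
      by (simp add: comm G_sym)
    also have "\<dots> = 2 * (LINT \<tau>:{0..t}|lebesgue. P (G (d \<tau>)) \<bullet> P (m \<tau>))" by simp
    also have "(LINT \<tau>:{0..t}|lebesgue. P (G (d \<tau>)) \<bullet> P (m \<tau>)) = (LINT \<tau>:{0..t}|lebesgue. f \<tau>)"
      unfolding set_lebesgue_integral_def
    proof (rule integral_cong_AE)
      show "(\<lambda>\<tau>. indicator {0..t} \<tau> *\<^sub>R (P (G (d \<tau>)) \<bullet> P (m \<tau>))) \<in> borel_measurable lebesgue"
        using int by (auto simp: set_integrable_def)
      show "(\<lambda>\<tau>. indicator {0..t} \<tau> *\<^sub>R f \<tau>) \<in> borel_measurable lebesgue"
        using integrable_imp_set_integrable[OF fi] by (auto simp: set_integrable_def)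
      \<comment> \<open>m is known to equal G w in the open interval only; the closed one adds two
        null points.\<close>
      have "AE \<tau> in lebesgue. \<tau> \<noteq> 0" "AE \<tau> in lebesgue. \<tau> \<noteq> T"
        by (auto intro!: AE_completion AE_lborel_singleton)
      with m show "AE \<tau> in lebesgue. indicator {0..t} \<tau> *\<^sub>R (P (G (d \<tau>)) \<bullet> P (m \<tau>)) = indicator {0..t} \<tau> *\<^sub>R f \<tau>"
        by eventually_elim (use t in \<open>auto simp: f_def indicator_def\<close>)
    qed
    finally show ?thesis .
  qed
  have "(LINT \<tau>:{0..t}|lebesgue. f \<tau>) = (LINT \<tau>:{0..s}|lebesgue. f \<tau>) + (LINT \<tau>:{s..t}|lebesgue. f \<tau>)"
    by (rule set_integral_combine[OF st(1,2) integrable_imp_set_integrable[OF fi]])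
  then show ?thesis using from0[of s] from0[of t] st by (simp add: f_def)
qed

text \<open>The value at t exceeds the value at any s by at most the energy integral, which gives
  the summand 1. Averaging over s and using that j has norm K gives the summand
  \<open>K^2 / T\<close>.\<close>

lemma energy_sup_bound:
  assumes T: "0 < T" and w: "sq_integrable w" and p: "weak_primitive m d"
    and m: "AE t in lebesgue. t \<in> {0<..<T} \<longrightarrow> m t = G (w t)"
    and P: "bounded_linear P" and sym: "\<And>x y. P x \<bullet> y = x \<bullet> P y" and comm: "\<And>x. P (G x) = G (P x)"
    and t: "t \<in> {0..T}"
  shows "(norm (j (P (m t))))\<^sup>2 \<le> (K\<^sup>2 / T + 1) *
    (LINT \<tau>|lebesgue. (norm (P (G (d \<tau>))))\<^sup>2 + (norm (P (G (w \<tau>))))\<^sup>2)"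
proof -
  have d: "sq_integrable d" using p by (rule weak_primitiveD)
  have PG: "bounded_linear (\<lambda>x. P (G x))" by (rule bounded_linear_compose[OF P G_bounded_linear])
  have sq: "sq_integrable (\<lambda>\<tau>. P (G (d \<tau>)))" "sq_integrable (\<lambda>\<tau>. P (G (w \<tau>)))"
    by (auto intro: sq_integrable_bounded_linear[OF PG] d w)
  define n where "n \<tau> = (norm (P (G (d \<tau>))))\<^sup>2 + (norm (P (G (w \<tau>))))\<^sup>2" for \<tau>
  define N where "N = (LINT \<tau>|lebesgue. n \<tau>)"
  have ni: "integrable lebesgue n" unfolding n_def[abs_def] using sq by (simp add: sq_integrable_def)
  have nn: "0 \<le> n \<tau>" for \<tau> by (simp add: n_def)
  define F where "F t = (norm (j (P (m t))))\<^sup>2" for t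
  define f where "f \<tau> = P (G (d \<tau>)) \<bullet> P (G (w \<tau>))" for \<tau>
  have fi: "integrable lebesgue f" unfolding f_def[abs_def] by (rule sq_integrable_inner[OF sq])
  have nset: "(LINT \<tau>:{a..b}|lebesgue. n \<tau>) \<le> N" for a b
    unfolding N_def set_lebesgue_integral_def using integrable_imp_set_integrable[OF ni, of a b] ni nn
    by (intro integral_mono) (auto simp: set_integrable_def indicator_def)
  have incr: "\<bar>F b - F a\<bar> \<le> N" if "0 \<le> a" "a \<le> b" "b \<le> T" for a b
  proof -
    have "F b - F a = 2 * (LINT \<tau>:{a..b}|lebesgue. f \<tau>)"
      unfolding F_def f_def by (rule energy_increment[OF w p m P sym comm that])
    also have "\<bar>\<dots>\<bar> \<le> 2 * (LINT \<tau>:{a..b}|lebesgue. \<bar>f \<tau>\<bar>)"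
      using set_integral_norm_bound[OF integrable_imp_set_integrable[OF fi, of a b]] by simp
    also have "\<dots> = (LINT \<tau>:{a..b}|lebesgue. 2 * \<bar>f \<tau>\<bar>)" by simp
    also have "\<dots> \<le> (LINT \<tau>:{a..b}|lebesgue. n \<tau>)"
    proof (rule set_integral_mono)
      show "set_integrable lebesgue {a..b} (\<lambda>\<tau>. 2 * \<bar>f \<tau>\<bar>)" "set_integrable lebesgue {a..b} n"
        using fi ni by (auto intro!: integrable_imp_set_integrable)
      show "2 * \<bar>f \<tau>\<bar> \<le> n \<tau>" for \<tau>
        using Cauchy_Schwarz_ineq2[of "P (G (d \<tau>))" "P (G (w \<tau>))"]
          sum_squares_bound[of "norm (P (G (d \<tau>)))" "norm (P (G (w \<tau>)))"]
        unfolding n_def f_def by linarith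
    qed
    finally show ?thesis using nset[of a b] by linarith
  qed
  have le: "F t \<le> F s + N" if "s \<in> {0..T}" for s
    using incr[of s t] incr[of t s] t that by (cases "s \<le> t") auto
  have c: "continuous_on {0..T} (\<lambda>t. j (P (m t)))"
  proof -
    have "continuous_on {0..T} m"
      using weak_primitive_continuous[OF p] by (rule continuous_on_subset) auto
    then show ?thesis
      by (rule continuous_on_compose2[OF linear_continuous_on[OF bounded_linear_compose[OF j_bounded_linear P]]]) auto
  qed
  have Fi: "set_integrable lebesgue {0..T} F"
  proof -
    have "(\<lambda>\<tau>. (norm (indicator {0..T} \<tau> *\<^sub>R j (P (m \<tau>))))\<^sup>2) = (\<lambda>\<tau>. indicator {0..T} \<tau> *\<^sub>R F \<tau>)"
      by (auto simp: F_def indicator_def)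
    then show ?thesis using sq_integrable_continuous[OF c] by (simp add: sq_integrable_def set_integrable_def)
  qed
  have "F t * (T - 0) = (LINT \<tau>:{0..T}|lebesgue. F t)" using T by simp
  also have "\<dots> \<le> (LINT \<tau>:{0..T}|lebesgue. F \<tau> + N)"
    using le Fi by (intro set_integral_mono set_integrable_const_Icc set_integral_add) auto
  also have "\<dots> = (LINT \<tau>:{0..T}|lebesgue. F \<tau>) + N * (T - 0)"
    using Fi T by (simp add: set_integral_add set_integrable_const_Icc)
  also have "(LINT \<tau>:{0..T}|lebesgue. F \<tau>) \<le> (LINT \<tau>|lebesgue. K\<^sup>2 * n \<tau>)"
    unfolding set_lebesgue_integral_def
  proof (rule integral_mono_AE)
    show "integrable lebesgue (\<lambda>\<tau>. indicator {0..T} \<tau> *\<^sub>R F \<tau>)" using Fi by (simp add: set_integrable_def)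
    show "integrable lebesgue (\<lambda>\<tau>. K\<^sup>2 * n \<tau>)" using ni by simp
    have "AE \<tau> in lebesgue. \<tau> \<noteq> 0" "AE \<tau> in lebesgue. \<tau> \<noteq> T"
      by (auto intro!: AE_completion AE_lborel_singleton)
    with m show "AE \<tau> in lebesgue. indicator {0..T} \<tau> *\<^sub>R F \<tau> \<le> K\<^sup>2 * n \<tau>"
    proof eventually_elim
      case (elim \<tau>)
      show ?case
      proof (cases "\<tau> \<in> {0..T}")
        case True
        then have "F \<tau> = (norm (j (P (G (w \<tau>)))))\<^sup>2" using elim by (simp add: F_def)
        also have "\<dots> \<le> (K * norm (P (G (w \<tau>))))\<^sup>2" by (intro power_mono norm_j_le) simp
        also have "\<dots> \<le> K\<^sup>2 * n \<tau>" by (simp add: power_mult_distrib n_def mult_left_mono)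
        finally show ?thesis using True by simp
      next
        case False
        then show ?thesis using nn by simp
      qed
    qed
  qed
  also have "(LINT \<tau>|lebesgue. K\<^sup>2 * n \<tau>) = K\<^sup>2 * N" by (simp add: N_def)
  finally have "F t * T \<le> K\<^sup>2 * N + N * T" by simp
  then have "F t \<le> (K\<^sup>2 / T + 1) * N" using T by (simp add: field_simps)
  then show ?thesis by (simp add: F_def N_def n_def)
qed

text \<open>The maps \<open>Rs n\<close> after G are contractions converging strongly, which yields
  pointwise convergence together with an integrable majorant.\<close>

lemma Rs_G_L2_tendsto:
  assumes z: "sq_integrable z"
  shows "(\<lambda>n. LINT t|lebesgue. (norm (Rs n (G (z t)) - z t))\<^sup>2) \<longlonglongrightarrow> 0"
proof -
  have RG: "sq_integrable (\<lambda>t. Rs n (G (z t)))" for n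
    by (rule sq_integrable_bounded_linear[OF bounded_linear_compose[OF Rs_bounded_linear G_bounded_linear] z])
  have "(\<lambda>n. LINT t|lebesgue. (norm (Rs n (G (z t)) - z t))\<^sup>2) \<longlonglongrightarrow> (LINT (t::real)|lebesgue. (0::real))"
  proof (rule integral_dominated_convergence[where w = "\<lambda>t. 4 * (norm (z t))\<^sup>2"])
    show "integrable lebesgue (\<lambda>t. 4 * (norm (z t))\<^sup>2)" using z by (simp add: sq_integrable_def)
    show "(\<lambda>t. (norm (Rs n (G (z t)) - z t))\<^sup>2) \<in> borel_measurable lebesgue" for n
      using sq_integrable_diff[OF RG z, of n] by (auto simp: sq_integrable_def)
    have "(\<lambda>n. (norm (Rs n (G x) - x))\<^sup>2) \<longlonglongrightarrow> (norm (x - x))\<^sup>2" for x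
      by (intro tendsto_intros Rs_G_tendsto)
    then show "AE t in lebesgue. (\<lambda>n. (norm (Rs n (G (z t)) - z t))\<^sup>2) \<longlonglongrightarrow> 0" by simp
    show "AE t in lebesgue. norm ((norm (Rs n (G (z t)) - z t))\<^sup>2) \<le> 4 * (norm (z t))\<^sup>2" for n
    proof (rule AE_I2)
      fix t
      have "norm (Rs n (G (z t)) - z t) \<le> 2 * norm (z t)"
        using norm_triangle_ineq4[of "Rs n (G (z t))" "z t"] norm_Rs_G[of n "z t"] by simp
      from power_mono[OF this, of 2] show "norm ((norm (Rs n (G (z t)) - z t))\<^sup>2) \<le> 4 * (norm (z t))\<^sup>2"
        by (simp add: power_mult_distrib)
    qed
  qed auto
  then show ?thesis by simp
qed

lemma Rs_G_inner_tendsto: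
  assumes w: "sq_integrable w" and d: "sq_integrable d"
  shows "(\<lambda>n. LINT \<tau>:{0..T}|lebesgue. Rs n (G (d \<tau>)) \<bullet> Rs n (G (w \<tau>))) \<longlonglongrightarrow> (LINT \<tau>:{0..T}|lebesgue. d \<tau> \<bullet> w \<tau>)"
  unfolding set_lebesgue_integral_def
proof (rule integral_dominated_convergence[where w = "\<lambda>t. norm (d t) * norm (w t)"])
  have bl: "bounded_linear (\<lambda>x. Rs n (G x))" for n by (rule bounded_linear_compose[OF Rs_bounded_linear G_bounded_linear])
  show "(\<lambda>\<tau>. indicator {0..T} \<tau> *\<^sub>R (d \<tau> \<bullet> w \<tau>)) \<in> borel_measurable lebesgue"
    using integrable_imp_set_integrable[OF sq_integrable_inner[OF d w]] by (auto simp: set_integrable_def)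
  show "(\<lambda>\<tau>. indicator {0..T} \<tau> *\<^sub>R (Rs n (G (d \<tau>)) \<bullet> Rs n (G (w \<tau>)))) \<in> borel_measurable lebesgue" for n
    using integrable_imp_set_integrable[OF sq_integrable_inner[OF sq_integrable_bounded_linear[OF bl d] sq_integrable_bounded_linear[OF bl w]]]
    by (auto simp: set_integrable_def)
  have "sq_integrable (\<lambda>t. norm (d t))" "sq_integrable (\<lambda>t. norm (w t))"
    using d w by (auto simp: sq_integrable_def)
  from sq_integrable_inner[OF this] show "integrable lebesgue (\<lambda>t. norm (d t) * norm (w t))" by simp
  show "AE t in lebesgue. (\<lambda>n. indicator {0..T} t *\<^sub>R (Rs n (G (d t)) \<bullet> Rs n (G (w t)))) \<longlonglongrightarrow> indicator {0..T} t *\<^sub>R (d t \<bullet> w t)"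
    by (intro AE_I2 tendsto_intros Rs_G_tendsto)
  show "AE t in lebesgue. norm (indicator {0..T} t *\<^sub>R (Rs n (G (d t)) \<bullet> Rs n (G (w t)))) \<le> norm (d t) * norm (w t)" for n
  proof (rule AE_I2)
    fix t
    have "\<bar>Rs n (G (d t)) \<bullet> Rs n (G (w t))\<bar> \<le> norm (Rs n (G (d t))) * norm (Rs n (G (w t)))"
      by (rule Cauchy_Schwarz_ineq2)
    also have "\<dots> \<le> norm (d t) * norm (w t)" by (intro mult_mono norm_Rs_G) auto
    finally show "norm (indicator {0..T} t *\<^sub>R (Rs n (G (d t)) \<bullet> Rs n (G (w t)))) \<le> norm (d t) * norm (w t)"
      by (auto simp: indicator_def)
  qed
qed

text \<open>The regularisations \<open>(\<epsilon> + G)\<^sup>-\<^sup>1 m\<close> are differentiable in time with values in \<open>V\<close>, and the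
  energy bound makes their images in \<open>H\<close> uniformly Cauchy as \<open>\<epsilon> \<rightarrow> 0\<close>.\<close>

lemma continuous_representative_of_primitive:
  assumes T: "0 < T" and w: "sq_integrable w" and p: "weak_primitive m d"
    and m: "AE t in lebesgue. t \<in> {0<..<T} \<longrightarrow> m t = G (w t)"
  shows "\<exists>c. continuous_on {0..T} c \<and> (AE t in lebesgue. t \<in> {0<..<T} \<longrightarrow> c t = j (w t)) \<and>
    (\<forall>t\<in>{0..T}. (norm (c t))\<^sup>2 \<le> (K\<^sup>2 / T + 1) * (LINT \<tau>|lebesgue. (norm (d \<tau>))\<^sup>2 + (norm (w \<tau>))\<^sup>2)) \<and>
    (norm (c T))\<^sup>2 - (norm (c 0))\<^sup>2 = 2 * (LINT \<tau>:{0..T}|lebesgue. d \<tau> \<bullet> w \<tau>)"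
proof -
  define C where "C = K\<^sup>2 / T + 1"
  have C: "0 < C" using T by (simp add: C_def add_nonneg_pos)
  have d: "sq_integrable d" using p by (rule weak_primitiveD)
  define c where "c n t = j (Rs n (m t))" for n t
  \<comment> \<open>C is the constant of the energy bound; the 2 comes from bounding the square of a
    difference of two regularisation errors.\<close>
  define \<epsilon> where "\<epsilon> n = 2 * C * ((LINT t|lebesgue. (norm (Rs n (G (d t)) - d t))\<^sup>2) + (LINT t|lebesgue. (norm (Rs n (G (w t)) - w t))\<^sup>2))" for n
  have \<epsilon>0: "\<epsilon> \<longlonglongrightarrow> 0" unfolding \<epsilon>_def
    by (intro tendsto_mult_right_zero tendsto_add_zero Rs_G_L2_tendsto d w)
  have bl: "bounded_linear (\<lambda>x. Rs n (G x))" for n by (rule bounded_linear_compose[OF Rs_bounded_linear G_bounded_linear])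
  have dist: "(norm (c n t - c k t))\<^sup>2 \<le> \<epsilon> n + \<epsilon> k" if t: "t \<in> {0..T}" for n k t
  proof -
    \<comment> \<open>A difference of two resolvents is still symmetric and commutes with G, so the
      energy bound applies directly to the difference of two regularisations.\<close>
    define P where "P x = Rs n x - Rs k x" for x
    have P: "bounded_linear P" unfolding P_def by (intro bounded_linear_sub Rs_bounded_linear)
    have sqz: "(LINT \<tau>|lebesgue. (norm (P (G (z \<tau>))))\<^sup>2) \<le>
        2 * (LINT \<tau>|lebesgue. (norm (Rs n (G (z \<tau>)) - z \<tau>))\<^sup>2) + 2 * (LINT \<tau>|lebesgue. (norm (Rs k (G (z \<tau>)) - z \<tau>))\<^sup>2)"
      (is "?I \<le> ?R")
      and sqi: "integrable lebesgue (\<lambda>\<tau>. (norm (P (G (z \<tau>))))\<^sup>2)"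
      if z: "sq_integrable z" for z
    proof -
      show i: "integrable lebesgue (\<lambda>\<tau>. (norm (P (G (z \<tau>))))\<^sup>2)"
        using sq_integrable_bounded_linear[OF bounded_linear_compose[OF P G_bounded_linear] z]
        by (simp add: sq_integrable_def)
      have r: "integrable lebesgue (\<lambda>\<tau>. (norm (Rs n (G (z \<tau>)) - z \<tau>))\<^sup>2)" for n
        using sq_integrable_diff[OF sq_integrable_bounded_linear[OF bl z] z] by (simp add: sq_integrable_def)
      have "?I \<le> (LINT \<tau>|lebesgue. 2 * (norm (Rs n (G (z \<tau>)) - z \<tau>))\<^sup>2 + 2 * (norm (Rs k (G (z \<tau>)) - z \<tau>))\<^sup>2)"
      proof (rule integral_mono[OF i])
        show "integrable lebesgue (\<lambda>\<tau>. 2 * (norm (Rs n (G (z \<tau>)) - z \<tau>))\<^sup>2 + 2 * (norm (Rs k (G (z \<tau>)) - z \<tau>))\<^sup>2)"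
          using r by simp
        fix \<tau>
        let ?a = "Rs n (G (z \<tau>)) - z \<tau>" and ?b = "Rs k (G (z \<tau>)) - z \<tau>"
        have "P (G (z \<tau>)) = ?a - ?b" by (simp add: P_def)
        then show "(norm (P (G (z \<tau>))))\<^sup>2 \<le> 2 * (norm ?a)\<^sup>2 + 2 * (norm ?b)\<^sup>2"
          by (simp only: norm_diff_square_le)
      qed
      also have "\<dots> = ?R" using r by simp
      finally show "?I \<le> ?R" .
    qed
    have "(norm (j (P (m t))))\<^sup>2 \<le> C * (LINT \<tau>|lebesgue. (norm (P (G (d \<tau>))))\<^sup>2 + (norm (P (G (w \<tau>))))\<^sup>2)"
      unfolding C_def
      by (rule energy_sup_bound[OF T w p m P _ _ t])
        (simp_all add: P_def inner_diff_left inner_diff_right Rs_sym Rs_commute G.diff)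
    also have "\<dots> = C * ((LINT \<tau>|lebesgue. (norm (P (G (d \<tau>))))\<^sup>2) + (LINT \<tau>|lebesgue. (norm (P (G (w \<tau>))))\<^sup>2))"
      using sqi[OF d] sqi[OF w] by simp
    also have "\<dots> \<le> \<epsilon> n + \<epsilon> k"
      using mult_left_mono[OF add_mono[OF sqz[OF d] sqz[OF w]], of C] C by (simp add: \<epsilon>_def algebra_simps)
    finally show ?thesis by (simp add: c_def P_def J.diff)
  qed
  have conv: "\<exists>l. (\<lambda>n. c n t) \<longlonglongrightarrow> l" if t: "t \<in> {0..T}" for t
  proof -
    have "Cauchy (\<lambda>n. c n t)"
      by (rule Cauchy_if_square_le[where c = 1 and \<epsilon> = \<epsilon>]) (use dist[OF t] \<epsilon>0 in auto)
    then show ?thesis by (simp add: Cauchy_convergent_iff convergent_def)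
  qed
  define c' where "c' t = lim (\<lambda>n. c n t)" for t
  have lim: "(\<lambda>n. c n t) \<longlonglongrightarrow> c' t" if "t \<in> {0..T}" for t
    unfolding c'_def using conv[OF that] by (auto simp: convergent_LIMSEQ_iff[symmetric] convergent_def)
  have dist': "(norm (c n t - c' t))\<^sup>2 \<le> \<epsilon> n" if t: "t \<in> {0..T}" for n t
  proof (rule LIMSEQ_le)
    show "(\<lambda>k. (norm (c n t - c k t))\<^sup>2) \<longlonglongrightarrow> (norm (c n t - c' t))\<^sup>2"
      by (intro tendsto_intros lim t)
    show "(\<lambda>k. \<epsilon> n + \<epsilon> k) \<longlonglongrightarrow> \<epsilon> n" using tendsto_add[OF tendsto_const \<epsilon>0, of "\<epsilon> n"] by simp
  qed (use dist[OF t] in blast)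
  have "uniform_limit {0..T} c c' sequentially"
  proof (rule uniform_limitI)
    fix e :: real assume e: "0 < e"
    then have "\<forall>\<^sub>F n in sequentially. \<epsilon> n < e\<^sup>2" using order_tendstoD(2)[OF \<epsilon>0, of "e\<^sup>2"] by simp
    then show "\<forall>\<^sub>F n in sequentially. \<forall>t\<in>{0..T}. dist (c n t) (c' t) < e"
    proof eventually_elim
      case (elim n)
      show ?case
      proof
        fix t assume "t \<in> {0..T}"
        from dist'[OF this, of n] have "(norm (c n t - c' t))\<^sup>2 < e\<^sup>2" using elim by linarith
        then show "dist (c n t) (c' t) < e" using e by (simp add: dist_norm power2_less_imp_less)
      qed
    qed
  qed
  moreover have "continuous_on {0..T} (c n)" for n
  proof -
    have "continuous_on {0..T} m" using weak_primitive_continuous[OF p] by (rule continuous_on_subset) auto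
    then show ?thesis unfolding c_def
      by (rule continuous_on_compose2[OF linear_continuous_on[OF bounded_linear_compose[OF j_bounded_linear Rs_bounded_linear]]]) auto
  qed
  ultimately have cont: "continuous_on {0..T} c'"
    by (intro uniform_limit_theorem[where f = c and F = sequentially]) auto
  have ae: "AE t in lebesgue. t \<in> {0<..<T} \<longrightarrow> c' t = j (w t)"
    using m
  proof eventually_elim
    case (elim t)
    show ?case
    proof
      assume t: "t \<in> {0<..<T}"
      then have "(\<lambda>n. c n t) \<longlonglongrightarrow> j (w t)"
        using elim unfolding c_def by (simp add: J.tendsto[OF Rs_G_tendsto])
      moreover have "(\<lambda>n. c n t) \<longlonglongrightarrow> c' t" using t by (intro lim) auto
      ultimately show "c' t = j (w t)" using LIMSEQ_unique by blast
    qed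
  qed
  have bound: "(norm (c' t))\<^sup>2 \<le> C * (LINT \<tau>|lebesgue. (norm (d \<tau>))\<^sup>2 + (norm (w \<tau>))\<^sup>2)" if t: "t \<in> {0..T}" for t
  proof (rule LIMSEQ_le_const2)
    show "(\<lambda>n. (norm (c n t))\<^sup>2) \<longlonglongrightarrow> (norm (c' t))\<^sup>2" by (intro tendsto_intros lim t)
    show "\<exists>N. \<forall>n\<ge>N. (norm (c n t))\<^sup>2 \<le> C * (LINT \<tau>|lebesgue. (norm (d \<tau>))\<^sup>2 + (norm (w \<tau>))\<^sup>2)"
    proof (intro exI allI impI)
      fix n
      have "(norm (c n t))\<^sup>2 \<le> C * (LINT \<tau>|lebesgue. (norm (Rs n (G (d \<tau>))))\<^sup>2 + (norm (Rs n (G (w \<tau>))))\<^sup>2)"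
        unfolding C_def c_def
        by (rule energy_sup_bound[OF T w p m Rs_bounded_linear Rs_sym Rs_commute t])
      also have "\<dots> \<le> C * (LINT \<tau>|lebesgue. (norm (d \<tau>))\<^sup>2 + (norm (w \<tau>))\<^sup>2)"
      proof (intro mult_left_mono integral_mono)
        show "integrable lebesgue (\<lambda>\<tau>. (norm (Rs n (G (d \<tau>))))\<^sup>2 + (norm (Rs n (G (w \<tau>))))\<^sup>2)"
          using sq_integrable_bounded_linear[OF bl d, of n] sq_integrable_bounded_linear[OF bl w, of n]
          by (simp add: sq_integrable_def)
        show "integrable lebesgue (\<lambda>\<tau>. (norm (d \<tau>))\<^sup>2 + (norm (w \<tau>))\<^sup>2)" using d w by (simp add: sq_integrable_def)
        show "(norm (Rs n (G (d \<tau>))))\<^sup>2 + (norm (Rs n (G (w \<tau>))))\<^sup>2 \<le> (norm (d \<tau>))\<^sup>2 + (norm (w \<tau>))\<^sup>2" for \<tau>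
          by (intro add_mono power_mono norm_Rs_G) auto
      qed (use C in simp)
      finally show "(norm (c n t))\<^sup>2 \<le> C * (LINT \<tau>|lebesgue. (norm (d \<tau>))\<^sup>2 + (norm (w \<tau>))\<^sup>2)" .
    qed
  qed
  have energy: "(norm (c' T))\<^sup>2 - (norm (c' 0))\<^sup>2 = 2 * (LINT \<tau>:{0..T}|lebesgue. d \<tau> \<bullet> w \<tau>)"
  proof (rule LIMSEQ_unique)
    show "(\<lambda>n. (norm (c n T))\<^sup>2 - (norm (c n 0))\<^sup>2) \<longlonglongrightarrow> (norm (c' T))\<^sup>2 - (norm (c' 0))\<^sup>2"
      using T by (intro tendsto_intros lim) auto
    have "(norm (c n T))\<^sup>2 - (norm (c n 0))\<^sup>2 = 2 * (LINT \<tau>:{0..T}|lebesgue. Rs n (G (d \<tau>)) \<bullet> Rs n (G (w \<tau>)))" for n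
      unfolding c_def using T by (intro energy_increment[OF w p m Rs_bounded_linear Rs_sym Rs_commute]) auto
    then show "(\<lambda>n. (norm (c n T))\<^sup>2 - (norm (c n 0))\<^sup>2) \<longlonglongrightarrow> 2 * (LINT \<tau>:{0..T}|lebesgue. d \<tau> \<bullet> w \<tau>)"
      by (simp add: tendsto_mult_left Rs_G_inner_tendsto[OF w d])
  qed
  show ?thesis using cont ae bound energy unfolding C_def by blast
qed

text \<open>G w and any weak primitive of d have the same weak derivative on (0, T), so they differ
  by a constant, which can be added to the primitive.\<close>

lemma continuous_representative:
  assumes T: "0 < T" and w: "sq_integrable w" and d: "sq_integrable d"
    and der: "\<And>\<phi> \<eta>. test_function T \<phi> \<Longrightarrow>
      (LINT t|lebesgue. deriv \<phi> t * (j (w t) \<bullet> j \<eta>)) = - (LINT t|lebesgue. \<phi> t * (d t \<bullet> \<eta>))"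
  shows "\<exists>c. continuous_on {0..T} c \<and> (AE t in lebesgue. t \<in> {0<..<T} \<longrightarrow> c t = j (w t)) \<and>
    (\<forall>t\<in>{0..T}. (norm (c t))\<^sup>2 \<le> (K\<^sup>2 / T + 1) * (LINT \<tau>|lebesgue. (norm (d \<tau>))\<^sup>2 + (norm (w \<tau>))\<^sup>2)) \<and>
    (norm (c T))\<^sup>2 - (norm (c 0))\<^sup>2 = 2 * (LINT \<tau>:{0..T}|lebesgue. d \<tau> \<bullet> w \<tau>)"
proof -
  obtain m0 where m0: "weak_primitive m0 d" using weak_primitive_exists[OF d] by blast
  have c0: "continuous_on {0..T} m0" using weak_primitive_continuous[OF m0] by (rule continuous_on_subset) auto
  have Gw: "sq_integrable (\<lambda>t. G (w t))" by (rule sq_integrable_bounded_linear[OF G_bounded_linear w])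
  \<comment> \<open>The primitive lives on the half-line and need not be square integrable there;
    the cut-off is invisible to test functions.\<close>
  define M where "M t = indicator {0..T} t *\<^sub>R m0 t" for t
  have M: "sq_integrable M" unfolding M_def[abs_def] by (rule sq_integrable_continuous[OF c0])
  define z where "z t = indicator {0<..<T} t *\<^sub>R (G (w t) - M t)" for t
  have z: "sq_integrable z"
    unfolding z_def[abs_def] by (intro sq_integrable_indicator sq_integrable_diff Gw M) auto
  have "\<exists>c. AE t in lebesgue. t \<in> {0<..<T} \<longrightarrow> z t = c"
  proof (rule du_Bois_Reymond[OF T z])
    show "z t = 0" if "t \<notin> {0<..<T}" for t using that by (simp add: z_def)
    fix \<phi> \<eta> assume \<phi>: "test_function T \<phi>"
    note \<phi>' = test_function_deriv[OF \<phi>]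
    have Meq: "deriv \<phi> t * (M t \<bullet> \<eta>) = deriv \<phi> t * (m0 t \<bullet> \<eta>)" for t
      using test_function_zero[OF \<phi>', of t] by (cases "t \<in> {0<..<T}") (auto simp: M_def)
    have "deriv \<phi> t * (z t \<bullet> \<eta>) = deriv \<phi> t * (G (w t) \<bullet> \<eta>) - deriv \<phi> t * (M t \<bullet> \<eta>)" for t
      using test_function_zero[OF \<phi>', of t]
      by (cases "t \<in> {0<..<T}") (auto simp: z_def inner_diff_left right_diff_distrib)
    then have "(LINT t|lebesgue. deriv \<phi> t * (z t \<bullet> \<eta>)) =
      (LINT t|lebesgue. deriv \<phi> t * (G (w t) \<bullet> \<eta>)) - (LINT t|lebesgue. deriv \<phi> t * (M t \<bullet> \<eta>))"
      using integrable_test_inner[OF Gw \<phi>', of \<eta>] integrable_test_inner[OF M \<phi>', of \<eta>] by simp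
    also have "\<dots> = 0"
      unfolding Meq using weak_primitive_integration_by_parts[OF less_imp_le[OF T] m0 \<phi>, of \<eta>] der[OF \<phi>, of \<eta>]
      by (simp add: G_inner)
    finally show "(LINT t|lebesgue. deriv \<phi> t * (z t \<bullet> \<eta>)) = 0" .
  qed
  then obtain c where c: "AE t in lebesgue. t \<in> {0<..<T} \<longrightarrow> z t = c" by blast
  have "AE t in lebesgue. t \<in> {0<..<T} \<longrightarrow> m0 t + c = G (w t)"
    using c by eventually_elim (auto simp: z_def M_def)
  from continuous_representative_of_primitive[OF T w weak_primitive_add_const[OF m0] this] show ?thesis .
qed

end

section \<open>The time derivative and the traces\<close>

definition riesz :: "('v::{real_inner,complete_space} \<Rightarrow>\<^sub>L real) \<Rightarrow> 'v" where
  "riesz f = (SOME z. \<forall>\<eta>. z \<bullet> \<eta> = blinfun_apply f \<eta>)"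

lemma riesz_inner: "riesz f \<bullet> \<eta> = blinfun_apply f \<eta>"
proof -
  have "\<exists>z. \<forall>\<eta>. z \<bullet> \<eta> = blinfun_apply f \<eta>"
    using riesz_representation[OF blinfun.bounded_linear_right[of f]] by metis
  from someI_ex[OF this] show ?thesis unfolding riesz_def by blast
qed

lemma norm_riesz [simp]: "norm (riesz f) = norm f"
proof (rule antisym)
  have "norm (riesz f) * norm (riesz f) = blinfun_apply f (riesz f)"
    by (simp add: riesz_inner[symmetric] power2_norm_eq_inner[symmetric] power2_eq_square)
  also have "\<dots> \<le> norm f * norm (riesz f)" using norm_blinfun[of f "riesz f"] by simp
  finally show "norm (riesz f) \<le> norm f"
    by (cases "norm (riesz f) = 0") (auto simp: mult_le_cancel_right)
  show "norm f \<le> norm (riesz f)"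
    by (rule norm_blinfun_bound) (auto simp: riesz_inner[symmetric] Cauchy_Schwarz_ineq2)
qed

lemma riesz_bounded_linear: "bounded_linear riesz"
proof (rule bounded_linear_intro)
  show "riesz (x + y) = riesz x + riesz y" for x y :: "'a \<Rightarrow>\<^sub>L real"
    by (rule vector_eq_rdot[THEN iffD1]) (auto simp: riesz_inner inner_add_left blinfun.add_left)
  show "riesz (r *\<^sub>R x) = r *\<^sub>R riesz x" for r and x :: "'a \<Rightarrow>\<^sub>L real"
    by (rule vector_eq_rdot[THEN iffD1]) (auto simp: riesz_inner blinfun.scaleR_left)
  show "norm (riesz x) \<le> norm x * 1" for x :: "'a \<Rightarrow>\<^sub>L real" by simp
qed

lemma AE_lebesgue_on_Ioo:
  "(AE t in lebesgue_on {0<..<T}. P t) \<longleftrightarrow> (AE t in lebesgue. t \<in> {0<..<T::real} \<longrightarrow> P t)"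
  by (rule AE_restrict_space_iff) auto

text \<open>Makes traces, at the endpoints too, independent of the chosen representative: a
  continuous nonnegative function with zero integral is 0 everywhere.\<close>

lemma continuous_AE_eq_imp_eq:
  fixes c1 c2 :: "real \<Rightarrow> 'h::{real_inner,second_countable_topology}"
  assumes T: "0 < T" and c: "continuous_on {0..T} c1" "continuous_on {0..T} c2"
    and ae: "AE t in lebesgue. t \<in> {0<..<T} \<longrightarrow> c1 t = c2 t" and t: "t \<in> {0..T}"
  shows "c1 t = c2 t"
proof -
  define f where "f t = norm (c1 t - c2 t)" for t
  have cf: "continuous_on {0..T} f" unfolding f_def by (intro continuous_intros c)
  have fi: "set_integrable lebesgue {0..T} f"
    using set_integrable_inner_continuous[OF sq_integrable_indicator_const[of "{0..T}" 0 T "1::real"] cf]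
    by (auto simp: set_integrable_def indicator_inter_arith[symmetric] mult.assoc[symmetric])
  have "AE t in lebesgue. t \<noteq> 0" "AE t in lebesgue. t \<noteq> T"
    by (auto intro!: AE_completion AE_lborel_singleton)
  with ae have "AE t in lebesgue. indicator {0..T} t *\<^sub>R f t = 0"
    by eventually_elim (auto simp: f_def indicator_def)
  then have "(LINT t:{0..T}|lebesgue. f t) = 0"
    unfolding set_lebesgue_integral_def by (rule integral_eq_zero_AE)
  then have "integral {0..T} f = 0" using set_lebesgue_integral_eq_integral(2)[OF fi] by simp
  moreover have "integral {0..T} f = 0 \<longleftrightarrow> (\<forall>x\<in>{0..T}. f x = 0)"
    by (rule integral_eq_0_iff[OF cf T]) (simp add: f_def)
  ultimately have "f t = 0" using t by blast
  then show ?thesis by (simp add: f_def)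
qed

text \<open>The elementary tensor of \<phi> and \<eta>. Inner products with such elements express
  the weak derivative by identities inside the Hilbert space.\<close>

definition tens :: "(real \<Rightarrow> real) \<Rightarrow> 'v::{real_inner,second_countable_topology} \<Rightarrow> 'v l2" where
  "tens \<phi> \<eta> = abs_l2 (\<lambda>t. \<phi> t *\<^sub>R \<eta>)"

lemma inner_abs_l2:
  assumes "sq_integrable f"
  shows "x \<bullet> abs_l2 f = (LINT t|lebesgue. rep_l2 x t \<bullet> f t)"
proof -
  have [measurable]: "f \<in> borel_measurable lebesgue" using assms by (simp add: sq_integrable_def)
  show ?thesis unfolding inner_l2 using rep_abs_l2[OF assms]
    by (intro integral_cong_AE) auto
qed

lemma inner_tens:
  assumes "test_function T \<phi>"
  shows "x \<bullet> tens \<phi> \<eta> = (LINT t|lebesgue. \<phi> t * (rep_l2 x t \<bullet> \<eta>))"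
  unfolding tens_def by (subst inner_abs_l2[OF sq_integrable_test[OF assms]]) simp

lemma integral_lebesgue_on_Ioo:
  fixes f :: "real \<Rightarrow> real"
  shows "(LINT t|lebesgue_on {0<..<T}. f t) = (LINT t|lebesgue. indicator {0<..<T} t * f t)"
  by (simp add: integral_restrict_space)

lemma integrable_lebesgue_on_Ioo:
  fixes f :: "real \<Rightarrow> real"
  shows "integrable (lebesgue_on {0<..<T}) f \<longleftrightarrow> integrable lebesgue (\<lambda>t. indicator {0<..<T} t * f t)"
  by (simp add: integrable_restrict_space)

locale gelfand_triple_interval = gelfand_triple j
  for j :: "'v::{real_inner,complete_space,second_countable_topology} \<Rightarrow>
              'h::{real_inner,complete_space,second_countable_topology}" +
  fixes T :: real
  assumes T: "0 < T"
begin

abbreviation "Y \<equiv> (L2I T :: 'v l2 set)"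
abbreviation "X \<equiv> (spaceX T j :: 'v l2 set)"

text \<open>Under the Riesz isometry \<open>V' \<simeq> V\<close> the weak derivative is an element of \<open>L\<^sub>2(I;V)\<close>, and its graph an
  orthogonal complement.\<close>

definition derivative_pair :: "'v l2 \<Rightarrow> 'v l2 \<Rightarrow> bool" where
  "derivative_pair w d \<longleftrightarrow> w \<in> Y \<and> d \<in> Y \<and>
     (\<forall>\<phi> \<eta>. test_function T \<phi> \<longrightarrow> w \<bullet> tens (deriv \<phi>) (G \<eta>) = - (d \<bullet> tens \<phi> \<eta>))"

lemma derivative_pair_add:
  "derivative_pair w d \<Longrightarrow> derivative_pair w' d' \<Longrightarrow> derivative_pair (w + w') (d + d')"
  by (auto simp: derivative_pair_def inner_add_left intro: L2I_add)

lemma derivative_pair_scale: "derivative_pair w d \<Longrightarrow> derivative_pair (r *\<^sub>R w) (r *\<^sub>R d)"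
  by (auto simp: derivative_pair_def intro: L2I_scale)

text \<open>The difference of two derivatives is orthogonal to all elementary tensors and vanishes
  by the fundamental lemma.\<close>

lemma derivative_pair_unique:
  assumes "derivative_pair w d" "derivative_pair w d'" shows "d = d'"
proof -
  define e where "e = d - d'"
  have e: "e \<in> Y" using assms by (auto simp: e_def derivative_pair_def intro: L2I_diff)
  have 0: "e \<bullet> tens \<phi> \<eta> = 0" if "test_function T \<phi>" for \<phi> \<eta>
    using assms that unfolding derivative_pair_def e_def inner_diff_left by (metis diff_self neg_equal_iff_equal)
  define z where "z t = indicator {0<..<T} t *\<^sub>R rep_l2 e t" for t
  have z: "sq_integrable z" unfolding z_def[abs_def] by (intro sq_integrable_indicator) auto
  have eq: "AE t in lebesgue. rep_l2 e t = z t"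
    using e unfolding L2I_AE by eventually_elim (auto simp: z_def indicator_def)
  have "AE t in lebesgue. z t = 0"
  proof (rule fundamental_lemma_vector[OF z])
    show "z t = 0" if "t \<notin> {0<..<T}" for t using that by (simp add: z_def)
    fix \<phi> and \<eta> :: 'v assume \<phi>: "test_function T \<phi>"
    have eq: "\<phi> t * (z t \<bullet> \<eta>) = \<phi> t * (rep_l2 e t \<bullet> \<eta>)" for t
      using test_function_zero[OF \<phi>, of t] by (cases "t \<in> {0<..<T}") (auto simp: z_def)
    show "(LINT t|lebesgue. \<phi> t * (z t \<bullet> \<eta>)) = 0"
      using 0[OF \<phi>, of \<eta>] unfolding eq inner_tens[OF \<phi>] .
  qed
  with eq have "AE t in lebesgue. rep_l2 e t = rep_l2 0 t"
    using rep_zero_l2[where 'a = 'v] by eventually_elim simp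
  then have "e = 0" by (simp add: l2_eq_iff)
  then show ?thesis by (simp add: e_def)
qed

text \<open>All defining conditions are closed: Y is closed, and the identities equate continuous
  functionals. This is the source of completeness of X.\<close>

lemma derivative_pair_limit:
  assumes w: "w \<longlonglongrightarrow> w'" and d: "d \<longlonglongrightarrow> d'" and p: "\<And>n. derivative_pair (w n) (d n)"
  shows "derivative_pair w' d'"
  unfolding derivative_pair_def
proof (intro conjI allI impI)
  show "w' \<in> Y" "d' \<in> Y"
    using closed_L2I closed_sequentially w d p unfolding derivative_pair_def by metis+
  fix \<phi> \<eta> assume \<phi>: "test_function T \<phi>"
  have "(\<lambda>n. w n \<bullet> tens (deriv \<phi>) (G \<eta>)) \<longlonglongrightarrow> w' \<bullet> tens (deriv \<phi>) (G \<eta>)"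
    "(\<lambda>n. - (d n \<bullet> tens \<phi> \<eta>)) \<longlonglongrightarrow> - (d' \<bullet> tens \<phi> \<eta>)"
    by (intro tendsto_intros w d)+
  moreover have "w n \<bullet> tens (deriv \<phi>) (G \<eta>) = - (d n \<bullet> tens \<phi> \<eta>)" for n
    using p[of n] \<phi> by (simp add: derivative_pair_def)
  ultimately show "w' \<bullet> tens (deriv \<phi>) (G \<eta>) = - (d' \<bullet> tens \<phi> \<eta>)"
    by (simp add: LIMSEQ_unique)
qed

lemma inner_tens_G:
  assumes "test_function T \<phi>"
  shows "w \<bullet> tens (deriv \<phi>) (G \<eta>) = (LINT t|lebesgue_on {0<..<T}. deriv \<phi> t * (j (rep_l2 w t) \<bullet> j \<eta>))"
  unfolding inner_tens[OF test_function_deriv[OF assms]] integral_lebesgue_on_Ioo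
proof (rule Bochner_Integration.integral_cong[OF refl])
  show "deriv \<phi> t * (rep_l2 w t \<bullet> G \<eta>) = indicator {0<..<T} t * (deriv \<phi> t * (j (rep_l2 w t) \<bullet> j \<eta>))" for t
    using test_function_zero[OF test_function_deriv[OF assms], of t]
    by (cases "t \<in> {0<..<T}") (auto simp: G_inner G_sym[symmetric])
qed

text \<open>The Riesz isometry applied at each time and extended by zero, so that derivatives with
  values in V' live in the same Hilbert space as the functions.\<close>

definition lift_dual :: "(real \<Rightarrow> 'v \<Rightarrow>\<^sub>L real) \<Rightarrow> 'v l2" where
  "lift_dual f = abs_l2 (\<lambda>t. indicator {0<..<T} t *\<^sub>R riesz (f t))"

lemma sq_integrable_lift:
  assumes "L2I_dual T f" shows "sq_integrable (\<lambda>t. indicator {0<..<T} t *\<^sub>R riesz (f t))"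
proof -
  have r: "riesz \<in> borel_measurable borel"
    by (intro borel_measurable_continuous_onI linear_continuous_on riesz_bounded_linear)
  have fm: "f \<in> borel_measurable (lebesgue_on {0<..<T})" using assms by (simp add: L2I_dual_def)
  from measurable_compose[OF fm r]
 have "(\<lambda>t. indicator {0<..<T} t *\<^sub>R riesz (f t)) \<in> borel_measurable lebesgue"
    by (subst (asm) borel_measurable_restrict_space_iff) auto
  moreover have "(\<lambda>t. (norm (indicator {0<..<T} t *\<^sub>R riesz (f t)))\<^sup>2) = (\<lambda>t. indicator {0<..<T} t * (norm (f t))\<^sup>2)"
    by (auto simp: indicator_def)
  ultimately show ?thesis
    using assms by (simp add: sq_integrable_def L2I_dual_def integrable_lebesgue_on_Ioo)
qed

lemma lift_dual_mem: "L2I_dual T f \<Longrightarrow> lift_dual f \<in> Y"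
  unfolding L2I_AE lift_dual_def using rep_abs_l2[OF sq_integrable_lift, of f] by (auto elim!: eventually_mono)

lemma lift_dual_inner:
  assumes "L2I_dual T f"
  shows "lift_dual f \<bullet> v = (LINT t|lebesgue_on {0<..<T}. blinfun_apply (f t) (rep_l2 v t))"
  unfolding integral_lebesgue_on_Ioo inner_commute[of _ v] lift_dual_def inner_abs_l2[OF sq_integrable_lift[OF assms]]
  by (simp add: riesz_inner[symmetric] inner_commute)

lemma lift_dual_norm:
  assumes "L2I_dual T f"
  shows "(norm (lift_dual f))\<^sup>2 = (LINT t|lebesgue_on {0<..<T}. (norm (f t))\<^sup>2)"
  unfolding integral_lebesgue_on_Ioo lift_dual_def norm_abs_l2[OF sq_integrable_lift[OF assms]]
  by (intro Bochner_Integration.integral_cong) (auto simp: indicator_def)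

lemma lift_dual_tens:
  assumes f: "L2I_dual T f" and \<phi>: "test_function T \<phi>"
  shows "lift_dual f \<bullet> tens \<phi> \<eta> = (LINT t|lebesgue_on {0<..<T}. \<phi> t * blinfun_apply (f t) \<eta>)"
proof -
  have "AE t in lebesgue. \<phi> t * (rep_l2 (lift_dual f) t \<bullet> \<eta>) = indicator {0<..<T} t * (\<phi> t * blinfun_apply (f t) \<eta>)"
    using rep_abs_l2[OF sq_integrable_lift[OF f]]
  proof eventually_elim
    case (elim t)
    then show ?case by (cases "t \<in> {0<..<T}")
      (auto simp: lift_dual_def riesz_inner[symmetric] test_function_zero[OF \<phi>])
  qed
  moreover have "(\<lambda>t. indicator {0<..<T} t * (\<phi> t * blinfun_apply (f t) \<eta>)) \<in> borel_measurable lebesgue"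
  proof -
    have "(\<lambda>t. indicator {0<..<T} t * (\<phi> t * blinfun_apply (f t) \<eta>)) =
      (\<lambda>t. \<phi> t * ((indicator {0<..<T} t *\<^sub>R riesz (f t)) \<bullet> \<eta>))"
      by (auto simp: indicator_def riesz_inner)
    then show ?thesis using integrable_test_inner[OF sq_integrable_lift[OF f] \<phi>, of \<eta>] by auto
  qed
  moreover have "(\<lambda>t. \<phi> t * (rep_l2 (lift_dual f) t \<bullet> \<eta>)) \<in> borel_measurable lebesgue"
    using integrable_test_inner[OF sq_integrable_rep \<phi>, of "lift_dual f" \<eta>] by auto
  ultimately show ?thesis
    unfolding inner_tens[OF \<phi>] integral_lebesgue_on_Ioo by (intro integral_cong_AE) auto
qed

lemma has_weak_deriv_iff:
  "w \<in> Y \<Longrightarrow> has_weak_deriv T j w f \<longleftrightarrow> L2I_dual T f \<and> derivative_pair w (lift_dual f)"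
  unfolding has_weak_deriv_def derivative_pair_def
  by (auto simp: lift_dual_mem inner_tens_G[symmetric] lift_dual_tens[symmetric])

text \<open>Taking inner products with a representative of d yields a V'-valued function whose lift
  is d.\<close>

lemma derivative_pair_imp_has_weak_deriv:
  assumes p: "derivative_pair w d" shows "\<exists>f. has_weak_deriv T j w f"
proof -
  define f where "f t = blinfun_inner_left (rep_l2 d t)" for t
  have app: "blinfun_apply (f t) \<eta> = rep_l2 d t \<bullet> \<eta>" for t \<eta> by (simp add: f_def inner_commute)
  have rf: "riesz (f t) = rep_l2 d t" for t
    by (rule vector_eq_rdot[THEN iffD1]) (simp add: riesz_inner app)
  have nf: "norm (f t) = norm (rep_l2 d t)" for t using norm_riesz[of "f t"] by (simp add: rf)
  have "(blinfun_inner_left :: 'v \<Rightarrow> _) \<in> borel_measurable borel"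
    by (intro borel_measurable_continuous_onI linear_continuous_on bounded_linear_blinfun_inner_left)
  then have "f \<in> borel_measurable lebesgue"
    unfolding f_def using measurable_compose[OF rep_measurable] by blast
  then have fm: "f \<in> borel_measurable (lebesgue_on {0<..<T})" by (rule measurable_restrict_space1)
  have "(\<lambda>t. (norm (indicator {0<..<T} t *\<^sub>R rep_l2 d t))\<^sup>2) = (\<lambda>t. indicator {0<..<T} t * (norm (f t))\<^sup>2)"
    by (auto simp: indicator_def nf)
  moreover have "sq_integrable (\<lambda>t. indicator {0<..<T} t *\<^sub>R rep_l2 d t)"
    by (rule sq_integrable_indicator) auto
  ultimately have "integrable lebesgue (\<lambda>t. indicator {0<..<T} t * (norm (f t))\<^sup>2)"
    by (simp add: sq_integrable_def)
  then have f: "L2I_dual T f" using fm by (simp add: L2I_dual_def integrable_lebesgue_on_Ioo)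
  have w: "w \<in> Y" and d: "d \<in> Y" using p by (auto simp: derivative_pair_def)
  have "AE t in lebesgue. rep_l2 (lift_dual f) t = rep_l2 d t"
    using rep_abs_l2[OF sq_integrable_lift[OF f]] d unfolding L2I_AE
    by eventually_elim (auto simp: lift_dual_def rf indicator_def)
  then have "lift_dual f = d" by (simp add: l2_eq_iff)
  then show ?thesis using f p w by (auto simp: has_weak_deriv_iff)
qed

text \<open>Passing to the lift removes the arbitrariness of the choice in
  \<open>weak_deriv\<close>, so that D becomes linear on X.\<close>

definition D :: "'v l2 \<Rightarrow> 'v l2" where "D w = lift_dual (weak_deriv T j w)"

lemma spaceX_iff: "w \<in> X \<longleftrightarrow> (\<exists>d. derivative_pair w d)"
proof
  assume "w \<in> X"
  then show "\<exists>d. derivative_pair w d" by (auto simp: spaceX_def has_weak_deriv_iff)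
next
  assume "\<exists>d. derivative_pair w d"
  then show "w \<in> X" using derivative_pair_imp_has_weak_deriv by (auto simp: spaceX_def derivative_pair_def)
qed

lemma weak_deriv_mem: assumes "w \<in> X" shows "L2I_dual T (weak_deriv T j w)" "derivative_pair w (D w)"
proof -
  have w: "w \<in> Y" and "\<exists>f. has_weak_deriv T j w f" using assms by (auto simp: spaceX_def)
  from someI_ex[OF this(2)] have "has_weak_deriv T j w (weak_deriv T j w)" by (simp add: weak_deriv_def)
  then show "L2I_dual T (weak_deriv T j w)" "derivative_pair w (D w)"
    using w by (auto simp: has_weak_deriv_iff D_def)
qed

lemma D_eqI: "derivative_pair w d \<Longrightarrow> D w = d"
  using derivative_pair_unique weak_deriv_mem(2) spaceX_iff by blast

lemma X_subset_Y: "w \<in> X \<Longrightarrow> w \<in> Y"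
  by (simp add: spaceX_def)

lemma D_mem: "w \<in> X \<Longrightarrow> D w \<in> Y"
  using weak_deriv_mem(2) by (simp add: derivative_pair_def)

lemma X_add: "w \<in> X \<Longrightarrow> v \<in> X \<Longrightarrow> w + v \<in> X" and D_add: "w \<in> X \<Longrightarrow> v \<in> X \<Longrightarrow> D (w + v) = D w + D v"
  using derivative_pair_add[OF weak_deriv_mem(2) weak_deriv_mem(2), of w v] D_eqI spaceX_iff by auto

lemma X_scale: "w \<in> X \<Longrightarrow> r *\<^sub>R w \<in> X" and D_scale: "w \<in> X \<Longrightarrow> D (r *\<^sub>R w) = r *\<^sub>R D w"
  using derivative_pair_scale[OF weak_deriv_mem(2), of w r] D_eqI spaceX_iff by auto

lemma derivative_pair_zero: "derivative_pair 0 0"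
  by (simp add: derivative_pair_def L2I_zero)

lemma subspace_X: "subspace X"
  unfolding subspace_def using X_add X_scale spaceX_iff derivative_pair_zero by blast

lemma X_diff: "w \<in> X \<Longrightarrow> v \<in> X \<Longrightarrow> w - v \<in> X"
  by (rule subspace_diff[OF subspace_X])

lemma D_diff: "w \<in> X \<Longrightarrow> v \<in> X \<Longrightarrow> D (w - v) = D w - D v"
  using D_add[of "w - v" v] X_diff[of w v] by simp

lemma normX_eq: "w \<in> X \<Longrightarrow> normX T j w = norm (w, D w)"
  by (simp add: normX_def norm_Pair D_def lift_dual_norm weak_deriv_mem(1))

lemma op_dt_eq: "w \<in> X \<Longrightarrow> v \<in> Y \<Longrightarrow> op_dt T j w v = D w \<bullet> v"
  by (simp add: op_dt_def D_def lift_dual_inner weak_deriv_mem(1))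

text \<open>The limit of a Cauchy sequence of pairs is again a function with its derivative, because
  the derivative is a closed operator; this places the limit in X, where closedness of S
  applies.\<close>

lemma complete_graph:
  assumes S: "S \<subseteq> X" "closed_in_X T j S"
  shows "complete ((\<lambda>w. (w, D w)) ` S)"
  unfolding complete_def
proof (intro allI impI, elim conjE)
  fix Z :: "nat \<Rightarrow> 'v l2 \<times> 'v l2"
  assume mem: "\<forall>n. Z n \<in> (\<lambda>w. (w, D w)) ` S" and C: "Cauchy Z"
  define w where "w n = fst (Z n)" for n
  have "\<exists>v\<in>S. Z n = (v, D v)" for n using mem by blast
  then have w: "w n \<in> S" "Z n = (w n, D (w n))" for n by (metis fst_conv w_def)+
  have "Cauchy (\<lambda>n. fst (Z n))" "Cauchy (\<lambda>n. snd (Z n))"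
    using C by (auto simp: Cauchy_fst Cauchy_snd)
  then obtain x d where lim: "(\<lambda>n. fst (Z n)) \<longlonglongrightarrow> x" "(\<lambda>n. snd (Z n)) \<longlonglongrightarrow> d"
    using complete_l2[where 'a = 'v] unfolding complete_def by (metis UNIV_I)
  have p: "derivative_pair x d"
    using lim w S weak_deriv_mem(2) by (intro derivative_pair_limit[of w x "\<lambda>n. D (w n)"]) auto
  then have xX: "x \<in> X" and d: "D x = d" using spaceX_iff D_eqI by auto
  have Zlim: "Z \<longlonglongrightarrow> (x, D x)"
    using tendsto_Pair[OF lim] by (simp add: d)
  have "x \<in> S"
  proof -
    have "\<exists>v\<in>S. normX T j (x - v) < e" if e: "0 < e" for e
    proof -
      obtain n where n: "norm (Z n - (x, D x)) < e"
        using LIMSEQ_D[OF Zlim e] by blast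
      have "w n \<in> X" using w S by blast
      then have "normX T j (x - w n) = norm (Z n - (x, D x))"
        using xX w(2)[of n] by (simp add: normX_eq X_diff D_diff norm_Pair norm_minus_commute)
      then show ?thesis using n w(1)[of n] by (intro bexI[of _ "w n"]) auto
    qed
    then show ?thesis using S(2) xX unfolding closed_in_X_def by blast
  qed
  then show "\<exists>l\<in>(\<lambda>w. (w, D w)) ` S. Z \<longlonglongrightarrow> l" using Zlim by blast
qed

section \<open>Traces and integration by parts in time\<close>

abbreviation "\<gamma> t w \<equiv> time_trace T j t w"

definition trC :: real where "trC = K\<^sup>2 / T + 1"

lemma trace_props:
  assumes w: "w \<in> X"
  shows "continuous_on {0..T} (\<lambda>t. \<gamma> t w)"
    "AE t in lebesgue. t \<in> {0<..<T} \<longrightarrow> \<gamma> t w = j (rep_l2 w t)"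
    "\<And>t. t \<in> {0..T} \<Longrightarrow> (norm (\<gamma> t w))\<^sup>2 \<le> trC * (norm (w, D w))\<^sup>2"
    "(norm (\<gamma> T w))\<^sup>2 - (norm (\<gamma> 0 w))\<^sup>2 = 2 * (D w \<bullet> w)"
proof -
  \<comment> \<open>The predicate under the choice in \<open>time_trace\<close>. The chosen function
    agrees on \<open>[0, T]\<close> with the c constructed here and inherits its bound and energy
    identity.\<close>
  define Q where "Q c \<longleftrightarrow> continuous_on {0..T} c \<and> (AE s in lebesgue_on {0<..<T}. c s = j (rep_l2 w s))" for c :: "real \<Rightarrow> 'h"
  have p: "derivative_pair w (D w)" by (rule weak_deriv_mem(2)[OF w])
  then have D: "D w \<in> Y" by (simp add: derivative_pair_def)
  have "(LINT t|lebesgue. deriv \<phi> t * (j (rep_l2 w t) \<bullet> j \<eta>)) = - (LINT t|lebesgue. \<phi> t * (rep_l2 (D w) t \<bullet> \<eta>))"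
    if \<phi>: "test_function T \<phi>" for \<phi> \<eta>
  proof -
    have "(LINT t|lebesgue. deriv \<phi> t * (j (rep_l2 w t) \<bullet> j \<eta>)) = w \<bullet> tens (deriv \<phi>) (G \<eta>)"
      by (simp add: inner_tens[OF test_function_deriv[OF \<phi>]] G_inner G_sym[symmetric])
    also have "\<dots> = - (D w \<bullet> tens \<phi> \<eta>)" using p \<phi> by (simp add: derivative_pair_def)
    finally show ?thesis by (simp add: inner_tens[OF \<phi>])
  qed
  from continuous_representative[OF T sq_integrable_rep sq_integrable_rep this]
  obtain c where c: "continuous_on {0..T} c" "AE t in lebesgue. t \<in> {0<..<T} \<longrightarrow> c t = j (rep_l2 w t)"
    and bound: "\<And>t. t \<in> {0..T} \<Longrightarrow> (norm (c t))\<^sup>2 \<le> trC * (LINT \<tau>|lebesgue. (norm (rep_l2 (D w) \<tau>))\<^sup>2 + (norm (rep_l2 w \<tau>))\<^sup>2)"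
    and energy: "(norm (c T))\<^sup>2 - (norm (c 0))\<^sup>2 = 2 * (LINT \<tau>:{0..T}|lebesgue. rep_l2 (D w) \<tau> \<bullet> rep_l2 w \<tau>)"
    unfolding trC_def by blast
  have "Q c" using c by (simp add: Q_def AE_lebesgue_on_Ioo)
  moreover have "(\<lambda>t. \<gamma> t w) = (SOME c. Q c)" by (simp add: fun_eq_iff time_trace_def Q_def[abs_def])
  ultimately have Q: "Q (\<lambda>t. \<gamma> t w)" using someI[of Q c] by simp
  then show 1: "continuous_on {0..T} (\<lambda>t. \<gamma> t w)"
    and 2: "AE t in lebesgue. t \<in> {0<..<T} \<longrightarrow> \<gamma> t w = j (rep_l2 w t)"
    by (auto simp: Q_def AE_lebesgue_on_Ioo)
  have "AE t in lebesgue. t \<in> {0<..<T} \<longrightarrow> \<gamma> t w = c t" using 2 c(2) by eventually_elim simp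
  then have eq: "\<gamma> t w = c t" if "t \<in> {0..T}" for t
    by (rule continuous_AE_eq_imp_eq[OF T 1 c(1) _ that])
  have "(LINT \<tau>|lebesgue. (norm (rep_l2 (D w) \<tau>))\<^sup>2 + (norm (rep_l2 w \<tau>))\<^sup>2) = (norm (w, D w))\<^sup>2"
    using sq_integrable_rep[of w] sq_integrable_rep[of "D w"] by (simp add: sq_integrable_def norm_Pair norm_l2)
  then show "(norm (\<gamma> t w))\<^sup>2 \<le> trC * (norm (w, D w))\<^sup>2" if "t \<in> {0..T}" for t
    using bound[OF that] eq[OF that] by simp
  have "(LINT \<tau>:{0..T}|lebesgue. rep_l2 (D w) \<tau> \<bullet> rep_l2 w \<tau>) = D w \<bullet> w"
    unfolding inner_l2 set_lebesgue_integral_def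
  proof (rule integral_cong_AE)
    show "AE t in lebesgue. indicator {0..T} t *\<^sub>R (rep_l2 (D w) t \<bullet> rep_l2 w t) = rep_l2 (D w) t \<bullet> rep_l2 w t"
      using D unfolding L2I_AE
    proof eventually_elim
      case (elim t)
      then show ?case by (cases "t \<in> {0<..<T}") auto
    qed
  qed measurable
  then show "(norm (\<gamma> T w))\<^sup>2 - (norm (\<gamma> 0 w))\<^sup>2 = 2 * (D w \<bullet> w)"
    using energy eq[of T] eq[of 0] T by simp
qed

lemma trace_eqI:
  assumes "w \<in> X" "continuous_on {0..T} c" "AE t in lebesgue. t \<in> {0<..<T} \<longrightarrow> c t = j (rep_l2 w t)" "t \<in> {0..T}"
  shows "\<gamma> t w = c t"
proof (rule continuous_AE_eq_imp_eq[OF T trace_props(1)[OF assms(1)] assms(2) _ assms(4)])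
  show "AE t in lebesgue. t \<in> {0<..<T} \<longrightarrow> \<gamma> t w = c t"
    using trace_props(2)[OF assms(1)] assms(3) by eventually_elim simp
qed

lemma trace_add:
  assumes "w \<in> X" "v \<in> X" "t \<in> {0..T}" shows "\<gamma> t (w + v) = \<gamma> t w + \<gamma> t v"
proof (rule trace_eqI)
  show "AE t in lebesgue. t \<in> {0<..<T} \<longrightarrow> \<gamma> t w + \<gamma> t v = j (rep_l2 (w + v) t)"
    using trace_props(2)[OF assms(1)] trace_props(2)[OF assms(2)] rep_plus_l2[of w v]
    by eventually_elim (simp add: J.add)
qed (use assms in \<open>auto intro!: continuous_intros trace_props X_add\<close>)

lemma trace_scale:
  assumes "w \<in> X" "t \<in> {0..T}" shows "\<gamma> t (r *\<^sub>R w) = r *\<^sub>R \<gamma> t w"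
proof (rule trace_eqI)
  show "AE t in lebesgue. t \<in> {0<..<T} \<longrightarrow> r *\<^sub>R \<gamma> t w = j (rep_l2 (r *\<^sub>R w) t)"
    using trace_props(2)[OF assms(1)] rep_scaleR_l2[of r w]
    by eventually_elim (simp add: J.scaleR)
qed (use assms in \<open>auto intro!: continuous_intros trace_props X_scale\<close>)

text \<open>Polarisation of the energy identity.\<close>

lemma integration_by_parts:
  assumes w: "w \<in> X" and v: "v \<in> X"
  shows "D w \<bullet> v + D v \<bullet> w = \<gamma> T w \<bullet> \<gamma> T v - \<gamma> 0 w \<bullet> \<gamma> 0 v"
proof -
  have t: "0 \<in> {0..T}" "T \<in> {0..T}" using T by auto
  have "2 * (D (w + v) \<bullet> (w + v)) = (norm (\<gamma> T (w + v)))\<^sup>2 - (norm (\<gamma> 0 (w + v)))\<^sup>2"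
    by (rule trace_props(4)[OF X_add[OF w v], symmetric])
  then show ?thesis
    using trace_props(4)[OF w] trace_props(4)[OF v]
    by (simp add: D_add[OF w v] trace_add[OF w v t(1)] trace_add[OF w v t(2)] power2_norm_eq_inner inner_add_left inner_add_right
      inner_commute[of "\<gamma> T v" "\<gamma> T w"] inner_commute[of "\<gamma> 0 v" "\<gamma> 0 w"])
qed

end

section \<open>The parabolic operator\<close>

text \<open>The pair of both functions takes finitely many values, and on each level set the
  arguments of the form are constant.\<close>

lemma borel_measurable_form_simple:
  fixes b :: "real \<Rightarrow> 'v::{real_inner,second_countable_topology} \<Rightarrow> 'v \<Rightarrow> real"
  assumes b: "\<And>\<eta> \<zeta>. (\<lambda>t. b t \<eta> \<zeta>) \<in> borel_measurable lebesgue"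
    and f: "simple_function lebesgue f" and g: "simple_function lebesgue g"
  shows "(\<lambda>t. b t (f t) (g t)) \<in> borel_measurable lebesgue"
proof -
  define h where "h t = (f t, g t)" for t
  have h: "simple_function lebesgue h"
    unfolding h_def using f g by (rule simple_function_Pair)
  then have fin: "finite (range h)" using simple_functionD(1)[OF h] by simp
  have "h \<in> measurable lebesgue (count_space (range h))"
    unfolding measurable_count_space_eq2[OF fin] using simple_functionD(2)[OF h] by auto
  from measurable_compose_countable'[OF _ this countable_finite[OF fin], of "\<lambda>p t. b t (fst p) (snd p)" borel]
  show ?thesis using b by (simp add: h_def)
qed

text \<open>A Caratheodory argument: the form is measurable in time and, for almost every time, continuous in
  its arguments.\<close>

lemma borel_measurable_form:
  fixes b :: "real \<Rightarrow> 'v::{real_inner,second_countable_topology} \<Rightarrow> 'v \<Rightarrow> real"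
  assumes b: "\<And>\<eta> \<zeta>. (\<lambda>t. b t \<eta> \<zeta>) \<in> borel_measurable lebesgue"
    and bil: "AE t in lebesgue. bilinear (b t)"
    and M: "AE t in lebesgue. \<forall>\<eta> \<zeta>. \<bar>b t \<eta> \<zeta>\<bar> \<le> M * norm \<eta> * norm \<zeta>"
    and f: "f \<in> borel_measurable lebesgue" and g: "g \<in> borel_measurable lebesgue"
  shows "(\<lambda>t. b t (f t) (g t)) \<in> borel_measurable lebesgue"
proof -
  obtain F where F: "\<And>i. simple_function lebesgue (F i)" "\<And>t. (\<lambda>i. F i t) \<longlonglongrightarrow> f t"
    using borel_measurable_implies_sequence_metric[OF f, of 0] by auto
  obtain H where H: "\<And>i. simple_function lebesgue (H i)" "\<And>t. (\<lambda>i. H i t) \<longlonglongrightarrow> g t"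
    using borel_measurable_implies_sequence_metric[OF g, of 0] by auto
  have "AE t in lebesgue. (\<lambda>i. b t (F i t) (H i t)) \<longlonglongrightarrow> b t (f t) (g t)"
    using bil M
  proof eventually_elim
    case (elim t)
    have "bounded_bilinear (b t)"
    proof
      show "\<exists>K. \<forall>a c. norm (b t a c) \<le> norm a * norm c * K"
        using elim(2) by (intro exI[of _ M]) (simp add: mult_ac)
    qed (use elim(1) in \<open>auto simp: bilinear_ladd bilinear_radd bilinear_lmul bilinear_rmul\<close>)
    then show ?case by (rule bounded_bilinear.tendsto[OF _ F(2) H(2)])
  qed
  \<comment> \<open>The limit may fail on a null set; multiplying by the indicator of its complement
    gives convergence everywhere.\<close>
  then obtain N where N: "{t. \<not> (\<lambda>i. b t (F i t) (H i t)) \<longlonglongrightarrow> b t (f t) (g t)} \<subseteq> N" "N \<in> null_sets lebesgue"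
    by (auto simp: eventually_ae_filter)
  have Nm: "N \<in> sets lebesgue" using N(2) by auto
  have "(\<lambda>t. indicator (- N) t * b t (f t) (g t)) \<in> borel_measurable lebesgue"
  proof (rule borel_measurable_LIMSEQ_metric)
    have "(\<lambda>t. b t (F i t) (H i t)) \<in> borel_measurable lebesgue" for i
      by (rule borel_measurable_form_simple[OF b F(1) H(1)])
    then show "(\<lambda>t. indicator (- N) t * b t (F i t) (H i t)) \<in> borel_measurable lebesgue" for i
      using Nm by (intro borel_measurable_times borel_measurable_indicator) (auto simp: Compl_in_sets_lebesgue)
    show "(\<lambda>i. indicator (- N) t * b t (F i t) (H i t)) \<longlonglongrightarrow> indicator (- N) t * b t (f t) (g t)" for t
      using N(1) by (cases "t \<in> N") auto
  qed
  then show ?thesis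
  proof (rule borel_measurable_lebesgue_AE_cong)
    have "AE t in lebesgue. t \<notin> N" using N(2) by (rule AE_not_in)
    then show "AE t in lebesgue. indicator (- N) t * b t (f t) (g t) = b t (f t) (g t)"
      by eventually_elim simp
  qed
qed

locale parabolic = gelfand_triple_interval j T
  for j :: "'v::{real_inner,complete_space,second_countable_topology} \<Rightarrow>
              'h::{real_inner,complete_space,second_countable_topology}" and T +
  fixes a :: "real \<Rightarrow> 'v \<Rightarrow> 'v \<Rightarrow> real"
  assumes a: "admissible_form T a"
begin

text \<open>Extended by zero, the form is bilinear and bounded at almost every real time, so that
  its integrals run over the whole line like those of \<open>l2\<close>.\<close>

definition aI :: "real \<Rightarrow> 'v \<Rightarrow> 'v \<Rightarrow> real" where
  "aI t \<eta> \<zeta> = indicator {0<..<T} t * a t \<eta> \<zeta>"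

definition A :: "'v l2 \<Rightarrow> 'v l2 \<Rightarrow> real" where
  "A w v = (LINT t|lebesgue. aI t (rep_l2 w t) (rep_l2 v t))"

definition As :: "'v l2 \<Rightarrow> 'v l2 \<Rightarrow> real" where
  "As w v = (A w v + A v w) / 2"

lemma aI_bilinear: "AE t in lebesgue. bilinear (aI t)"
proof -
  have "AE t in lebesgue. t \<in> {0<..<T} \<longrightarrow> bilinear (a t)"
    using a by (simp add: admissible_form_def AE_lebesgue_on_Ioo)
  then show ?thesis
  proof eventually_elim
    case (elim t)
    have "aI t = (if t \<in> {0<..<T} then a t else (\<lambda>_ _. 0))" by (auto simp: aI_def fun_eq_iff)
    moreover have "bilinear (\<lambda>_ _. 0 :: real)" by (simp add: bilinear_def linear_iff)
    ultimately show ?case using elim by auto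
  qed
qed

lemma aI_bounded: "\<exists>M\<ge>0. AE t in lebesgue. \<forall>\<eta> \<zeta>. \<bar>aI t \<eta> \<zeta>\<bar> \<le> M * norm \<eta> * norm \<zeta>"
proof -
  obtain M where "AE t in lebesgue. t \<in> {0<..<T} \<longrightarrow> (\<forall>\<eta> \<zeta>. \<bar>a t \<eta> \<zeta>\<bar> \<le> M * norm \<eta> * norm \<zeta>)"
    using a by (auto simp: admissible_form_def AE_lebesgue_on_Ioo)
  then have "AE t in lebesgue. \<forall>\<eta> \<zeta>. \<bar>aI t \<eta> \<zeta>\<bar> \<le> \<bar>M\<bar> * norm \<eta> * norm \<zeta>"
  proof eventually_elim
    case (elim t)
    show ?case
    proof (intro allI)
      fix \<eta> \<zeta> :: 'v
      have "M * norm \<eta> * norm \<zeta> \<le> \<bar>M\<bar> * norm \<eta> * norm \<zeta>" by (intro mult_right_mono) auto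
      moreover have "0 \<le> \<bar>M\<bar> * norm \<eta> * norm \<zeta>" by simp
      ultimately show "\<bar>aI t \<eta> \<zeta>\<bar> \<le> \<bar>M\<bar> * norm \<eta> * norm \<zeta>"
        using elim by (cases "t \<in> {0<..<T}") (auto simp: aI_def intro: order_trans)
    qed
  qed
  then show ?thesis by (intro exI[of _ "\<bar>M\<bar>"]) auto
qed

definition M :: real where
  "M = (SOME M. 0 \<le> M \<and> (AE t in lebesgue. \<forall>\<eta> \<zeta>. \<bar>aI t \<eta> \<zeta>\<bar> \<le> M * norm \<eta> * norm \<zeta>))"

lemma M: "0 \<le> M" "AE t in lebesgue. \<forall>\<eta> \<zeta>. \<bar>aI t \<eta> \<zeta>\<bar> \<le> M * norm \<eta> * norm \<zeta>"
proof -
  have "\<exists>M. 0 \<le> M \<and> (AE t in lebesgue. \<forall>\<eta> \<zeta>. \<bar>aI t \<eta> \<zeta>\<bar> \<le> M * norm \<eta> * norm \<zeta>)"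
    using aI_bounded by blast
  from someI_ex[OF this] show "0 \<le> M" "AE t in lebesgue. \<forall>\<eta> \<zeta>. \<bar>aI t \<eta> \<zeta>\<bar> \<le> M * norm \<eta> * norm \<zeta>"
    unfolding M_def by auto
qed

lemma aI_measurable:
  "f \<in> borel_measurable lebesgue \<Longrightarrow> g \<in> borel_measurable lebesgue \<Longrightarrow>
    (\<lambda>t. aI t (f t) (g t)) \<in> borel_measurable lebesgue"
proof (rule borel_measurable_form[OF _ aI_bilinear M(2)])
  fix \<eta> \<zeta> :: 'v
  have "(\<lambda>t. a t \<eta> \<zeta>) \<in> borel_measurable (lebesgue_on {0<..<T})" using a by (simp add: admissible_form_def)
  then show "(\<lambda>t. aI t \<eta> \<zeta>) \<in> borel_measurable lebesgue"
    by (simp add: aI_def borel_measurable_restrict_space_iff)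
qed

text \<open>Cauchy-Schwarz in the scalar space, applied to the pointwise norms of w and v.\<close>

lemma L2_norm_product:
  "integrable lebesgue (\<lambda>t. norm (rep_l2 w t) * norm (rep_l2 v t))"
  "(LINT t|lebesgue. norm (rep_l2 (w :: 'v l2) t) * norm (rep_l2 (v :: 'v l2) t)) \<le> norm w * norm v"
proof -
  have sq: "sq_integrable (\<lambda>t. norm (rep_l2 x t))" for x :: "'v l2"
    using sq_integrable_rep[of x] by (simp add: sq_integrable_def)
  have n: "norm (abs_l2 (\<lambda>t. norm (rep_l2 x t))) = norm x" for x :: "'v l2"
  proof (rule power2_eq_imp_eq)
    show "(norm (abs_l2 (\<lambda>t. norm (rep_l2 x t))))\<^sup>2 = (norm x)\<^sup>2"
      unfolding norm_abs_l2[OF sq] norm_l2[of x] by simp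
  qed simp_all
  show "integrable lebesgue (\<lambda>t. norm (rep_l2 w t) * norm (rep_l2 v t))"
    using sq_integrable_inner[OF sq[of w] sq[of v]] by simp
  have "(LINT t|lebesgue. norm (rep_l2 w t) * norm (rep_l2 v t)) =
    abs_l2 (\<lambda>t. norm (rep_l2 w t)) \<bullet> abs_l2 (\<lambda>t. norm (rep_l2 v t))"
    unfolding inner_abs_l2[OF sq] using rep_abs_l2[OF sq[of w]]
    by (intro integral_cong_AE) auto
  also have "\<dots> \<le> norm w * norm v" unfolding n[symmetric] by (rule norm_cauchy_schwarz)
  finally show "(LINT t|lebesgue. norm (rep_l2 w t) * norm (rep_l2 v t)) \<le> norm w * norm v" .
qed

lemma aI_integrable: "integrable lebesgue (\<lambda>t. aI t (rep_l2 w t) (rep_l2 v t))"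
proof (rule Bochner_Integration.integrable_bound)
  show "integrable lebesgue (\<lambda>t. M * (norm (rep_l2 w t) * norm (rep_l2 v t)))"
    by (intro integrable_mult_right L2_norm_product(1))
  show "(\<lambda>t. aI t (rep_l2 w t) (rep_l2 v t)) \<in> borel_measurable lebesgue"
    by (intro aI_measurable rep_measurable)
  show "AE t in lebesgue. norm (aI t (rep_l2 w t) (rep_l2 v t)) \<le> norm (M * (norm (rep_l2 w t) * norm (rep_l2 v t)))"
    using M(2) by eventually_elim (use M(1) in \<open>simp add: abs_mult mult.assoc\<close>)
qed

lemma A_addL: "A (w + w') v = A w v + A w' v"
proof -
  have "A (w + w') v = (LINT t|lebesgue. aI t (rep_l2 w t) (rep_l2 v t) + aI t (rep_l2 w' t) (rep_l2 v t))"
    unfolding A_def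
  proof (rule integral_cong_AE)
    show "AE t in lebesgue. aI t (rep_l2 (w + w') t) (rep_l2 v t) = aI t (rep_l2 w t) (rep_l2 v t) + aI t (rep_l2 w' t) (rep_l2 v t)"
      using aI_bilinear rep_plus_l2[of w w'] by eventually_elim (simp add: bilinear_ladd)
  qed (intro borel_measurable_add aI_measurable rep_measurable)+
  then show ?thesis by (simp add: A_def aI_integrable)
qed

lemma A_addR: "A v (w + w') = A v w + A v w'"
proof -
  have "A v (w + w') = (LINT t|lebesgue. aI t (rep_l2 v t) (rep_l2 w t) + aI t (rep_l2 v t) (rep_l2 w' t))"
    unfolding A_def
  proof (rule integral_cong_AE)
    show "AE t in lebesgue. aI t (rep_l2 v t) (rep_l2 (w + w') t) = aI t (rep_l2 v t) (rep_l2 w t) + aI t (rep_l2 v t) (rep_l2 w' t)"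
      using aI_bilinear rep_plus_l2[of w w'] by eventually_elim (simp add: bilinear_radd)
  qed (intro borel_measurable_add aI_measurable rep_measurable)+
  then show ?thesis by (simp add: A_def aI_integrable)
qed

lemma A_scaleL: "A (r *\<^sub>R w) v = r * A w v"
proof -
  have "A (r *\<^sub>R w) v = (LINT t|lebesgue. r * aI t (rep_l2 w t) (rep_l2 v t))"
    unfolding A_def
  proof (rule integral_cong_AE)
    show "AE t in lebesgue. aI t (rep_l2 (r *\<^sub>R w) t) (rep_l2 v t) = r * aI t (rep_l2 w t) (rep_l2 v t)"
      using aI_bilinear rep_scaleR_l2[of r w] by eventually_elim (simp add: bilinear_lmul)
  qed (intro borel_measurable_times borel_measurable_const aI_measurable rep_measurable)+
  then show ?thesis by (simp add: A_def)
qed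

lemma A_scaleR: "A v (r *\<^sub>R w) = r * A v w"
proof -
  have "A v (r *\<^sub>R w) = (LINT t|lebesgue. r * aI t (rep_l2 v t) (rep_l2 w t))"
    unfolding A_def
  proof (rule integral_cong_AE)
    show "AE t in lebesgue. aI t (rep_l2 v t) (rep_l2 (r *\<^sub>R w) t) = r * aI t (rep_l2 v t) (rep_l2 w t)"
      using aI_bilinear rep_scaleR_l2[of r w] by eventually_elim (simp add: bilinear_rmul)
  qed (intro borel_measurable_times borel_measurable_const aI_measurable rep_measurable)+
  then show ?thesis by (simp add: A_def)
qed

lemma A_bounded: "\<bar>A w v\<bar> \<le> M * (norm w * norm v)"
proof -
  have "\<bar>A w v\<bar> \<le> (LINT t|lebesgue. norm (aI t (rep_l2 w t) (rep_l2 v t)))"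
    unfolding A_def using integral_norm_bound[of lebesgue "\<lambda>t. aI t (rep_l2 w t) (rep_l2 v t)"] by simp
  also have "\<dots> \<le> (LINT t|lebesgue. M * (norm (rep_l2 w t) * norm (rep_l2 v t)))"
  proof (rule integral_mono_AE)
    show "AE t in lebesgue. norm (aI t (rep_l2 w t) (rep_l2 v t)) \<le> M * (norm (rep_l2 w t) * norm (rep_l2 v t))"
      using M(2) by eventually_elim (simp add: mult.assoc)
  qed (auto intro: aI_integrable integrable_norm L2_norm_product)
  also have "\<dots> \<le> M * (norm w * norm v)"
    using mult_left_mono[OF L2_norm_product(2) M(1)] by simp
  finally show ?thesis .
qed

lemma A_coercive: "\<exists>\<alpha>>0. \<forall>w\<in>Y. \<alpha> * (norm w)\<^sup>2 \<le> A w w"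
proof -
  obtain \<alpha> where \<alpha>: "0 < \<alpha>" and c: "AE t in lebesgue. t \<in> {0<..<T} \<longrightarrow> (\<forall>\<eta>. a t \<eta> \<eta> \<ge> \<alpha> * (norm \<eta>)\<^sup>2)"
    using a by (auto simp: admissible_form_def AE_lebesgue_on_Ioo)
  have "\<alpha> * (norm w)\<^sup>2 \<le> A w w" if w: "w \<in> Y" for w
  proof -
    have "\<alpha> * (norm w)\<^sup>2 = (LINT t|lebesgue. \<alpha> * (norm (rep_l2 w t))\<^sup>2)" by (simp add: norm_l2)
    also have "\<dots> \<le> A w w" unfolding A_def
    proof (rule integral_mono_AE)
      show "integrable lebesgue (\<lambda>t. \<alpha> * (norm (rep_l2 w t))\<^sup>2)"
        using sq_integrable_rep[of w] by (simp add: sq_integrable_def)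
      show "AE t in lebesgue. \<alpha> * (norm (rep_l2 w t))\<^sup>2 \<le> aI t (rep_l2 w t) (rep_l2 w t)"
        using c w unfolding L2I_AE
      proof eventually_elim
        case (elim t)
        then show ?case by (cases "t \<in> {0<..<T}") (auto simp: aI_def)
      qed
    qed (rule aI_integrable)
    finally show ?thesis .
  qed
  then show ?thesis using \<alpha> by blast
qed

definition \<alpha> :: real where "\<alpha> = (SOME \<alpha>. 0 < \<alpha> \<and> (\<forall>w\<in>Y. \<alpha> * (norm w)\<^sup>2 \<le> A w w))"

lemma \<alpha>: "0 < \<alpha>" "w \<in> Y \<Longrightarrow> \<alpha> * (norm w)\<^sup>2 \<le> A w w"
proof -
  have "\<exists>\<alpha>. 0 < \<alpha> \<and> (\<forall>w\<in>Y. \<alpha> * (norm w)\<^sup>2 \<le> A w w)" using A_coercive by blast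
  from someI_ex[OF this] show "0 < \<alpha>" "w \<in> Y \<Longrightarrow> \<alpha> * (norm w)\<^sup>2 \<le> A w w"
    unfolding \<alpha>_def by auto
qed

lemma opA_eq: "v \<in> Y \<Longrightarrow> opA T a w v = A w v"
  by (simp add: opA_def A_def aI_def integral_lebesgue_on_Ioo)

lemma opAs_eq: "w \<in> Y \<Longrightarrow> v \<in> Y \<Longrightarrow> opAs T a w v = As w v"
  by (simp add: opAs_def opA_adj_def opA_eq As_def)

text \<open>Not cut off outside Y, so that linearity in w can be stated as an equation between
  functions of v; it agrees with \<open>opB\<close> for w in X and v in Y.\<close>

definition B :: "'v l2 \<Rightarrow> 'v l2 \<Rightarrow> real" where "B w v = D w \<bullet> v + A w v"

definition C :: "'v l2 \<Rightarrow> 'v l2 \<Rightarrow> real" where "C w v = B w v - As w v"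

lemma opB_eq: "w \<in> X \<Longrightarrow> v \<in> Y \<Longrightarrow> opB T j a w v = B w v"
  by (simp add: opB_def B_def op_dt_eq opA_eq)

lemma opC_eq: "w \<in> X \<Longrightarrow> v \<in> Y \<Longrightarrow> opC T j a w v = C w v"
  by (simp add: opC_def C_def opB_eq opAs_eq X_subset_Y)

lemma normY_eq: "v \<in> Y \<Longrightarrow> normY T a v = sqrt (As v v)"
  by (simp add: normY_def opAs_eq)

sublocale As: psd_form Y As
proof
  show "subspace Y" by (rule subspace_L2I)
  show "bilinear_on Y As"
    by (auto simp: bilinear_on_def As_def A_addL A_addR A_scaleL A_scaleR algebra_simps add_divide_distrib)
  show "As x y = As y x" for x y by (simp add: As_def)
  show "0 \<le> As x x" if "x \<in> Y" for x
    using \<alpha>(2)[OF that] \<alpha>(1) by (simp add: As_def) (meson less_imp_le mult_nonneg_nonneg order_trans zero_le_power2)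
qed

lemma As_coercive: "w \<in> Y \<Longrightarrow> \<alpha> * (norm w)\<^sup>2 \<le> As w w"
  using \<alpha>(2) by (simp add: As_def)

lemma As_bounded: "As w w \<le> M * (norm w)\<^sup>2"
  using A_bounded[of w w] by (simp add: As_def power2_eq_square)

end

section \<open>The energy norm\<close>

text \<open>Membership in \<open>dual\<close> without extensionality, so that one and the same
  function can act on Y and on its subspaces.\<close>

definition functional :: "'a::real_normed_vector set \<Rightarrow> ('a \<Rightarrow> real) \<Rightarrow> bool" where
  "functional S f \<longleftrightarrow> (\<forall>x\<in>S. \<forall>y\<in>S. f (x + y) = f x + f y) \<and> (\<forall>c. \<forall>x\<in>S. f (c *\<^sub>R x) = c * f x) \<and>
     (\<exists>M. \<forall>x\<in>S. \<bar>f x\<bar> \<le> M * norm x)"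

lemma functional_restrict: "subspace S \<Longrightarrow> functional S f \<Longrightarrow> restrict f S \<in> dual S"
  by (auto simp: dual_def functional_def subspace_add subspace_scale)

lemma functional_subset: "functional S f \<Longrightarrow> S' \<subseteq> S \<Longrightarrow> functional S' f"
  unfolding functional_def by (meson subsetD)

lemma functional_add:
  assumes "functional S f" "functional S h" shows "functional S (\<lambda>v. f v + h v)"
proof -
  obtain M M' where "\<And>x. x \<in> S \<Longrightarrow> \<bar>f x\<bar> \<le> M * norm x" "\<And>x. x \<in> S \<Longrightarrow> \<bar>h x\<bar> \<le> M' * norm x"
    using assms unfolding functional_def by blast
  then have "\<forall>x\<in>S. \<bar>f x + h x\<bar> \<le> (M + M') * norm x"
    by (fastforce simp: distrib_right intro: order_trans[OF abs_triangle_ineq add_mono])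
  then show ?thesis using assms unfolding functional_def by (auto simp: distrib_left)
qed

lemma functional_scale:
  assumes "functional S f" shows "functional S (\<lambda>v. r * f v)"
proof -
  obtain M where "\<And>x. x \<in> S \<Longrightarrow> \<bar>f x\<bar> \<le> M * norm x" using assms unfolding functional_def by blast
  then have "\<forall>x\<in>S. \<bar>r * f x\<bar> \<le> (\<bar>r\<bar> * M) * norm x"
    by (auto simp: abs_mult mult.assoc intro: mult_left_mono)
  then show ?thesis using assms unfolding functional_def by (auto simp: distrib_left)
qed

section \<open>Riesz representatives and dual norms on closed subspaces of Y\<close>

context parabolic begin

abbreviation "\<rho> \<equiv> discrete_riesz T a"

definition closed_sub :: "'v l2 set \<Rightarrow> bool" where
  "closed_sub S \<longleftrightarrow> S \<subseteq> Y \<and> subspace S \<and> closed S"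

lemma closed_sub_Y: "closed_sub Y"
  by (simp add: closed_sub_def subspace_L2I closed_L2I)

lemma psd_form_subset: "closed_sub S \<Longrightarrow> psd_form S As"
  using As.bilin As.sym As.nonneg
  by unfold_locales (auto simp: closed_sub_def bilinear_on_def subset_iff)

lemma riesz_ex1:
  assumes S: "closed_sub S" and f: "functional S f"
  shows "\<exists>!z. z \<in> S \<and> (\<forall>v\<in>S. As z v = f v)"
proof -
  obtain L where L: "\<And>x. x \<in> S \<Longrightarrow> \<bar>f x\<bar> \<le> L * norm x" using f unfolding functional_def by blast
  show ?thesis
  proof (rule riesz_form[where c = \<alpha> and C = M and M = L])
    show "psd_form S As" by (rule psd_form_subset[OF S])
    show "complete S" using S by (intro complete_closed_l2) (simp add: closed_sub_def)
    show "\<alpha> * (norm x)\<^sup>2 \<le> As x x" if "x \<in> S" for x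
      using As_coercive S that by (auto simp: closed_sub_def)
  qed (use \<alpha>(1) As_bounded f L in \<open>auto simp: functional_def\<close>)
qed

lemma \<rho>_eq_The:
  assumes "closed_sub S"
  shows "\<rho> S f = (THE z. z \<in> S \<and> (\<forall>v\<in>S. As z v = f v))"
  unfolding discrete_riesz_def using assms
  by (intro arg_cong[where f = The] ext conj_cong ball_cong refl) (auto simp: closed_sub_def opAs_eq subset_iff)

lemma \<rho>_props:
  assumes S: "closed_sub S" and f: "functional S f"
  shows "\<rho> S f \<in> S" "\<And>v. v \<in> S \<Longrightarrow> As (\<rho> S f) v = f v"
  using theI'[OF riesz_ex1[OF S f]] unfolding \<rho>_eq_The[OF S] by auto

lemma \<rho>_eqI:
  assumes S: "closed_sub S" and f: "functional S f" and z: "z \<in> S" "\<And>v. v \<in> S \<Longrightarrow> As z v = f v"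
  shows "\<rho> S f = z"
  unfolding \<rho>_eq_The[OF S] using z by (intro the1_equality[OF riesz_ex1[OF S f]]) auto

lemma \<rho>_cong: "(\<And>v. v \<in> S \<Longrightarrow> f v = h v) \<Longrightarrow> \<rho> S f = \<rho> S h"
  unfolding discrete_riesz_def by (intro arg_cong[where f = The] ext conj_cong ball_cong refl) auto

lemma \<rho>_add:
  assumes S: "closed_sub S" and f: "functional S f" "functional S h"
  shows "\<rho> S (\<lambda>v. f v + h v) = \<rho> S f + \<rho> S h"
proof -
  interpret s: psd_form S As by (rule psd_form_subset[OF S])
  show ?thesis
    using \<rho>_props[OF S f(1)] \<rho>_props[OF S f(2)]
    by (intro \<rho>_eqI[OF S functional_add[OF f]]) (auto simp: s.addL)
qed

lemma \<rho>_scale: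
  assumes S: "closed_sub S" and f: "functional S f"
  shows "\<rho> S (\<lambda>v. r * f v) = r *\<^sub>R \<rho> S f"
proof -
  interpret s: psd_form S As by (rule psd_form_subset[OF S])
  show ?thesis
    using \<rho>_props[OF S f] by (intro \<rho>_eqI[OF S functional_scale[OF f]]) (auto simp: s.scaleL)
qed

text \<open>The value of f at its representative on S can also be expressed by the representative on
  Y, and Cauchy-Schwarz concludes. This is monotonicity of dual norms under restriction.\<close>

lemma \<rho>_subspace_le:
  assumes S: "closed_sub S" and f: "functional Y f"
  shows "As (\<rho> S f) (\<rho> S f) \<le> As (\<rho> Y f) (\<rho> Y f)"
proof -
  have sub: "S \<subseteq> Y" using S by (simp add: closed_sub_def)
  let ?s = "\<rho> S f" and ?y = "\<rho> Y f"
  have s: "?s \<in> S" "\<And>v. v \<in> S \<Longrightarrow> As ?s v = f v"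
    using \<rho>_props[OF S functional_subset[OF f sub]] by auto
  have y: "?y \<in> Y" "\<And>v. v \<in> Y \<Longrightarrow> As ?y v = f v"
    using \<rho>_props[OF closed_sub_Y f] by auto
  have sY: "?s \<in> Y" using s(1) sub by blast
  have "(As ?s ?s)\<^sup>2 = (As ?y ?s)\<^sup>2" using s y sY by simp
  also have "\<dots> \<le> As ?y ?y * As ?s ?s" by (rule As.Cauchy_Schwarz[OF y(1) sY])
  finally have "As ?s ?s * As ?s ?s \<le> As ?y ?y * As ?s ?s" by (simp add: power2_eq_square)
  then show ?thesis
    using As.nonneg[OF sY] As.nonneg[OF y(1)] by (cases "As ?s ?s = 0") (auto simp: mult_le_cancel_right)
qed

text \<open>Cauchy-Schwarz bounds every quotient, and the Riesz representative attains the bound; if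
  it is 0, any nonzero element of S attains it.\<close>

lemma dual_norm_eq:
  assumes S: "closed_sub S" "S \<noteq> {0}" and f: "functional S f" and F: "\<And>v. v \<in> S \<Longrightarrow> F v = f v"
  shows "dual_norm T a S F = sqrt (As (\<rho> S f) (\<rho> S f))"
proof -
  interpret s: psd_form S As by (rule psd_form_subset[OF S(1)])
  let ?z = "\<rho> S f"
  have sub: "S \<subseteq> Y" using S by (simp add: closed_sub_def)
  have z: "?z \<in> S" "\<And>v. v \<in> S \<Longrightarrow> As ?z v = f v" using \<rho>_props[OF S(1) f] by auto
  have pos: "0 < As v v" if "v \<in> S" "v \<noteq> 0" for v
  proof -
    have "0 < \<alpha> * (norm v)\<^sup>2" using that \<alpha>(1) by simp
    then show ?thesis using As_coercive[of v] that sub by force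
  qed
  have val: "\<bar>F v\<bar> / normY T a v = \<bar>As ?z v\<bar> / sqrt (As v v)" if "v \<in> S" for v
    using that z(2) F sub by (auto simp: normY_eq subset_iff)
  have le: "\<bar>As ?z v\<bar> / sqrt (As v v) \<le> sqrt (As ?z ?z)" if "v \<in> S - {0}" for v
    using s.Cauchy_Schwarz_sqrt[OF z(1), of v] pos[of v] that by (simp add: pos_divide_le_eq)
  have ex: "\<exists>v\<in>S - {0}. \<bar>As ?z v\<bar> / sqrt (As v v) = sqrt (As ?z ?z)"
  proof (cases "?z = 0")
    case True
    obtain v where "v \<in> S" "v \<noteq> 0" using S(2) s.zero_closed by blast
    then show ?thesis using True by (intro bexI[of _ v]) auto
  next
    case False
    then show ?thesis using z(1) pos[OF z(1)]
      by (intro bexI[of _ ?z]) (auto simp: real_div_sqrt)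
  qed
  show ?thesis unfolding dual_norm_def
  proof (rule cSup_eq_maximum)
    show "sqrt (As ?z ?z) \<in> (\<lambda>v. \<bar>F v\<bar> / normY T a v) ` (S - {0})"
      using ex val by (auto simp: image_iff intro: sym)
    show "x \<le> sqrt (As ?z ?z)" if "x \<in> (\<lambda>v. \<bar>F v\<bar> / normY T a v) ` (S - {0})" for x
      using that le val by auto
  qed
qed

lemma functional_As: "w \<in> Y \<Longrightarrow> functional Y (As w)"
  unfolding functional_def
proof (intro conjI ballI allI)
  have "\<bar>As w v\<bar> \<le> (M * norm w) * norm v" for v
    using A_bounded[of w v] A_bounded[of v w] unfolding As_def by (simp add: abs_le_iff mult_ac)
  then show "\<exists>M. \<forall>v\<in>Y. \<bar>As w v\<bar> \<le> M * norm v" by blast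
qed (auto simp: As.addR As.scaleR)

lemma functional_B: "functional Y (B w)"
  unfolding functional_def
proof (intro conjI ballI allI)
  have "\<bar>B w v\<bar> \<le> (norm (D w) + M * norm w) * norm v" for v
    using Cauchy_Schwarz_ineq2[of "D w" v] A_bounded[of w v] abs_triangle_ineq[of "D w \<bullet> v" "A w v"]
    by (simp add: B_def algebra_simps)
  then show "\<exists>M. \<forall>v\<in>Y. \<bar>B w v\<bar> \<le> M * norm v" by blast
qed (auto simp: B_def inner_add_right A_addR A_scaleR distrib_left)

lemma functional_C: "w \<in> Y \<Longrightarrow> functional Y (C w)"
  unfolding C_def
  using functional_add[OF functional_B functional_scale[OF functional_As], of w w "-1"] by simp

lemma B_add: "w \<in> X \<Longrightarrow> w' \<in> X \<Longrightarrow> B (w + w') = (\<lambda>v. B w v + B w' v)"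
  by (auto simp: B_def D_add A_addL inner_add_left)

lemma B_scale: "w \<in> X \<Longrightarrow> B (r *\<^sub>R w) = (\<lambda>v. r * B w v)"
  by (auto simp: B_def D_scale A_scaleL distrib_left)

lemma C_add: "w \<in> X \<Longrightarrow> w' \<in> X \<Longrightarrow> C (w + w') = (\<lambda>v. C w v + C w' v)"
  by (auto simp: C_def B_add As_def A_addL A_addR add_divide_distrib)

lemma C_scale: "w \<in> X \<Longrightarrow> C (r *\<^sub>R w) = (\<lambda>v. r * C w v)"
  by (auto simp: C_def B_scale As_def A_scaleL A_scaleR algebra_simps)

text \<open>With Riesz representatives in place of functionals, dual norms become
  \<open>As\<close>-norms of vectors depending linearly on w, on Y and on discrete test spaces
  alike.\<close>

definition b :: "'v l2 set \<Rightarrow> 'v l2 \<Rightarrow> 'v l2" where "b S w = \<rho> S (B w)"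
definition c :: "'v l2 set \<Rightarrow> 'v l2 \<Rightarrow> 'v l2" where "c S w = \<rho> S (C w)"

lemma functional_B_sub: "closed_sub S \<Longrightarrow> functional S (B w)"
  by (rule functional_subset[OF functional_B]) (simp add: closed_sub_def)

lemma functional_C_sub: "closed_sub S \<Longrightarrow> w \<in> X \<Longrightarrow> functional S (C w)"
  by (rule functional_subset[OF functional_C[OF X_subset_Y]]) (simp_all add: closed_sub_def)

lemma b_props: "closed_sub S \<Longrightarrow> b S w \<in> S" "closed_sub S \<Longrightarrow> v \<in> S \<Longrightarrow> As (b S w) v = B w v"
  unfolding b_def using \<rho>_props functional_B_sub by blast+

lemma c_props: "closed_sub S \<Longrightarrow> w \<in> X \<Longrightarrow> c S w \<in> S" "closed_sub S \<Longrightarrow> w \<in> X \<Longrightarrow> v \<in> S \<Longrightarrow> As (c S w) v = C w v"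
  unfolding c_def using \<rho>_props functional_C_sub by blast+

lemma b_mem_Y: "closed_sub S \<Longrightarrow> b S w \<in> Y" and c_mem_Y: "closed_sub S \<Longrightarrow> w \<in> X \<Longrightarrow> c S w \<in> Y"
  using b_props(1)[of S w] c_props(1)[of S w] unfolding closed_sub_def by blast+

lemma b_add: "closed_sub S \<Longrightarrow> w \<in> X \<Longrightarrow> w' \<in> X \<Longrightarrow> b S (w + w') = b S w + b S w'"
  by (simp add: b_def B_add \<rho>_add functional_B_sub)

lemma b_scale: "closed_sub S \<Longrightarrow> w \<in> X \<Longrightarrow> b S (r *\<^sub>R w) = r *\<^sub>R b S w"
  by (simp add: b_def B_scale \<rho>_scale functional_B_sub)

lemma c_add: "closed_sub S \<Longrightarrow> w \<in> X \<Longrightarrow> w' \<in> X \<Longrightarrow> c S (w + w') = c S w + c S w'"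
  by (simp add: c_def C_add \<rho>_add functional_C_sub)

lemma c_scale: "closed_sub S \<Longrightarrow> w \<in> X \<Longrightarrow> c S (r *\<^sub>R w) = r *\<^sub>R c S w"
  by (simp add: c_def C_scale \<rho>_scale functional_C_sub)

text \<open>An element w of S is its own Riesz representative of \<open>As w\<close>, so the
  splitting of B persists on test spaces that contain w.\<close>

lemma b_eq_c_add:
  assumes S: "closed_sub S" and w: "w \<in> X" "w \<in> S"
  shows "b S w = c S w + w"
proof -
  interpret s: psd_form S As by (rule psd_form_subset[OF S])
  show ?thesis unfolding b_def
    using c_props[OF S w(1)] w(2) by (intro \<rho>_eqI[OF S functional_B_sub[OF S]]) (auto simp: s.addL C_def)
qed

text \<open>A minus its symmetric part is antisymmetric and cancels; the time derivatives integrate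
  to boundary terms.\<close>

lemma C_symmetric_part:
  assumes w: "w \<in> X" and v: "v \<in> X"
  shows "C w v + C v w = \<gamma> T w \<bullet> \<gamma> T v - \<gamma> 0 w \<bullet> \<gamma> 0 v"
  using integration_by_parts[OF w v] by (simp add: C_def B_def As_def field_simps)

text \<open>The mixed term is twice \<open>As (c S w) w = C w w\<close>, which consists of boundary
  terms only.\<close>

lemma b_square:
  assumes S: "closed_sub S" and w: "w \<in> X" "w \<in> S"
  shows "As (b S w) (b S w) + (norm (\<gamma> 0 w))\<^sup>2 = As (c S w) (c S w) + As w w + (norm (\<gamma> T w))\<^sup>2"
proof -
  interpret s: psd_form S As by (rule psd_form_subset[OF S])
  have "As (b S w) (b S w) = As (c S w) (c S w) + 2 * C w w + As w w"
    using c_props[OF S w(1)] w by (simp add: b_eq_c_add[OF S w] s.square_add)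
  moreover have "2 * C w w = (norm (\<gamma> T w))\<^sup>2 - (norm (\<gamma> 0 w))\<^sup>2"
    using C_symmetric_part[OF w(1) w(1)] by (simp add: power2_norm_eq_inner)
  ultimately show ?thesis by simp
qed

lemma zero_T_mem: "0 \<in> {0..T}" "T \<in> {0..T}"
  using T by auto

end

section \<open>Sums, multiples and pullbacks of semidefinite forms\<close>

lemma psd_form_add:
  assumes "psd_form S E" "psd_form S F" shows "psd_form S (\<lambda>x y. E x y + F x y)"
proof -
  interpret E: psd_form S E by fact
  interpret F: psd_form S F by fact
  show ?thesis
  proof
    show "bilinear_on S (\<lambda>x y. E x y + F x y)"
      by (auto simp: bilinear_on_def E.addL E.addR F.addL F.addR E.scaleL E.scaleR F.scaleL F.scaleR algebra_simps)
  qed (auto simp: E.subspace E.sym F.sym E.nonneg F.nonneg)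
qed

lemma psd_form_scale:
  assumes "psd_form S E" "0 \<le> r" shows "psd_form S (\<lambda>x y. r * E x y)"
proof -
  interpret E: psd_form S E by fact
  show ?thesis
  proof
    show "bilinear_on S (\<lambda>x y. r * E x y)"
      by (auto simp: bilinear_on_def E.addL E.addR E.scaleL E.scaleR algebra_simps)
  qed (use assms(2) in \<open>auto simp: E.subspace E.sym E.nonneg\<close>)
qed

lemma psd_form_pullback:
  assumes "psd_form S E" "subspace S'" "\<And>x. x \<in> S' \<Longrightarrow> h x \<in> S"
    "\<And>x y. x \<in> S' \<Longrightarrow> y \<in> S' \<Longrightarrow> h (x + y) = h x + h y" "\<And>r x. x \<in> S' \<Longrightarrow> h (r *\<^sub>R x) = r *\<^sub>R h x"
  shows "psd_form S' (\<lambda>x y. E (h x) (h y))"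
proof -
  interpret E: psd_form S E by fact
  show ?thesis
  proof
    show "bilinear_on S' (\<lambda>x y. E (h x) (h y))"
      using assms by (auto simp: bilinear_on_def E.addL E.addR E.scaleL E.scaleR)
  qed (use assms in \<open>auto simp: E.sym E.nonneg\<close>)
qed

lemma psd_form_inner: "psd_form UNIV ((\<bullet>) :: 'a::real_inner \<Rightarrow> _)"
  by unfold_locales (auto simp: bilinear_on_def inner_add_left inner_add_right inner_commute)

lemma psd_form_mono: "psd_form S E \<Longrightarrow> subspace S' \<Longrightarrow> S' \<subseteq> S \<Longrightarrow> psd_form S' E"
  using psd_form_pullback[of S E S' "\<lambda>x. x"] by auto

section \<open>The energy form and Galerkin approximation with respect to it\<close>

locale energy = parabolic j T a
  for j :: "'v::{real_inner,complete_space,second_countable_topology} \<Rightarrow>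
              'h::{real_inner,complete_space,second_countable_topology}" and T a +
  fixes \<beta> :: real
  assumes \<beta>: "1 \<le> \<beta>"
begin

definition E :: "'v l2 \<Rightarrow> 'v l2 \<Rightarrow> real" where
  "E w v = As (b Y w) (b Y v) + \<beta> * (\<gamma> 0 w \<bullet> \<gamma> 0 v)"

lemma psd_trace: "t \<in> {0..T} \<Longrightarrow> psd_form X (\<lambda>w v. \<gamma> t w \<bullet> \<gamma> t v)"
  by (rule psd_form_pullback[OF psd_form_inner subspace_X]) (auto simp: trace_add trace_scale)

lemma psd_b: "closed_sub S \<Longrightarrow> psd_form X (\<lambda>w v. As (b S w) (b S v))"
  by (rule psd_form_pullback[OF As.psd_form_axioms subspace_X]) (auto simp: b_mem_Y b_add b_scale)

lemma psd_c: "closed_sub S \<Longrightarrow> psd_form X (\<lambda>w v. As (c S w) (c S v))"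
  by (rule psd_form_pullback[OF As.psd_form_axioms subspace_X]) (auto simp: c_mem_Y c_add c_scale)

sublocale E: psd_form X E
  unfolding E_def[abs_def]
  using \<beta> by (intro psd_form_add psd_form_scale psd_b psd_trace closed_sub_Y zero_T_mem) simp

lemma E_split:
  assumes w: "w \<in> X"
  shows "E w w = As (c Y w) (c Y w) + As w w + (norm (\<gamma> T w))\<^sup>2 + (\<beta> - 1) * (norm (\<gamma> 0 w))\<^sup>2"
  using b_square[OF closed_sub_Y w X_subset_Y[OF w]] by (simp add: E_def power2_norm_eq_inner algebra_simps)

text \<open>w is controlled by its own term in \<open>E_split\<close>. The derivative is what
  remains of Bw after subtracting A w; testing this with D w itself bounds D w. The two summands of
  k belong to these two estimates.\<close>

lemma E_coercive: "\<exists>k>0. \<forall>w\<in>X. k * (norm (w, D w))\<^sup>2 \<le> E w w"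
proof -
  define k where "k = 1 / \<alpha> + (2 * M + 2 * M\<^sup>2 / \<alpha>)"
  have k: "0 < k" using \<alpha>(1) M(1) by (simp add: k_def add_pos_nonneg)
  have le: "(norm (w, D w))\<^sup>2 \<le> k * E w w" if w: "w \<in> X" for w
  proof -
    have wY: "w \<in> Y" and DY: "D w \<in> Y" using w X_subset_Y D_mem by auto
    have "0 \<le> As (c Y w) (c Y w)" "0 \<le> (norm (\<gamma> T w))\<^sup>2" "0 \<le> (\<beta> - 1) * (norm (\<gamma> 0 w))\<^sup>2"
      using \<beta> As.nonneg[OF c_mem_Y[OF closed_sub_Y w]] by auto
    then have "As w w \<le> E w w" using E_split[OF w] by linarith
    then have n1: "(norm w)\<^sup>2 \<le> E w w / \<alpha>"
      using As_coercive[OF wY] \<alpha>(1) by (simp add: pos_le_divide_eq mult.commute)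
    have bE: "As (b Y w) (b Y w) \<le> E w w" using \<beta> by (simp add: E_def)
    have "(norm (D w))\<^sup>2 = As (b Y w) (D w) - A w (D w)"
      using b_props(2)[OF closed_sub_Y DY] by (simp add: B_def power2_norm_eq_inner)
    also have "\<dots> \<le> sqrt (E w w) * (sqrt M * norm (D w)) + M * (norm w * norm (D w))"
    proof -
      have "\<bar>As (b Y w) (D w)\<bar> \<le> sqrt (As (b Y w) (b Y w)) * sqrt (As (D w) (D w))"
        by (rule As.Cauchy_Schwarz_sqrt[OF b_mem_Y[OF closed_sub_Y] DY])
      also have "\<dots> \<le> sqrt (E w w) * sqrt (M * (norm (D w))\<^sup>2)"
        using bE As_bounded As.nonneg[OF b_mem_Y[OF closed_sub_Y, of w]] As.nonneg[OF DY]
        by (intro mult_mono real_sqrt_le_mono) auto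
      also have "sqrt (M * (norm (D w))\<^sup>2) = sqrt M * norm (D w)" by (simp add: real_sqrt_mult)
      finally show ?thesis using A_bounded[of w "D w"] by linarith
    qed
    also have "\<dots> = (sqrt (E w w) * sqrt M + M * norm w) * norm (D w)" by (simp add: algebra_simps)
    finally have "norm (D w) \<le> sqrt (E w w) * sqrt M + M * norm w"
      using E.nonneg[OF w] M(1) by (cases "norm (D w) = 0") (auto simp: power2_eq_square mult_le_cancel_right)
    then have "(norm (D w))\<^sup>2 \<le> (sqrt (E w w) * sqrt M + M * norm w)\<^sup>2" by (rule power_mono) simp
    also have "\<dots> \<le> 2 * (sqrt (E w w) * sqrt M)\<^sup>2 + 2 * (M * norm w)\<^sup>2"
      using sum_squares_bound[of "sqrt (E w w) * sqrt M" "M * norm w"] by (simp add: power2_sum)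
    also have "\<dots> = 2 * M * E w w + 2 * M\<^sup>2 * (norm w)\<^sup>2"
      using E.nonneg[OF w] M(1) by (simp add: power_mult_distrib)
    also have "\<dots> \<le> 2 * M * E w w + 2 * M\<^sup>2 * (E w w / \<alpha>)"
      using n1 by (intro add_left_mono mult_left_mono) auto
    finally have "(norm w)\<^sup>2 + (norm (D w))\<^sup>2 \<le> k * E w w"
      using n1 by (simp add: k_def algebra_simps)
    then show ?thesis by (simp add: norm_Pair)
  qed
  show ?thesis
  proof (intro exI[of _ "1 / k"] conjI ballI)
    show "1 / k * (norm (w, D w))\<^sup>2 \<le> E w w" if "w \<in> X" for w
      using le[OF that] k by (simp add: pos_divide_le_eq mult.commute)
  qed (use k in simp)
qed

text \<open>Testing the representative of Bw with itself bounds its norm by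
  \<open>(norm (D w) + M * norm w) / \<alpha>\<close>; the trace term is covered by the uniform
  bound on traces.\<close>

lemma E_bounded: "\<exists>k. \<forall>w\<in>X. E w w \<le> k * (norm (w, D w))\<^sup>2"
proof -
  define k where "k = 2 * (1 + M\<^sup>2) / \<alpha> + \<beta> * trC"
  have "E w w \<le> k * (norm (w, D w))\<^sup>2" if w: "w \<in> X" for w
  proof -
    let ?b = "b Y w"
    have bY: "?b \<in> Y" by (rule b_mem_Y[OF closed_sub_Y])
    let ?n = "norm (D w) + M * norm w"
    have n0: "0 \<le> ?n" using M(1) by simp
    have "As ?b ?b = D w \<bullet> ?b + A w ?b" using b_props(2)[OF closed_sub_Y bY] by (simp add: B_def)
    also have "\<dots> \<le> ?n * norm ?b"
      using norm_cauchy_schwarz[of "D w" ?b] A_bounded[of w ?b] by (simp add: algebra_simps)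
    finally have 1: "As ?b ?b \<le> ?n * norm ?b" .
    then have "\<alpha> * (norm ?b)\<^sup>2 \<le> ?n * norm ?b" using As_coercive[OF bY] by linarith
    then have "\<alpha> * norm ?b \<le> ?n"
      using n0 by (cases "norm ?b = 0") (auto simp: power2_eq_square mult.assoc[symmetric] mult_le_cancel_right)
    then have "norm ?b \<le> ?n / \<alpha>" using \<alpha>(1) by (simp add: pos_le_divide_eq mult.commute)
    with 1 have "As ?b ?b \<le> ?n * (?n / \<alpha>)" using mult_left_mono[OF _ n0] by (meson order_trans)
    also have "\<dots> = ?n\<^sup>2 / \<alpha>" by (simp add: power2_eq_square)
    also have "\<dots> \<le> 2 * (1 + M\<^sup>2) / \<alpha> * (norm (w, D w))\<^sup>2"
    proof -
      have "?n\<^sup>2 \<le> 2 * (norm (D w))\<^sup>2 + 2 * (M * norm w)\<^sup>2"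
        using sum_squares_bound[of "norm (D w)" "M * norm w"] by (simp add: power2_sum)
      also have "\<dots> \<le> 2 * (1 + M\<^sup>2) * ((norm w)\<^sup>2 + (norm (D w))\<^sup>2)"
        by (simp add: algebra_simps power_mult_distrib)
      finally show ?thesis using \<alpha>(1) by (simp add: norm_Pair divide_right_mono)
    qed
    finally have "As ?b ?b \<le> 2 * (1 + M\<^sup>2) / \<alpha> * (norm (w, D w))\<^sup>2" .
    moreover have "\<beta> * (norm (\<gamma> 0 w))\<^sup>2 \<le> \<beta> * (trC * (norm (w, D w))\<^sup>2)"
      using trace_props(3)[OF w zero_T_mem(1)] \<beta> by (intro mult_left_mono) auto
    ultimately show ?thesis by (simp add: E_def k_def power2_norm_eq_inner distrib_right mult.assoc)
  qed
  then show ?thesis by blast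
qed

lemma energy_norm_eq:
  assumes w: "w \<in> X" and Y: "Y \<noteq> {0}"
  shows "energy_norm T j a \<beta> w = sqrt (E w w)"
proof -
  have "dual_norm T a Y (opB T j a w) = sqrt (As (b Y w) (b Y w))"
    unfolding b_def by (rule dual_norm_eq[OF closed_sub_Y Y functional_B]) (simp add: opB_eq w)
  then show ?thesis
    using As.nonneg[OF b_mem_Y[OF closed_sub_Y, of w]] by (simp add: energy_norm_def E_def power2_norm_eq_inner)
qed

text \<open>Lax--Milgram on the graph of the time derivative, which is complete for the energy norm.\<close>

lemma variational_problem_ex1:
  assumes S: "S \<subseteq> X" "subspace S" "closed_in_X T j S" and N: "psd_form X N"
    and k: "0 < k" and low: "\<And>w. w \<in> S \<Longrightarrow> k * E w w \<le> N w w"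
    and up: "\<And>w. w \<in> S \<Longrightarrow> N w w \<le> k' * E w w"
    and l_add: "\<And>x y. x \<in> S \<Longrightarrow> y \<in> S \<Longrightarrow> l (x + y) = l x + l y"
    and l_scale: "\<And>x r. x \<in> S \<Longrightarrow> l (r *\<^sub>R x) = r * l x"
    and l_bound: "\<And>x. x \<in> S \<Longrightarrow> \<bar>l x\<bar> \<le> L * sqrt (E x x)"
  shows "\<exists>!z. z \<in> S \<and> (\<forall>w\<in>S. N z w = l w)"
proof -
  interpret N: psd_form X N by fact
  let ?g = "\<lambda>w. (w, D w)"
  obtain e where e: "0 < e" "\<And>w. w \<in> X \<Longrightarrow> e * (norm (?g w))\<^sup>2 \<le> E w w" using E_coercive by blast
  obtain e' where e': "\<And>w. w \<in> X \<Longrightarrow> E w w \<le> e' * (norm (?g w))\<^sup>2" using E_bounded by blast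
  have "\<exists>!p. p \<in> ?g ` S \<and> (\<forall>q\<in>?g ` S. N (fst p) (fst q) = l (fst q))"
  proof (rule riesz_form[where c = "k * e" and C = "\<bar>k'\<bar> * \<bar>e'\<bar>" and M = "\<bar>L\<bar> * sqrt \<bar>e'\<bar>"])
    have sub: "subspace (?g ` S)"
      unfolding subspace_def
    proof (intro conjI ballI allI)
      have "D 0 = 0" by (rule D_eqI[OF derivative_pair_zero])
      then show "0 \<in> ?g ` S" using subspace_0[OF S(2)] by (auto simp: zero_prod_def image_iff)
      show "p + q \<in> ?g ` S" if pq: "p \<in> ?g ` S" "q \<in> ?g ` S" for p q
      proof -
        obtain w v where "w \<in> S" "v \<in> S" "p = ?g w" "q = ?g v" using pq by blast
        moreover from this have "D (w + v) = D w + D v" "w + v \<in> S"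
          using S(1) by (auto intro!: D_add subspace_add[OF S(2)])
        ultimately show ?thesis by (intro image_eqI[of _ _ "w + v"]) auto
      qed
      show "r *\<^sub>R p \<in> ?g ` S" if p: "p \<in> ?g ` S" for r p
      proof -
        obtain w where "w \<in> S" "p = ?g w" using p by blast
        moreover from this have "D (r *\<^sub>R w) = r *\<^sub>R D w" "r *\<^sub>R w \<in> S"
          using S(1) by (auto intro!: D_scale subspace_scale[OF S(2)])
        ultimately show ?thesis by (intro image_eqI[of _ _ "r *\<^sub>R w"]) auto
      qed
    qed
    show "psd_form (?g ` S) (\<lambda>p q. N (fst p) (fst q))"
      by (rule psd_form_pullback[OF N sub]) (use S(1) in auto)
    show "complete (?g ` S)" by (rule complete_graph[OF S(1,3)])
    show "0 < k * e" using k e by simp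
    fix p assume "p \<in> ?g ` S"
    then obtain w where w: "w \<in> S" "p = ?g w" by blast
    then have wX: "w \<in> X" using S(1) by blast
    have "k * e * (norm p)\<^sup>2 \<le> k * E w w"
      using mult_left_mono[OF e(2)[OF wX], of k] k w by (simp add: mult.assoc)
    then show "k * e * (norm p)\<^sup>2 \<le> N (fst p) (fst p)" using low[OF w(1)] w by simp
    have Ele: "E w w \<le> \<bar>e'\<bar> * (norm p)\<^sup>2"
      using e'[OF wX] w mult_right_mono[OF abs_ge_self[of e'], of "(norm p)\<^sup>2"] by simp
    have "N w w \<le> \<bar>k'\<bar> * E w w"
      using up[OF w(1)] mult_right_mono[OF abs_ge_self[of k'] E.nonneg[OF wX]] by linarith
    also have "\<dots> \<le> \<bar>k'\<bar> * (\<bar>e'\<bar> * (norm p)\<^sup>2)" using Ele by (intro mult_left_mono) auto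
    finally show "N (fst p) (fst p) \<le> \<bar>k'\<bar> * \<bar>e'\<bar> * (norm p)\<^sup>2" using w by (simp add: mult.assoc)
    have "\<bar>l w\<bar> \<le> \<bar>L\<bar> * sqrt (E w w)"
      using l_bound[OF w(1)] mult_right_mono[OF abs_ge_self[of L], of "sqrt (E w w)"] E.nonneg[OF wX] by simp
    also have "\<dots> \<le> \<bar>L\<bar> * sqrt (\<bar>e'\<bar> * (norm p)\<^sup>2)" using Ele by (intro mult_left_mono real_sqrt_le_mono) auto
    finally show "\<bar>l (fst p)\<bar> \<le> \<bar>L\<bar> * sqrt \<bar>e'\<bar> * norm p" using w by (simp add: real_sqrt_mult mult.assoc)
    show "l (fst (r *\<^sub>R p)) = r * l (fst p)" for r using w l_scale by simp
    show "l (fst (p + q)) = l (fst p) + l (fst q)" if "q \<in> ?g ` S" for q using w that l_add by auto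
  qed
  then obtain p where p: "p \<in> ?g ` S" "\<And>q. q \<in> ?g ` S \<Longrightarrow> N (fst p) (fst q) = l (fst q)"
    and uniq: "\<And>p'. p' \<in> ?g ` S \<Longrightarrow> (\<forall>q\<in>?g ` S. N (fst p') (fst q) = l (fst q)) \<Longrightarrow> p' = p" by blast
  show ?thesis
  proof (rule ex1I[of _ "fst p"])
    show "fst p \<in> S \<and> (\<forall>w\<in>S. N (fst p) w = l w)" using p by force
    fix z assume z: "z \<in> S \<and> (\<forall>w\<in>S. N z w = l w)"
    then have "?g z = p" by (intro uniq) auto
    then show "z = fst p" by auto
  qed
qed

text \<open>Galerkin approximation: orthogonality makes the projection bounded, and a projection and its
  complement have the same norm.\<close>

lemma galerkin_quasi_optimal:
  assumes S: "S \<subseteq> X" "subspace S" and N: "psd_form X N"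
    and L: "1 \<le> L" and k: "0 < k" "k' \<le> k * L\<^sup>2"
    and low: "\<And>w. w \<in> S \<Longrightarrow> k * E w w \<le> N w w" and up: "\<And>x. x \<in> X \<Longrightarrow> N x x \<le> k' * E x x"
    and u: "u \<in> X" and z: "z \<in> S" "\<And>w. w \<in> S \<Longrightarrow> N z w = N u w" and w: "w \<in> S"
  shows "sqrt (E (u - z) (u - z)) \<le> L * sqrt (E (u - w) (u - w))"
proof -
  interpret N: psd_form X N by fact
  \<comment> \<open>The N-orthogonal complement of the trial space, where the Galerkin error
    lies.\<close>
  define W where "W = {x \<in> X. \<forall>v\<in>S. N x v = 0}"
  have W: "subspace W" "W \<subseteq> X"
    using S(1) by (auto simp: W_def subspace_def N.addL N.scaleL subset_iff)
  \<comment> \<open>u - w splits into z - w in S and u - z in W. The bound for the first component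
    passes to the second with the same L; the triangle inequality would cost 1 + L.\<close>
  have "sqrt (E (u - z) (u - z)) \<le> L * sqrt (E ((z - w) + (u - z)) ((z - w) + (u - z)))"
  proof (rule E.complementary_component_bound[OF S(2,1) W L])
    show "z - w \<in> S" using z(1) w by (rule subspace_diff[OF S(2)])
    show "u - z \<in> W" using u z S(1) by (auto simp: W_def N.diffL subset_iff)
    fix x y assume x: "x \<in> S" and y: "y \<in> W"
    have X: "x \<in> X" "y \<in> X" using x y S(1) W(2) by auto
    have "N y x = 0" using x y by (simp add: W_def)
    then have "N (x + y) (x + y) = N x x + N y y" using X N.sym[OF X] by (simp add: N.square_add)
    then have "N x x \<le> N (x + y) (x + y)" using N.nonneg[OF X(2)] by simp
    then have "k * E x x \<le> k' * E (x + y) (x + y)"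
      using low[OF x] up[OF N.add_closed[OF X]] by linarith
    also have "\<dots> \<le> k * L\<^sup>2 * E (x + y) (x + y)"
      using k(2) E.nonneg[OF E.add_closed[OF X]] by (rule mult_right_mono)
    finally have "E x x \<le> L\<^sup>2 * E (x + y) (x + y)" using k(1) by (simp add: mult.assoc)
    then have "sqrt (E x x) \<le> sqrt (L\<^sup>2 * E (x + y) (x + y))" by (rule real_sqrt_le_mono)
    then show "sqrt (E x x) \<le> L * sqrt (E (x + y) (x + y))" using L by (simp add: real_sqrt_mult)
  qed
  then show ?thesis by simp
qed

end

section \<open>The discretisations\<close>

lemma le_if_square_le:
  fixes x c :: real
  assumes "x * x \<le> c * x" "0 \<le> c" shows "x \<le> c"
proof (rule ccontr)
  assume "\<not> x \<le> c"
  then have "c * x < x * x" using assms(2) by (intro mult_strict_right_mono) auto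
  then show False using assms(1) by simp
qed

lemma inv_into_bij_betw_eq: "bij_betw K A B \<Longrightarrow> x \<in> A \<Longrightarrow> inv_into A K (K x) = x"
  by (simp add: bij_betw_def inv_into_f_f)

text \<open>Here \<open>g\<close> is the inf-sup constant, not the right-hand side. Written without
  a quotient, the condition also covers functions with Cw = 0.\<close>

locale discretisation = energy j T a \<beta>
  for j :: "'v::{real_inner,complete_space,second_countable_topology} \<Rightarrow>
              'h::{real_inner,complete_space,second_countable_topology}" and T a \<beta> +
  fixes XS YS :: "'v l2 set" and g :: real
  assumes XS: "XS \<subseteq> X" "subspace XS" "closed_in_X T j XS"
    and YS: "closed_sub YS" "YS \<noteq> {0}"
    and g: "0 < g" "g \<le> 1"
    and inf_sup: "\<And>w. w \<in> XS \<Longrightarrow> g * sqrt (As (c Y w) (c Y w)) \<le> sqrt (As (c YS w) (c YS w))"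
begin

lemma XS_X: "w \<in> XS \<Longrightarrow> w \<in> X"
  using XS(1) by blast

lemma YS_Y: "v \<in> YS \<Longrightarrow> v \<in> Y"
  using YS(1) by (auto simp: closed_sub_def)

lemma Y_nontrivial: "Y \<noteq> {0}"
proof -
  obtain v where "v \<in> YS" "v \<noteq> 0"
    using YS subspace_0[of YS] unfolding closed_sub_def by blast
  then show ?thesis using YS_Y by blast
qed

lemma g_square: "g\<^sup>2 \<le> 1"
  using g by (simp add: power_le_one)

lemma inf_sup_square:
  assumes w: "w \<in> XS" shows "g\<^sup>2 * As (c Y w) (c Y w) \<le> As (c YS w) (c YS w)"
proof -
  have n: "0 \<le> As (c Y w) (c Y w)" "0 \<le> As (c YS w) (c YS w)"
    using As.nonneg c_mem_Y[OF _ XS_X[OF w]] YS(1) closed_sub_Y by auto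
  have "(g * sqrt (As (c Y w) (c Y w)))\<^sup>2 \<le> (sqrt (As (c YS w) (c YS w)))\<^sup>2"
    using inf_sup[OF w] g n by (intro power_mono) auto
  then show ?thesis using n by (simp add: power_mult_distrib)
qed

text \<open>Only the term with C needs the factor; the other three are nonnegative and
  \<open>g^2\<close> is at most 1, so they may be scaled along.\<close>

lemma scaled_energy_le:
  assumes w: "w \<in> XS"
  shows "g\<^sup>2 * E w w \<le> As (c YS w) (c YS w) + As w w + (norm (\<gamma> T w))\<^sup>2 + (\<beta> - 1) * (norm (\<gamma> 0 w))\<^sup>2"
proof -
  have "g\<^sup>2 * (As w w + (norm (\<gamma> T w))\<^sup>2 + (\<beta> - 1) * (norm (\<gamma> 0 w))\<^sup>2) \<le>
      As w w + (norm (\<gamma> T w))\<^sup>2 + (\<beta> - 1) * (norm (\<gamma> 0 w))\<^sup>2"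
    using g_square As.nonneg[OF X_subset_Y[OF XS_X[OF w]]] \<beta>
    by (intro mult_left_le_one_le add_nonneg_nonneg mult_nonneg_nonneg) auto
  then show ?thesis
    using inf_sup_square[OF w] unfolding E_split[OF XS_X[OF w]] by (simp add: distrib_left)
qed

end

section \<open>The minimal residual method with a preconditioner\<close>

locale preconditioned = discretisation j T a \<beta> XS YS g
  for j :: "'v::{real_inner,complete_space,second_countable_topology} \<Rightarrow>
              'h::{real_inner,complete_space,second_countable_topology}" and T a \<beta> XS YS g +
  fixes K :: "('v l2 \<Rightarrow> real) \<Rightarrow> 'v l2" and r R :: real
  assumes sub: "XS \<subseteq> YS" and K: "symmetric_boundedly_invertible T a YS K"
    and r: "0 < r" and R: "r \<le> R"
    and K_low: "\<And>v. v \<in> YS \<Longrightarrow> r * As v v \<le> inv_into (dual YS) K v v"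
    and K_up: "\<And>v. v \<in> YS \<Longrightarrow> inv_into (dual YS) K v v \<le> R * As v v"
begin

text \<open>The bilinear form of the inverse of K, spectrally equivalent to \<open>As\<close> on the
  test space.\<close>

definition q :: "'v l2 \<Rightarrow> 'v l2 \<Rightarrow> real" where "q x y = inv_into (dual YS) K x y"

lemma K_bij: "bij_betw K (dual YS) YS"
  and K_add: "f \<in> dual YS \<Longrightarrow> h \<in> dual YS \<Longrightarrow> K (\<lambda>v\<in>YS. f v + h v) = K f + K h"
  and K_scale: "f \<in> dual YS \<Longrightarrow> K (\<lambda>v\<in>YS. s * f v) = s *\<^sub>R K f"
  and K_sym: "f \<in> dual YS \<Longrightarrow> h \<in> dual YS \<Longrightarrow> f (K h) = h (K f)"
  using K by (auto simp: symmetric_boundedly_invertible_def)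

lemma q_K: "f \<in> dual YS \<Longrightarrow> q (K f) y = f y"
  by (simp add: q_def inv_into_bij_betw_eq[OF K_bij])

lemma K_surj: "x \<in> YS \<Longrightarrow> \<exists>f\<in>dual YS. x = K f"
  using K_bij by (auto simp: bij_betw_def)

lemma K_mem: "f \<in> dual YS \<Longrightarrow> K f \<in> YS"
  using K_bij by (auto simp: bij_betw_def)

lemma q_sym: assumes "x \<in> YS" "y \<in> YS" shows "q x y = q y x"
  using K_surj[OF assms(1)] K_surj[OF assms(2)] K_sym by (auto simp: q_K)

sublocale q: psd_form YS q
proof
  show sY: "subspace YS" using YS(1) by (simp add: closed_sub_def)
  show sym: "q x y = q y x" if "x \<in> YS" "y \<in> YS" for x y using that by (rule q_sym)
  show "0 \<le> q x x" if x: "x \<in> YS" for x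
  proof -
    have "0 \<le> r * As x x" using r As.nonneg[OF YS_Y[OF x]] by simp
    then show ?thesis using K_low[OF x] by (simp add: q_def)
  qed
  \<comment> \<open>Linearity in the second argument holds because \<open>q z\<close> is a
    functional; symmetry then yields the first argument.\<close>
  have addR: "q z (x + y) = q z x + q z y" if z: "z \<in> YS" and "x \<in> YS" "y \<in> YS" for x y z
  proof -
    obtain f where "f \<in> dual YS" "z = K f" using K_surj[OF z] by blast
    then show ?thesis using that by (simp add: q_K) (simp add: dual_def)
  qed
  have scaleR: "q z (s *\<^sub>R x) = s * q z x" if z: "z \<in> YS" and "x \<in> YS" for s x z
  proof -
    obtain f where "f \<in> dual YS" "z = K f" using K_surj[OF z] by blast
    then show ?thesis using that by (simp add: q_K) (simp add: dual_def)
  qed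
  show "bilinear_on YS q"
    unfolding bilinear_on_def
    using addR scaleR sym by (simp add: subspace_add[OF sY] subspace_scale[OF sY])
qed

text \<open>K f and \<rho> YS f represent the same functional in the forms q and \<open>As\<close>.
  Evaluating f at either of them, Cauchy-Schwarz and spectral equivalence give both bounds; the
  constants appear inverted because K inverts the form.\<close>

lemma K_functional:
  assumes f: "functional YS f"
  shows "K (restrict f YS) \<in> YS" "\<And>y. y \<in> YS \<Longrightarrow> q (K (restrict f YS)) y = f y"
    "q (K (restrict f YS)) (K (restrict f YS)) \<le> As (\<rho> YS f) (\<rho> YS f) / r"
    "As (\<rho> YS f) (\<rho> YS f) \<le> R * q (K (restrict f YS)) (K (restrict f YS))"
proof -
  have sY: "subspace YS" using YS(1) by (simp add: closed_sub_def)
  have d: "restrict f YS \<in> dual YS" by (rule functional_restrict[OF sY f])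
  let ?v = "K (restrict f YS)" and ?z = "\<rho> YS f"
  show v: "?v \<in> YS" by (rule K_mem[OF d])
  show qv: "q ?v y = f y" if "y \<in> YS" for y using that by (simp add: q_K[OF d])
  have z: "?z \<in> YS" "\<And>y. y \<in> YS \<Longrightarrow> As ?z y = f y" using \<rho>_props[OF YS(1) f] by auto
  have qn: "0 \<le> q ?v ?v" and zn: "0 \<le> As ?z ?z"
    using q.nonneg[OF v] As.nonneg[OF YS_Y[OF z(1)]] by auto
  have "(q ?v ?v)\<^sup>2 = (As ?z ?v)\<^sup>2" using z(2)[OF v] qv[OF v] by simp
  also have "\<dots> \<le> As ?z ?z * As ?v ?v" by (intro As.Cauchy_Schwarz YS_Y z v)
  also have "\<dots> \<le> As ?z ?z * (q ?v ?v / r)"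
    using K_low[OF v] r zn by (intro mult_left_mono) (auto simp: q_def pos_le_divide_eq mult.commute)
  finally have "q ?v ?v * q ?v ?v \<le> (As ?z ?z / r) * q ?v ?v" by (simp add: power2_eq_square)
  then show "q ?v ?v \<le> As ?z ?z / r"
    by (rule le_if_square_le) (use zn r in simp)
  have "(As ?z ?z)\<^sup>2 = (q ?v ?z)\<^sup>2" using z(2)[OF z(1)] qv[OF z(1)] by simp
  also have "\<dots> \<le> q ?v ?v * q ?z ?z" by (rule q.Cauchy_Schwarz[OF v z(1)])
  also have "\<dots> \<le> q ?v ?v * (R * As ?z ?z)"
    using K_up[OF z(1)] qn by (intro mult_left_mono) (auto simp: q_def)
  finally have "As ?z ?z * As ?z ?z \<le> (R * q ?v ?v) * As ?z ?z" by (simp add: power2_eq_square mult_ac)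
  then show "As ?z ?z \<le> R * q ?v ?v"
    by (rule le_if_square_le) (use qn r R in simp)
qed

definition kB :: "'v l2 \<Rightarrow> 'v l2" where "kB w = K (restrict (B w) YS)"

lemma kB_props:
  "kB w \<in> YS" "y \<in> YS \<Longrightarrow> q (kB w) y = B w y"
  "q (kB w) (kB w) \<le> As (b YS w) (b YS w) / r" "As (b YS w) (b YS w) \<le> R * q (kB w) (kB w)"
  unfolding kB_def b_def using K_functional[OF functional_B_sub[OF YS(1)]] by blast+

lemma dual_B: "restrict (B w) YS \<in> dual YS"
  using YS(1) by (intro functional_restrict functional_B_sub) (auto simp: closed_sub_def)

lemma kB_add: assumes "w \<in> X" "v \<in> X" shows "kB (w + v) = kB w + kB v"
proof -
  have "restrict (B (w + v)) YS = (\<lambda>y\<in>YS. restrict (B w) YS y + restrict (B v) YS y)"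
    using assms by (auto simp: B_add)
  then show ?thesis unfolding kB_def using K_add[OF dual_B dual_B] by simp
qed

lemma kB_scale: assumes "w \<in> X" shows "kB (s *\<^sub>R w) = s *\<^sub>R kB w"
proof -
  have "restrict (B (s *\<^sub>R w)) YS = (\<lambda>y\<in>YS. s * restrict (B w) YS y)"
    using assms by (auto simp: B_scale)
  then show ?thesis unfolding kB_def using K_scale[OF dual_B] by simp
qed

text \<open>The left side of the discrete equation in symmetric form: Bw evaluated at the
  preconditioned residual of z is \<open>q (kB z) (kB w)\<close>.\<close>

definition N :: "'v l2 \<Rightarrow> 'v l2 \<Rightarrow> real" where
  "N z w = q (kB z) (kB w) + \<beta> * (\<gamma> 0 z \<bullet> \<gamma> 0 w)"

lemma N_psd: "psd_form X N"
  unfolding N_def[abs_def] using \<beta>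
  by (intro psd_form_add psd_form_scale psd_trace zero_T_mem psd_form_pullback[OF q.psd_form_axioms subspace_X])
    (auto simp: kB_props kB_add kB_scale)

text \<open>The inclusion of the trial space in the test space makes \<open>b_square\<close>
  available there. The trace term carries no preconditioner, hence \<open>max R 1\<close> instead of
  R.\<close>

lemma N_low:
  assumes w: "w \<in> XS" shows "(1 / max R 1) * g\<^sup>2 * E w w \<le> N w w"
proof -
  have R1: "0 < max R 1" by simp
  have "g\<^sup>2 * E w w \<le> As (b YS w) (b YS w) + \<beta> * (norm (\<gamma> 0 w))\<^sup>2"
    using scaled_energy_le[OF w] b_square[OF YS(1) XS_X[OF w]] sub w by (simp add: subset_iff algebra_simps)
  also have "\<dots> \<le> R * q (kB w) (kB w) + \<beta> * (norm (\<gamma> 0 w))\<^sup>2" using kB_props(4) by simp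
  also have "\<dots> \<le> max R 1 * q (kB w) (kB w) + max R 1 * (\<beta> * (norm (\<gamma> 0 w))\<^sup>2)"
  proof (rule add_mono)
    show "R * q (kB w) (kB w) \<le> max R 1 * q (kB w) (kB w)"
      using q.nonneg[OF kB_props(1)] by (intro mult_right_mono) auto
    show "\<beta> * (norm (\<gamma> 0 w))\<^sup>2 \<le> max R 1 * (\<beta> * (norm (\<gamma> 0 w))\<^sup>2)"
      using mult_right_mono[of 1 "max R 1" "\<beta> * (norm (\<gamma> 0 w))\<^sup>2"] \<beta> by simp
  qed
  also have "\<dots> = max R 1 * N w w" by (simp add: N_def power2_norm_eq_inner distrib_left)
  finally show ?thesis using R1 by (simp add: pos_divide_le_eq mult_ac)
qed

lemma N_up:
  assumes x: "x \<in> X" shows "N x x \<le> (1 / min r 1) * E x x"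
proof -
  have m: "0 < min r 1" "min r 1 \<le> r" "min r 1 \<le> 1" using r by auto
  have bn: "0 \<le> As (b Y x) (b Y x)" by (intro As.nonneg b_mem_Y closed_sub_Y)
  have "q (kB x) (kB x) \<le> As (b YS x) (b YS x) / r" by (rule kB_props)
  also have "\<dots> \<le> As (b Y x) (b Y x) / r"
    unfolding b_def using r by (intro divide_right_mono \<rho>_subspace_le YS functional_B) auto
  also have "\<dots> \<le> As (b Y x) (b Y x) / min r 1"
    using bn m by (intro divide_left_mono) auto
  finally have 1: "q (kB x) (kB x) \<le> As (b Y x) (b Y x) / min r 1" .
  have "\<beta> * (norm (\<gamma> 0 x))\<^sup>2 / 1 \<le> \<beta> * (norm (\<gamma> 0 x))\<^sup>2 / min r 1"
    using \<beta> m by (intro divide_left_mono) auto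
  with 1 show ?thesis by (simp add: N_def E_def power2_norm_eq_inner add_divide_distrib)
qed

text \<open>The data are the images of u, so the equation expresses Galerkin orthogonality of u - z
  for N.\<close>

lemma mr_solution_iff:
  assumes u: "u \<in> X"
  shows "mr_solution T j a \<beta> XS YS K (opB T j a u) (\<gamma> 0 u) z \<longleftrightarrow> z \<in> XS \<and> (\<forall>w\<in>XS. N z w = N u w)"
proof -
  have res: "K (restrict (opB T j a x) YS) = kB x" if "x \<in> X" for x
    unfolding kB_def using that YS_Y by (intro arg_cong[where f = K]) (auto simp: opB_eq)
  have "opB T j a w (kB x) = q (kB x) (kB w)" if "w \<in> X" for w x
    using kB_props(2)[OF kB_props(1), of w x] q.sym[OF kB_props(1) kB_props(1)] that
    by (simp add: opB_eq YS_Y kB_props(1))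
  then show ?thesis
    unfolding mr_solution_def N_def using XS_X u by (auto simp: res)
qed

lemma mr_solution_ex1:
  assumes u: "u \<in> X"
  shows "\<exists>!z. mr_solution T j a \<beta> XS YS K (opB T j a u) (\<gamma> 0 u) z"
  unfolding mr_solution_iff[OF u]
proof (rule variational_problem_ex1[OF XS N_psd])
  interpret N: psd_form X N by (rule N_psd)
  show "0 < (1 / max R 1) * g\<^sup>2" using g by (auto simp: less_max_iff_disj)
  show "N w w \<le> (1 / min r 1) * E w w" if "w \<in> XS" for w using N_up[OF XS_X[OF that]] .
  show "N u (x + y) = N u x + N u y" if "x \<in> XS" "y \<in> XS" for x y
    using that u XS_X by (simp add: N.addR)
  show "N u (s *\<^sub>R x) = s * N u x" if "x \<in> XS" for x s using that u XS_X by (simp add: N.scaleR)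
  show "\<bar>N u x\<bar> \<le> sqrt (N u u) * sqrt (1 / min r 1) * sqrt (E x x)" if "x \<in> XS" for x
  proof -
    have x: "x \<in> X" using that by (rule XS_X)
    have "\<bar>N u x\<bar> \<le> sqrt (N u u) * sqrt (N x x)" by (rule N.Cauchy_Schwarz_sqrt[OF u x])
    also have "\<dots> \<le> sqrt (N u u) * sqrt ((1 / min r 1) * E x x)"
      using N_up[OF x] N.nonneg[OF u] by (intro mult_left_mono real_sqrt_le_mono) auto
    finally show ?thesis by (simp only: real_sqrt_mult mult.assoc)
  qed
qed (rule N_low)

lemma mr_error:
  assumes u: "u \<in> X" and z: "mr_solution T j a \<beta> XS YS K (opB T j a u) (\<gamma> 0 u) z" and w: "w \<in> XS"
  shows "sqrt (E (u - z) (u - z)) \<le> sqrt (max R 1 / min r 1) * inverse g * sqrt (E (u - w) (u - w))"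
proof (rule galerkin_quasi_optimal[OF XS(1,2) N_psd])
  have m: "0 < min r 1" "min r 1 \<le> 1" "1 \<le> max R 1" using r by auto
  have "1 \<le> sqrt (max R 1 / min r 1)" using m by (simp add: pos_le_divide_eq)
  moreover have "1 \<le> inverse g" using g by (simp add: one_le_inverse)
  ultimately show "1 \<le> sqrt (max R 1 / min r 1) * inverse g"
    using mult_mono[of 1 "sqrt (max R 1 / min r 1)" 1 "inverse g"] by simp
  show "0 < (1 / max R 1) * g\<^sup>2" using g m by auto
  \<comment> \<open>The square of the claimed constant is exactly the quotient of the upper and the
    lower bound of N.\<close>
  show "1 / min r 1 \<le> (1 / max R 1) * g\<^sup>2 * (sqrt (max R 1 / min r 1) * inverse g)\<^sup>2"
    using g m by (simp add: power_mult_distrib power_inverse field_simps)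
qed (use u z w N_low N_up in \<open>auto simp: mr_solution_iff\<close>)

end

section \<open>The second method: Galerkin projection and consistency error\<close>

context discretisation begin

text \<open>The polarised right side of \<open>E_split\<close> with the test space YS in place of
  Y.\<close>

definition BN :: "'v l2 \<Rightarrow> 'v l2 \<Rightarrow> real" where
  "BN z w = As (c YS z) (c YS w) + As z w + \<gamma> T z \<bullet> \<gamma> T w + (\<beta> - 1) * (\<gamma> 0 z \<bullet> \<gamma> 0 w)"

lemma BN_psd: "psd_form X BN"
  unfolding BN_def[abs_def] using \<beta>
  by (intro psd_form_add psd_form_scale psd_trace zero_T_mem psd_c YS(1)
      psd_form_mono[OF As.psd_form_axioms subspace_X]) (auto intro: X_subset_Y)

lemma BN_low: "w \<in> XS \<Longrightarrow> g\<^sup>2 * E w w \<le> BN w w"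
  using scaled_energy_le by (simp add: BN_def power2_norm_eq_inner)

lemma BN_up:
  assumes x: "x \<in> X" shows "BN x x \<le> E x x"
  using \<rho>_subspace_le[OF YS(1) functional_C[OF X_subset_Y[OF x]]]
  unfolding E_split[OF x] BN_def c_def by (simp add: power2_norm_eq_inner)

text \<open>The orthogonal projection onto YS in the inner product \<open>As\<close>; it is what
  \<open>discrete_riesz\<close> makes of the symmetric part of Bu.\<close>

definition proj :: "'v l2 \<Rightarrow> 'v l2" where "proj u = \<rho> YS (As u)"

lemma proj:
  assumes u: "u \<in> Y"
  shows "proj u \<in> YS" "v \<in> YS \<Longrightarrow> As (proj u) v = As u v"
  unfolding proj_def
  using \<rho>_props[OF YS(1) functional_subset[OF functional_As[OF u]]] YS(1) by (auto simp: closed_sub_def)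

lemma proj_best:
  assumes u: "u \<in> Y" and v: "v \<in> YS"
  shows "As (u - proj u) (u - proj u) \<le> As (u - v) (u - v)"
proof -
  let ?e = "u - proj u" and ?d = "proj u - v"
  have p: "proj u \<in> YS" by (rule proj(1)[OF u])
  have d: "?d \<in> YS" using YS(1) p v by (auto simp: closed_sub_def intro: subspace_diff)
  have e: "?e \<in> Y" using u YS_Y[OF p] by simp
  have "As ?e ?d = 0" using proj(2)[OF u d] u YS_Y[OF p] YS_Y[OF d] by (simp add: As.diffL)
  then have "As (u - v) (u - v) = As ?e ?e + As ?d ?d"
    using As.square_add[OF e YS_Y[OF d]] by simp
  then show ?thesis using As.nonneg[OF YS_Y[OF d]] by simp
qed

text \<open>The consistency error: replacing \<open>u\<close> by its projection in the Riesz representative of \<open>g\<close>.\<close>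

definition res :: "'v l2 \<Rightarrow> 'v l2 \<Rightarrow> real" where "res u w = C w (proj u - u)"

text \<open>The discrete representative of Bu is \<open>c YS u + proj u\<close>. Replacing
  \<open>C w (proj u)\<close> by \<open>C w u\<close> costs \<open>res\<close>, and
  \<open>C w u + C u w\<close> supplies the traces; its part at time 0 lowers the coefficient
  \<beta> to \<beta> - 1.\<close>

lemma ben_solution_iff:
  assumes u: "u \<in> X"
  shows "ben_solution T j a \<beta> XS YS (opB T j a u) (\<gamma> 0 u) z \<longleftrightarrow>
    z \<in> XS \<and> (\<forall>w\<in>XS. BN z w = BN u w + res u w)"
proof -
  have uY: "u \<in> Y" by (rule X_subset_Y[OF u])
  have C\<rho>: "opC T j a w (\<rho> YS (opC T j a z)) = As (c YS z) (c YS w)" if "w \<in> X" "z \<in> X" for w z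
  proof -
    have "\<rho> YS (opC T j a z) = c YS z"
      unfolding c_def using that YS_Y by (intro \<rho>_cong) (simp add: opC_eq)
    then show ?thesis
      using c_props[OF YS(1) that(1)] c_props(1)[OF YS(1) that(2)] As.sym[OF c_mem_Y[OF YS(1)] c_mem_Y[OF YS(1)]] that
      by (simp add: opC_eq YS_Y)
  qed
  have "\<rho> YS (opB T j a u) = \<rho> YS (\<lambda>v. C u v + As u v)"
    using u YS_Y by (intro \<rho>_cong) (simp add: opB_eq C_def)
  also have "\<dots> = c YS u + proj u"
    unfolding c_def proj_def
    using YS(1) u by (intro \<rho>_add functional_C_sub functional_subset[OF functional_As[OF uY]]) (auto simp: closed_sub_def)
  finally have \<rho>g: "\<rho> YS (opB T j a u) = c YS u + proj u" .
  have rhs: "opC T j a w (\<rho> YS (opB T j a u)) + opB T j a u w + \<beta> * (\<gamma> 0 u \<bullet> \<gamma> 0 w) = BN u w + res u w"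
    if w: "w \<in> X" for w
  proof -
    have wY: "w \<in> Y" by (rule X_subset_Y[OF w])
    have cY: "c YS u \<in> Y" and pY: "proj u \<in> Y" using c_mem_Y[OF YS(1) u] YS_Y[OF proj(1)[OF uY]] by auto
    have Cadd: "C w (x + y) = C w x + C w y" if "x \<in> Y" "y \<in> Y" for x y
      using functional_C[OF wY] that by (simp add: functional_def)
    have "opC T j a w (c YS u + proj u) = C w (c YS u) + C w (proj u)"
      using w cY pY by (simp add: opC_eq Cadd)
    moreover have "C w (c YS u) = As (c YS u) (c YS w)"
      using c_props(2)[OF YS(1) w c_props(1)[OF YS(1) u]] As.sym[OF c_mem_Y[OF YS(1) w] cY] by simp
    moreover have "C w (proj u) = res u w + C w u"
      using Cadd[of "proj u - u" u] pY uY by (simp add: res_def)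
    moreover have "opB T j a u w = C u w + As u w" using u wY by (simp add: opB_eq C_def)
    moreover have "C u w + C w u = \<gamma> T u \<bullet> \<gamma> T w - \<gamma> 0 u \<bullet> \<gamma> 0 w" by (rule C_symmetric_part[OF u w])
    ultimately show ?thesis unfolding \<rho>g by (simp add: BN_def algebra_simps)
  qed
  have lhs: "opC T j a w (\<rho> YS (opC T j a z)) + opAs T a z w + \<gamma> T z \<bullet> \<gamma> T w + (\<beta> - 1) * (\<gamma> 0 z \<bullet> \<gamma> 0 w) = BN z w"
    if "w \<in> X" "z \<in> X" for w z
    using that by (simp add: C\<rho> BN_def opAs_eq X_subset_Y)
  show ?thesis unfolding ben_solution_def using XS_X by (auto simp: lhs rhs)
qed

text \<open>Cw is evaluated at the projection error, and its dual norm on Y is among the nonnegative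
  terms of \<open>E_split\<close>.\<close>

lemma res_bound:
  assumes u: "u \<in> X" and w: "w \<in> X"
  shows "\<bar>res u w\<bar> \<le> sqrt (As (u - proj u) (u - proj u)) * sqrt (E w w)"
proof -
  let ?e = "proj u - u"
  have e: "?e \<in> Y" using X_subset_Y[OF u] YS_Y[OF proj(1)[OF X_subset_Y[OF u]]] by simp
  have cY: "c Y w \<in> Y" by (rule c_mem_Y[OF closed_sub_Y w])
  have "As (c Y w) (c Y w) \<le> E w w"
    using E_split[OF w] As.nonneg[OF X_subset_Y[OF w]] \<beta> by simp
  then have cE: "sqrt (As (c Y w) (c Y w)) \<le> sqrt (E w w)" by (rule real_sqrt_le_mono)
  have "\<bar>res u w\<bar> = \<bar>As (c Y w) ?e\<bar>" using c_props(2)[OF closed_sub_Y w e] by (simp add: res_def)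
  also have "\<dots> \<le> sqrt (As (c Y w) (c Y w)) * sqrt (As ?e ?e)" by (rule As.Cauchy_Schwarz_sqrt[OF cY e])
  also have "\<dots> \<le> sqrt (E w w) * sqrt (As ?e ?e)"
    using cE As.nonneg[OF e] by (intro mult_right_mono) auto
  also have "As ?e ?e = As (u - proj u) (u - proj u)"
    using As.square_scale[OF e, of "-1"] by simp
  finally show ?thesis by (simp add: mult.commute)
qed

lemma res_add: "w \<in> X \<Longrightarrow> v \<in> X \<Longrightarrow> res u (w + v) = res u w + res u v"
  and res_scale: "w \<in> X \<Longrightarrow> res u (s *\<^sub>R w) = s * res u w"
  by (auto simp: res_def C_add C_scale)

lemma BN_bound:
  assumes u: "u \<in> X" and x: "x \<in> X"
  shows "\<bar>BN u x\<bar> \<le> sqrt (BN u u) * sqrt (E x x)"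
proof -
  interpret N: psd_form X BN by (rule BN_psd)
  have "\<bar>BN u x\<bar> \<le> sqrt (BN u u) * sqrt (BN x x)" by (rule N.Cauchy_Schwarz_sqrt[OF u x])
  also have "\<dots> \<le> sqrt (BN u u) * sqrt (E x x)"
    using BN_up[OF x] N.nonneg[OF u] by (intro mult_left_mono real_sqrt_le_mono) auto
  finally show ?thesis .
qed

lemma ben_solution_ex1:
  assumes u: "u \<in> X"
  shows "\<exists>!z. ben_solution T j a \<beta> XS YS (opB T j a u) (\<gamma> 0 u) z"
  unfolding ben_solution_iff[OF u]
proof (rule variational_problem_ex1[OF XS BN_psd])
  interpret N: psd_form X BN by (rule BN_psd)
  show "0 < g\<^sup>2" using g by simp
  show "BN w w \<le> 1 * E w w" if "w \<in> XS" for w using BN_up[OF XS_X[OF that]] by simp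
  show "BN u (x + y) + res u (x + y) = BN u x + res u x + (BN u y + res u y)" if "x \<in> XS" "y \<in> XS" for x y
    using that u XS_X by (simp add: N.addR res_add)
  show "BN u (s *\<^sub>R x) + res u (s *\<^sub>R x) = s * (BN u x + res u x)" if "x \<in> XS" for x s
    using that u XS_X by (simp add: N.scaleR res_scale distrib_left)
  show "\<bar>BN u x + res u x\<bar> \<le> (sqrt (BN u u) + sqrt (As (u - proj u) (u - proj u))) * sqrt (E x x)" if "x \<in> XS" for x
    using BN_bound[OF u XS_X[OF that]] res_bound[OF u XS_X[OF that]] by (simp add: distrib_right)
qed (rule BN_low)

text \<open>The comparison function of the error estimate: what the method would compute if
  \<open>res\<close> vanished.\<close>

lemma galerkin_projection_exists:
  assumes u: "u \<in> X"
  obtains p where "p \<in> XS" "\<And>w. w \<in> XS \<Longrightarrow> BN p w = BN u w"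
proof -
  interpret N: psd_form X BN by (rule BN_psd)
  have "\<exists>!z. z \<in> XS \<and> (\<forall>w\<in>XS. BN z w = BN u w)"
  proof (rule variational_problem_ex1[OF XS BN_psd])
    show "0 < g\<^sup>2" using g by simp
    show "BN w w \<le> 1 * E w w" if "w \<in> XS" for w using BN_up[OF XS_X[OF that]] by simp
    show "\<bar>BN u x\<bar> \<le> sqrt (BN u u) * sqrt (E x x)" if "x \<in> XS" for x
      by (rule BN_bound[OF u XS_X[OF that]])
  qed (use u XS_X BN_low N.addR N.scaleR in auto)
  then show ?thesis using that by blast
qed

text \<open>The error is split at the Galerkin projection p. Quasi-optimality gives u - p the factor
  1/g; the remainder z - p solves the discrete problem with right side \<open>res\<close>, and
  dividing by the lower bound \<open>g^2\<close> of \<open>BN\<close> gives the second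
  power.\<close>

lemma ben_error:
  assumes u: "u \<in> X" and z: "ben_solution T j a \<beta> XS YS (opB T j a u) (\<gamma> 0 u) z"
    and w: "w \<in> XS" and v: "v \<in> YS"
  shows "sqrt (E (u - z) (u - z)) \<le> (inverse g)\<^sup>2 * (sqrt (E (u - w) (u - w)) + sqrt (As (u - v) (u - v)))"
proof -
  interpret N: psd_form X BN by (rule BN_psd)
  have zS: "z \<in> XS" and zN: "\<And>w. w \<in> XS \<Longrightarrow> BN z w = BN u w + res u w"
    using z by (auto simp: ben_solution_iff[OF u])
  obtain p where p: "p \<in> XS" "\<And>w. w \<in> XS \<Longrightarrow> BN p w = BN u w"
    using galerkin_projection_exists[OF u] by blast
  define d where "d = z - p"
  have d: "d \<in> XS" unfolding d_def using zS p(1) by (rule subspace_diff[OF XS(2)])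
  have X: "z \<in> X" "p \<in> X" "d \<in> X" using zS p(1) d XS_X by auto
  have ig: "1 \<le> inverse g" using g by (simp add: one_le_inverse)
  have 1: "sqrt (E (u - p) (u - p)) \<le> inverse g * sqrt (E (u - w) (u - w))"
  proof (rule galerkin_quasi_optimal[OF XS(1,2) BN_psd ig])
    show "0 < g\<^sup>2" "1 \<le> g\<^sup>2 * (inverse g)\<^sup>2" using g by (auto simp: power_inverse)
    show "BN x x \<le> 1 * E x x" if "x \<in> X" for x using BN_up[OF that] by simp
  qed (use u p w BN_low in auto)
  let ?n = "sqrt (As (u - proj u) (u - proj u))"
  have "g\<^sup>2 * E d d \<le> BN d d" by (rule BN_low[OF d])
  also have "\<dots> = res u d" using zN[OF d] p(2)[OF d] X by (simp add: N.diffL d_def)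
  also have "\<dots> \<le> ?n * sqrt (E d d)" using res_bound[OF u X(3)] by simp
  finally have "g\<^sup>2 * sqrt (E d d) * sqrt (E d d) \<le> ?n * sqrt (E d d)"
    using E.nonneg[OF X(3)] by (simp add: mult.assoc)
  moreover have n0: "0 \<le> ?n"
    using As.nonneg X_subset_Y[OF u] YS_Y[OF proj(1)[OF X_subset_Y[OF u]]] by simp
  ultimately have "g\<^sup>2 * sqrt (E d d) \<le> ?n"
    using E.nonneg[OF X(3)] by (cases "sqrt (E d d) = 0") (auto simp: mult_le_cancel_right)
  then have 2: "sqrt (E d d) \<le> (inverse g)\<^sup>2 * ?n" using g by (simp add: power_inverse field_simps)
  have 3: "?n \<le> sqrt (As (u - v) (u - v))"
    by (intro real_sqrt_le_mono proj_best X_subset_Y u v)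
  have "E (u - z) (u - z) = E ((u - p) + (- d)) ((u - p) + (- d))" by (simp add: d_def)
  then have "sqrt (E (u - z) (u - z)) \<le> sqrt (E (u - p) (u - p)) + sqrt (E (- d) (- d))"
    using E.triangle[of "u - p" "- d"] u X E.scale_closed[OF X(3), of "-1"] by simp
  also have "E (- d) (- d) = E d d" using E.square_scale[OF X(3), of "-1"] by simp
  also have "sqrt (E (u - p) (u - p)) + sqrt (E d d) \<le>
      inverse g * sqrt (E (u - w) (u - w)) + (inverse g)\<^sup>2 * sqrt (As (u - v) (u - v))"
    using 1 2 mult_left_mono[OF 3, of "(inverse g)\<^sup>2"] by simp
  \<comment> \<open>As 1/g is at least 1, the better factor of the Galerkin part is weakened to the
    common one.\<close>
  also have "inverse g * sqrt (E (u - w) (u - w)) \<le> (inverse g)\<^sup>2 * sqrt (E (u - w) (u - w))"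
    using mult_left_mono[OF ig, of "inverse g"] g E.nonneg[OF X_diff[OF u XS_X[OF w]]]
    by (intro mult_right_mono) (auto simp: power2_eq_square)
  finally show ?thesis by (simp add: distrib_left)
qed

end

text \<open>Positivity excludes infinite values of the extended infimum, which would be converted to
  0, and the minimum with 1 bounds the constant. Dual norms are then rewritten by Riesz
  representatives.\<close>

lemma (in parabolic) gammaC_bounds:
  assumes gamma: "gammaC T j a \<Delta> Xd Yd > 0" and \<delta>: "\<delta> \<in> \<Delta>"
    and Xd: "Xd \<delta> \<subseteq> X" "subspace (Xd \<delta>)" and Yd: "closed_sub (Yd \<delta>)" "Yd \<delta> \<noteq> {0}"
  shows "gammaC T j a \<Delta> Xd Yd \<le> 1"
    "\<And>w. w \<in> Xd \<delta> \<Longrightarrow>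
      gammaC T j a \<Delta> Xd Yd * sqrt (As (c Y w) (c Y w)) \<le> sqrt (As (c (Yd \<delta>) w) (c (Yd \<delta>) w))"
proof -
  let ?g = "gammaC T j a \<Delta> Xd Yd"
  define Q where "Q \<delta> w = dual_norm T a (Yd \<delta>) (restrict (opC T j a w) (Yd \<delta>)) / dual_norm T a Y (opC T j a w)" for \<delta> w
  define I where "I = (INF \<delta>\<in>\<Delta>. INF w\<in>{w \<in> Xd \<delta>. w \<noteq> 0 \<and> opC T j a w \<noteq> (\<lambda>v\<in>Y. 0)}. ereal (Q \<delta> w))"
  have geq: "?g = real_of_ereal (min 1 I)" by (simp add: gammaC_def I_def Q_def)
  then have e: "ereal ?g = min 1 I"
    using gamma by (cases "min 1 I") auto
  have "ereal ?g \<le> 1" unfolding e by simp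
  then show "?g \<le> 1" by (simp add: one_ereal_def)
  fix w assume w: "w \<in> Xd \<delta>"
  then have wX: "w \<in> X" using Xd by blast
  have sub: "Yd \<delta> \<subseteq> Y" using Yd by (simp add: closed_sub_def)
  have n: "0 \<le> As (c Y w) (c Y w)" "0 \<le> As (c (Yd \<delta>) w) (c (Yd \<delta>) w)"
    using As.nonneg c_mem_Y[OF _ wX] closed_sub_Y Yd(1) by auto
  show "?g * sqrt (As (c Y w) (c Y w)) \<le> sqrt (As (c (Yd \<delta>) w) (c (Yd \<delta>) w))"
  \<comment> \<open>Functions with Cw = 0 do not take part in the infimum; for them the left side is
    0.\<close>
  proof (cases "As (c Y w) (c Y w) = 0")
    case True
    then show ?thesis using n by simp
  next
    case False
    have "c Y w \<noteq> 0" using False As.zeroL[OF As.zero_closed] by auto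
    have C0: "c Y w = 0" if "\<And>v. v \<in> Y \<Longrightarrow> C w v = 0"
      unfolding c_def using that As.zero_closed
      by (intro \<rho>_eqI[OF closed_sub_Y functional_C_sub[OF closed_sub_Y wX]]) auto
    have "opC T j a w \<noteq> (\<lambda>v\<in>Y. 0)"
    proof
      assume eq: "opC T j a w = (\<lambda>v\<in>Y. 0)"
      have "C w v = 0" if "v \<in> Y" for v using fun_cong[OF eq, of v] that by (simp add: opC_eq wX)
      then show False using C0 \<open>c Y w \<noteq> 0\<close> by blast
    qed
    moreover have "w \<noteq> 0"
    proof
      assume "w = 0"
      then have "c Y w = 0" using c_scale[OF closed_sub_Y wX, of 0] by simp
      then show False using \<open>c Y w \<noteq> 0\<close> by simp
    qed
    ultimately have "I \<le> ereal (Q \<delta> w)"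
      unfolding I_def using \<delta> w by (intro INF_lower2[OF \<delta>] INF_lower) auto
    then have "ereal ?g \<le> ereal (Q \<delta> w)" unfolding e by (simp add: min.coboundedI2)
    then have gQ: "?g \<le> Q \<delta> w" by simp
    have Y0: "Y \<noteq> {0}"
    proof -
      obtain v where "v \<in> Yd \<delta>" "v \<noteq> 0"
        using Yd subspace_0[of "Yd \<delta>"] unfolding closed_sub_def by blast
      then show ?thesis using sub by blast
    qed
    have "dual_norm T a Y (opC T j a w) = sqrt (As (c Y w) (c Y w))"
      unfolding c_def by (rule dual_norm_eq[OF closed_sub_Y Y0 functional_C_sub[OF closed_sub_Y wX]]) (simp add: opC_eq wX)
    moreover have "dual_norm T a (Yd \<delta>) (restrict (opC T j a w) (Yd \<delta>)) = sqrt (As (c (Yd \<delta>) w) (c (Yd \<delta>) w))"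
      unfolding c_def using sub
      by (intro dual_norm_eq[OF Yd functional_C_sub[OF Yd(1) wX]]) (auto simp: opC_eq wX)
    ultimately show ?thesis
      using gQ False n by (simp add: Q_def pos_le_divide_eq)
  qed
qed

lemma le_mult_INF:
  fixes f :: "'a \<Rightarrow> real"
  assumes "S \<noteq> {}" "0 < k" "\<And>w. w \<in> S \<Longrightarrow> x \<le> k * f w"
  shows "x \<le> k * (INF w\<in>S. f w)"
proof -
  have "x / k \<le> (INF w\<in>S. f w)"
    using assms by (intro cINF_greatest) (auto simp: pos_divide_le_eq mult.commute)
  then show ?thesis using assms(2) by (simp add: pos_divide_le_eq mult.commute)
qed

text \<open>The bound holds for every pair, so the infima can be taken in turn with the other
  argument fixed.\<close>

lemma le_mult_INF_add_INF:
  fixes f h :: "'a \<Rightarrow> real"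
  assumes "S \<noteq> {}" "S' \<noteq> {}" "0 < k" "\<And>w v. w \<in> S \<Longrightarrow> v \<in> S' \<Longrightarrow> x \<le> k * (f w + h v)"
  shows "x \<le> k * ((INF w\<in>S. f w) + (INF v\<in>S'. h v))"
proof -
  have "x / k - (INF w\<in>S. f w) \<le> h v" if v: "v \<in> S'" for v
  proof -
    have "x / k - h v \<le> (INF w\<in>S. f w)"
      using assms v by (intro cINF_greatest) (auto simp: algebra_simps pos_divide_le_eq)
    then show ?thesis by simp
  qed
  then have "x / k - (INF w\<in>S. f w) \<le> (INF v\<in>S'. h v)" using assms(2) by (intro cINF_greatest)
  then have "x / k \<le> (INF w\<in>S. f w) + (INF v\<in>S'. h v)" by simp
  then show ?thesis using assms(3) by (simp add: pos_divide_le_eq mult.commute)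
qed

theorem theorem6p1:
  fixes T \<beta> :: real
    and j :: "'v::{real_inner,complete_space,second_countable_topology} \<Rightarrow>
              'h::{real_inner,complete_space,second_countable_topology}"
    and a :: "real \<Rightarrow> 'v \<Rightarrow> 'v \<Rightarrow> real"
    and \<Delta> :: "'d set"
    and Xd Yd :: "'d \<Rightarrow> 'v l2 set"
    and g :: "'v l2 \<Rightarrow> real" and u0 :: 'h and u :: "'v l2"
  assumes T: "T > 0"
    and j: "dense_embedding j"
    and a: "admissible_form T a"
    and Xd: "\<And>\<delta>. \<delta> \<in> \<Delta> \<Longrightarrow>
      Xd \<delta> \<subseteq> spaceX T j \<and> subspace (Xd \<delta>) \<and> closed_in_X T j (Xd \<delta>) \<and> Xd \<delta> \<noteq> {0}"
    and Yd: "\<And>\<delta>. \<delta> \<in> \<Delta> \<Longrightarrow>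
      Yd \<delta> \<subseteq> L2I T \<and> subspace (Yd \<delta>) \<and> closed (Yd \<delta>) \<and> Yd \<delta> \<noteq> {0}"
    and gamma: "gammaC T j a \<Delta> Xd Yd > 0"
    and beta: "\<beta> \<ge> 1"
    and g: "g \<in> dual (L2I T)"
    and u: "u \<in> spaceX T j" "opB T j a u = g" "time_trace T j 0 u = u0"
  shows
    "(\<forall>(K :: 'd \<Rightarrow> ('v l2 \<Rightarrow> real) \<Rightarrow> 'v l2) r R.
        (\<forall>\<delta>\<in>\<Delta>. Xd \<delta> \<subseteq> Yd \<delta>) \<longrightarrow>
        (\<forall>\<delta>\<in>\<Delta>. symmetric_boundedly_invertible T a (Yd \<delta>) (K \<delta>)) \<longrightarrow>
        0 < r \<longrightarrow> r \<le> R \<longrightarrow>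
        (\<forall>\<delta>\<in>\<Delta>. \<forall>v\<in>Yd \<delta>.
           r * opAs T a v v \<le> inv_into (dual (Yd \<delta>)) (K \<delta>) v v \<and>
           inv_into (dual (Yd \<delta>)) (K \<delta>) v v \<le> R * opAs T a v v) \<longrightarrow>
        (\<forall>\<delta>\<in>\<Delta>.
           (\<exists>!z. mr_solution T j a \<beta> (Xd \<delta>) (Yd \<delta>) (K \<delta>) g u0 z) \<and>
           (\<forall>z. mr_solution T j a \<beta> (Xd \<delta>) (Yd \<delta>) (K \<delta>) g u0 z \<longrightarrow>
              energy_norm T j a \<beta> (u - z) \<le>
                sqrt (max R 1 / min r 1) * inverse (gammaC T j a \<Delta> Xd Yd) *
                (INF w\<in>Xd \<delta>. energy_norm T j a \<beta> (u - w))))) \<and>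
     (\<forall>\<delta>\<in>\<Delta>.
        (\<exists>!z. ben_solution T j a \<beta> (Xd \<delta>) (Yd \<delta>) g u0 z) \<and>
        (\<forall>z. ben_solution T j a \<beta> (Xd \<delta>) (Yd \<delta>) g u0 z \<longrightarrow>
           energy_norm T j a \<beta> (u - z) \<le>
             (inverse (gammaC T j a \<Delta> Xd Yd))\<^sup>2 *
             ((INF w\<in>Xd \<delta>. energy_norm T j a \<beta> (u - w)) +
              (INF v\<in>Yd \<delta>. normY T a (u - v)))))"
proof -
  interpret energy j T a \<beta>
    by unfold_locales (fact j T a beta)+
  let ?g = "gammaC T j a \<Delta> Xd Yd"
  have uX: "u \<in> X" by (fact u(1))
  \<comment> \<open>The infimum over the whole family serves as inf-sup constant of each single
    member.\<close>
  have disc: "discretisation j T a \<beta> (Xd \<delta>) (Yd \<delta>) ?g" if \<delta>: "\<delta> \<in> \<Delta>" for \<delta>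
  proof -
    have x: "Xd \<delta> \<subseteq> X" "subspace (Xd \<delta>)" "closed_in_X T j (Xd \<delta>)"
      and y: "closed_sub (Yd \<delta>)" "Yd \<delta> \<noteq> {0}"
      using Xd[OF \<delta>] Yd[OF \<delta>] by (auto simp: closed_sub_def)
    show ?thesis
      by unfold_locales (use x y gamma gammaC_bounds[OF gamma \<delta> x(1,2) y] in auto)
  qed
  have en: "energy_norm T j a \<beta> (u - w) = sqrt (E (u - w) (u - w))"
    and wX: "w \<in> X" if \<delta>: "\<delta> \<in> \<Delta>" and w: "w \<in> Xd \<delta>" for \<delta> w
  proof -
    interpret discretisation j T a \<beta> "Xd \<delta>" "Yd \<delta>" ?g by (rule disc[OF \<delta>])
    show "w \<in> X" by (rule XS_X[OF w])
    then show "energy_norm T j a \<beta> (u - w) = sqrt (E (u - w) (u - w))"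
      by (intro energy_norm_eq Y_nontrivial X_diff uX)
  qed
  show ?thesis
  proof (intro conjI allI impI ballI)
    fix K :: "'d \<Rightarrow> ('v l2 \<Rightarrow> real) \<Rightarrow> 'v l2" and r R \<delta>
    assume sub: "\<forall>\<delta>\<in>\<Delta>. Xd \<delta> \<subseteq> Yd \<delta>"
      and K: "\<forall>\<delta>\<in>\<Delta>. symmetric_boundedly_invertible T a (Yd \<delta>) (K \<delta>)"
      and r: "0 < r" and R: "r \<le> R"
      and b: "\<forall>\<delta>\<in>\<Delta>. \<forall>v\<in>Yd \<delta>. r * opAs T a v v \<le> inv_into (dual (Yd \<delta>)) (K \<delta>) v v \<and>
        inv_into (dual (Yd \<delta>)) (K \<delta>) v v \<le> R * opAs T a v v"
      and \<delta>: "\<delta> \<in> \<Delta>"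
    interpret discretisation j T a \<beta> "Xd \<delta>" "Yd \<delta>" ?g by (rule disc[OF \<delta>])
    interpret preconditioned j T a \<beta> "Xd \<delta>" "Yd \<delta>" ?g "K \<delta>" r R
    proof
      fix v assume v: "v \<in> Yd \<delta>"
      show "r * As v v \<le> inv_into (dual (Yd \<delta>)) (K \<delta>) v v" "inv_into (dual (Yd \<delta>)) (K \<delta>) v v \<le> R * As v v"
        using b[rule_format, OF \<delta> v] unfolding opAs_eq[OF YS_Y[OF v] YS_Y[OF v]] by auto
    qed (use sub K r R \<delta> in auto)
    show "\<exists>!z. mr_solution T j a \<beta> (Xd \<delta>) (Yd \<delta>) (K \<delta>) g u0 z"
      using mr_solution_ex1[OF uX] by (simp add: u)
    fix z assume "mr_solution T j a \<beta> (Xd \<delta>) (Yd \<delta>) (K \<delta>) g u0 z"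
    then have z: "mr_solution T j a \<beta> (Xd \<delta>) (Yd \<delta>) (K \<delta>) (opB T j a u) (\<gamma> 0 u) z" by (simp add: u)
    then have zX: "z \<in> Xd \<delta>" by (simp add: mr_solution_def)
    show "energy_norm T j a \<beta> (u - z) \<le> sqrt (max R 1 / min r 1) * inverse ?g * (INF w\<in>Xd \<delta>. energy_norm T j a \<beta> (u - w))"
    proof (rule le_mult_INF)
      show "0 < sqrt (max R 1 / min r 1) * inverse ?g"
        using gamma r by (auto simp: less_max_iff_disj)
      show "energy_norm T j a \<beta> (u - z) \<le> sqrt (max R 1 / min r 1) * inverse ?g * energy_norm T j a \<beta> (u - w)"
        if w: "w \<in> Xd \<delta>" for w
        using mr_error[OF uX z w] by (simp only: en[OF \<delta> zX] en[OF \<delta> w])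
    qed (use zX in auto)
  next
    fix \<delta> assume \<delta>: "\<delta> \<in> \<Delta>"
    interpret discretisation j T a \<beta> "Xd \<delta>" "Yd \<delta>" ?g by (rule disc[OF \<delta>])
    show "\<exists>!z. ben_solution T j a \<beta> (Xd \<delta>) (Yd \<delta>) g u0 z"
      using ben_solution_ex1[OF uX] by (simp add: u)
    fix z assume "ben_solution T j a \<beta> (Xd \<delta>) (Yd \<delta>) g u0 z"
    then have z: "ben_solution T j a \<beta> (Xd \<delta>) (Yd \<delta>) (opB T j a u) (\<gamma> 0 u) z" by (simp add: u)
    then have zX: "z \<in> Xd \<delta>" by (simp add: ben_solution_def)
    show "energy_norm T j a \<beta> (u - z) \<le> (inverse ?g)\<^sup>2 *
      ((INF w\<in>Xd \<delta>. energy_norm T j a \<beta> (u - w)) + (INF v\<in>Yd \<delta>. normY T a (u - v)))"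
    proof (rule le_mult_INF_add_INF)
      show "0 < (inverse ?g)\<^sup>2" using gamma by simp
      show "energy_norm T j a \<beta> (u - z) \<le> (inverse ?g)\<^sup>2 * (energy_norm T j a \<beta> (u - w) + normY T a (u - v))"
        if w: "w \<in> Xd \<delta>" and v: "v \<in> Yd \<delta>" for w v
        using ben_error[OF uX z w v] X_subset_Y[OF uX] YS_Y[OF v]
        by (simp only: en[OF \<delta> zX] en[OF \<delta> w] normY_eq As.diff_closed)
      show "Yd \<delta> \<noteq> {}" using Yd[OF \<delta>] subspace_0 by blast
    qed (use zX in auto)
  qed
qed

end
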